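(* We have the following identifications: $$\dot B^{\alpha}_{p,q}(\mathbb Z)=\dot B^{\alpha,\Delta_d}_{p,q}(\mathbb Z),\qquad 0<p,q\le\infty,\ \alpha\in\mathbb R,$$ and $$\dot F^{\alpha}_{p,q}(\mathbb Z)=\dot F^{\alpha,\Delta_d}_{p,q}(\mathbb Z),\qquad 0<p<\infty,\ 0<q\le\infty,\ \alpha\in\mathbb R.$$
   Context: $\mathbb Z^-=\{-1,-2,\dots\}$, $\mathbb N=\{0,1,2,\dots\}$; functions are complex valued; usual modifications (suprema) are made when $p$ or $q$ is $\infty$. The discrete Laplacian is $\Delta_d f(n)=-f(n+1)+2f(n)-f(n-1)$, a nonnegative self-adjoint operator on $\ell^2(\mathbb Z)$ with spectrum in $[0,4]$. For bounded Borel $F$, $F(\sqrt{\Delta_d})$ has kernel $F(\sqrt{\Delta_d})(m,n)=\frac1{2\pi}\int_{-\pi}^{\pi}F(\sqrt{2(1-\cos\theta)})e^{-i(m-n)\theta}d\theta$. $\mathcal S(\mathbb Z)$: functions $f$ on $\mathbb Z$ with $\|f\|_m=\sup_n(1+|n|)^m\sup_{0\le\ell\le m}|\Delta_d^\ell f(n)|<\infty$ for all $m\in\mathbb N$, topologized by these seminorms; $\mathcal S'(\mathbb Z)$ is its dual. $\mathcal P(\mathbb Z)$: restrictions to $\mathbb Z$ of polynomials. $\mathcal S_\infty(\mathbb Z)$: all $f\in\mathcal S(\mathbb Z)$ such that for each $k\in\mathbb N$ there is a (unique) $g_k\in\mathcal S(\mathbb Z)$ with $f=\Delta_d^kg_k$,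 topologized by $\|f\|_{m,k}=\|g_k\|_m$. Its dual $\mathcal S_\infty'(\mathbb Z)$ is identified with $\mathcal S'(\mathbb Z)/\mathcal P(\mathbb Z)$. For a Schwartz function $\psi\in\mathcal S(\mathbb R)$ supported in $[2,8]$, $t>0$ and $f\in\mathcal S_\infty'(\mathbb Z)$, $\psi(t\sqrt{\Delta_d})f(n)=\langle\psi(t\sqrt{\Delta_d})(n,\cdot),f\rangle$ (the kernels lie in $\mathcal S_\infty(\mathbb Z)$). Spaces adapted to $\Delta_d$: a partition of unity is $\psi\in\mathcal S(\mathbb R)$ with $\operatorname{supp}\psi\subset[2,8]$, $\int\psi(\xi)\frac{d\xi}\xi\ne0$ and $\sum_{j\in\mathbb Z}\psi_j(\lambda)=1$ on $(0,\infty)$, $\psi_j(\lambda)=\psi(2^{-j}\lambda)$. For a partition of unity $\psi$ (different choices give equivalent quasi-norms), $\dot B^{\alpha,\Delta_d}_{p,q}(\mathbb Z)$ and $\dot F^{\alpha,\Delta_d}_{p,q}(\mathbb Z)$ are the spaces of $f\in\mathcal S'(\mathbb Z)/\mathcal P(\mathbb Z)$ for which, respectively, $\|f\|_{\dot B^{\alpha,\Delta_d}_{p,q}(\mathbb Z)}=\big\{\sum_{j\in\mathbb Z^-}(2^{j\alpha}\|\psi_j(\sqrt{\Delta_d})f\|_{\ell^p(\mathbb Z)})^q\big\}^{1/q}$ and $\|f\|_{\dot F^{\alpha,\Delta_d}_{p,q}(\mathbb Z)}=\big\|\big[\sum_{j\in\mathbb Z^-}(2^{j\alpha}|\psi_j(\sqrt{\Delta_d})f|)^q\big]^{1/q}\big\|_{\ell^p(\mathbb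 Z)}$ are finite. Classical spaces: $\mathcal F_{\mathbb Z}(f)(\theta)=\sum_{n\in\mathbb Z}f(n)e^{in\theta}$, $\theta\in[-\pi,\pi]$. A family $(\varphi_\nu,\psi_\nu)_{\nu\in\mathbb Z,\nu\le0}$ in $\mathcal S(\mathbb Z)\times\mathcal S(\mathbb Z)$ is an admissible pair if: (i) $\operatorname{supp}\mathcal F_{\mathbb Z}(\varphi_\nu),\operatorname{supp}\mathcal F_{\mathbb Z}(\psi_\nu)\subset[-2^\nu\pi,2^\nu\pi]\setminus[-2^{\nu-2}\pi,2^{\nu-2}\pi]$; (ii) $\sum_{\nu\le0}\overline{\mathcal F_{\mathbb Z}(\varphi_\nu)(x)}\,\mathcal F_{\mathbb Z}(\psi_\nu)(x)=1$ for $x\in[-\pi,\pi]\setminus\{0\}$; (iii) there are constants $A>0$ and $A_k$, $k\ge0$, independent of $\nu$, such that $|\partial_x^k\mathcal F_{\mathbb Z}(\varphi_\nu)(x)|,|\partial_x^k\mathcal F_{\mathbb Z}(\psi_\nu)(x)|\le A_k2^{-k\nu}$ for all $x\in[-\pi,\pi]$, $k\in\mathbb N$, and $|\mathcal F_{\mathbb Z}(\varphi_\nu)(x)|,|\mathcal F_{\mathbb Z}(\psi_\nu)(x)|\ge A$ for $x\in T_\nu$, where $T_0=[-\pi,\pi]\setminus[-\frac38\pi,\frac38\pi]$ and $T_\nu=[-3\cdot2^{\nu-2}\pi,3\cdot2^{\nu-2}\pi]\setminus[-3\cdot2^{\nu-3}\pi,3\cdot2^{\nu-3}\pi]$ for $\nu\le-1$.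 With an admissible pair fixed and $\varphi_\nu*f(n)=\sum_m\varphi_\nu(n-m)f(m)$, $\dot B^\alpha_{p,q}(\mathbb Z)$ and $\dot F^\alpha_{p,q}(\mathbb Z)$ are the spaces of $f\in\mathcal S'(\mathbb Z)/\mathcal P(\mathbb Z)$ with, respectively, finite quasi-norms $\|f\|_{\dot B^\alpha_{p,q}(\mathbb Z)}=\big(\sum_{\nu\le0}(2^{\nu\alpha}\|\varphi_\nu*f\|_{\ell^p(\mathbb Z)})^q\big)^{1/q}$ and $\|f\|_{\dot F^\alpha_{p,q}(\mathbb Z)}=\big\|\big[\sum_{\nu\le0}(2^{\nu\alpha}|\varphi_\nu*f|)^q\big]^{1/q}\big\|_{\ell^p(\mathbb Z)}$. *)

theory Defs
  imports "HOL-Analysis.Analysis" "HOL-Computational_Algebra.Polynomial"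
begin

section \<open>Sequence quasi-norms\<close>

definition ennpow :: "ennreal \<Rightarrow> real \<Rightarrow> ennreal" where
  "ennpow x r = (if x = \<infinity> then \<infinity> else ennreal (enn2real x powr r))"

text \<open>The \<open>\<ell>\<^sup>p\<close> quasi-norm over the index set \<open>I\<close>, for \<open>0 < p \<le> \<infinity>\<close>; the value may be \<open>\<infinity>\<close>.
  The integral over the counting measure is the (unordered) sum over \<open>I\<close>.\<close>

definition lpnorm :: "ennreal \<Rightarrow> 'i set \<Rightarrow> ('i \<Rightarrow> ennreal) \<Rightarrow> ennreal" where
  "lpnorm p I g =
     (if p = \<infinity> then (SUP i\<in>I. g i)
      else ennpow (\<integral>\<^sup>+ i. ennpow (g i) (enn2real p) \<partial>count_space I) (1 / enn2real p))"


section \<open>Schwartz functions and distributions on the integers\<close>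

definition lap :: "(int \<Rightarrow> complex) \<Rightarrow> int \<Rightarrow> complex" where
  "lap f n = - f (n + 1) + 2 * f n - f (n - 1)"

definition schwartz_seminorm :: "nat \<Rightarrow> (int \<Rightarrow> complex) \<Rightarrow> ennreal" where
  "schwartz_seminorm m f =
     (SUP n. ennreal ((1 + \<bar>real_of_int n\<bar>) ^ m) * (SUP l\<in>{0..m}. ennreal (cmod ((lap ^^ l) f n))))"

definition schwartz :: "(int \<Rightarrow> complex) set" where
  "schwartz = {f. \<forall>m. schwartz_seminorm m f < \<infinity>}"

definition schwartz_topology :: "(int \<Rightarrow> complex) topology" where
  "schwartz_topology = topology_generated_by
     {{g \<in> schwartz. schwartz_seminorm m (\<lambda>n. g n - f n) < ennreal \<epsilon>} | f m \<epsilon>. f \<in> schwartz \<and> \<epsilon> > 0}"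

text \<open>The dual of \<open>schwartz\<close>; functionals are made total by the value \<open>0\<close> outside \<open>schwartz\<close>.\<close>

definition schwartz_dual :: "((int \<Rightarrow> complex) \<Rightarrow> complex) set" where
  "schwartz_dual = {u.
     (\<forall>f\<in>schwartz. \<forall>g\<in>schwartz. u (\<lambda>n. f n + g n) = u f + u g) \<and>
     (\<forall>c. \<forall>f\<in>schwartz. u (\<lambda>n. c * f n) = c * u f) \<and>
     continuous_map schwartz_topology euclidean u \<and>
     (\<forall>f. f \<notin> schwartz \<longrightarrow> u f = 0)}"

definition int_polynomials :: "(int \<Rightarrow> complex) set" where
  "int_polynomials = {\<lambda>n. poly P (of_int n) | P :: complex poly. True}"

text \<open>\<open>u\<close> and \<open>v\<close> differ by the functional \<open>f \<mapsto> \<Sum>\<^sub>n P n * f n\<close> of a polynomial \<open>P\<close>.\<close>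

definition poly_rel :: "(((int \<Rightarrow> complex) \<Rightarrow> complex) \<times> ((int \<Rightarrow> complex) \<Rightarrow> complex)) set" where
  "poly_rel = {(u, v). u \<in> schwartz_dual \<and> v \<in> schwartz_dual \<and>
     (\<exists>P\<in>int_polynomials. \<forall>f\<in>schwartz. u f - v f = (\<Sum>\<^sub>\<infinity>n. P n * f n))}"

definition dist_mod_poly :: "((int \<Rightarrow> complex) \<Rightarrow> complex) set set" where
  "dist_mod_poly = schwartz_dual // poly_rel"

definition schwartz_inf :: "(int \<Rightarrow> complex) set" where
  "schwartz_inf = {f \<in> schwartz. \<forall>k. \<exists>g\<in>schwartz. f = (lap ^^ k) g}"

text \<open>A representative of a class. The operators below do not depend on this choice, because they
  only pair it with functions in \<open>schwartz_inf\<close>, which annihilate polynomials.\<close>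

definition dist_rep :: "((int \<Rightarrow> complex) \<Rightarrow> complex) set \<Rightarrow> (int \<Rightarrow> complex) \<Rightarrow> complex" where
  "dist_rep U = (SOME u. u \<in> U)"

text \<open>The identification of distributions modulo polynomials with functionals on \<open>schwartz_inf\<close>,
  by restriction.\<close>

definition dual_inf_of :: "((int \<Rightarrow> complex) \<Rightarrow> complex) set \<Rightarrow> (int \<Rightarrow> complex) \<Rightarrow> complex" where
  "dual_inf_of U f = (if f \<in> schwartz_inf then dist_rep U f else 0)"

text \<open>The function \<open>m \<mapsto> u(m)\<close> of a distribution \<open>u\<close> on the integers, namely \<open>u\<close> at the unit
  sequence of \<open>m\<close>.\<close>

definition dist_fun :: "((int \<Rightarrow> complex) \<Rightarrow> complex) \<Rightarrow> int \<Rightarrow> complex" where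
  "dist_fun u m = u (\<lambda>n. of_bool (n = m))"


section \<open>Schwartz functions on the real line\<close>

abbreviation iter_deriv :: "nat \<Rightarrow> (real \<Rightarrow> complex) \<Rightarrow> real \<Rightarrow> complex" where
  "iter_deriv k f \<equiv> ((\<lambda>g x. vector_derivative g (at x)) ^^ k) f"

definition real_schwartz :: "(real \<Rightarrow> complex) set" where
  "real_schwartz = {f.
     (\<forall>k x. iter_deriv k f differentiable (at x)) \<and>
     (\<forall>m k. \<exists>C. \<forall>x. \<bar>x\<bar> ^ m * cmod (iter_deriv k f x) \<le> C)}"


section \<open>Spaces adapted to the discrete Laplacian\<close>

definition partition_of_unity :: "(real \<Rightarrow> complex) \<Rightarrow> bool" where
  "partition_of_unity \<psi> \<longleftrightarrow>
     \<psi> \<in> real_schwartz \<and>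
     closure {\<xi>. \<psi> \<xi> \<noteq> 0} \<subseteq> {2..8} \<and>
     (LBINT \<xi>:{0<..}. \<psi> \<xi> / of_real \<xi>) \<noteq> 0 \<and>
     (\<forall>x>0. ((\<lambda>j::int. \<psi> (2 powi (- j) * x)) has_sum 1) UNIV)"

text \<open>The kernel of \<open>F(\<surd>lap)\<close>.\<close>

definition sqrt_lap_kernel :: "(real \<Rightarrow> complex) \<Rightarrow> int \<Rightarrow> int \<Rightarrow> complex" where
  "sqrt_lap_kernel F m n =
     1 / (2 * of_real pi) *
     (LBINT \<theta>:{-pi..pi}. F (sqrt (2 * (1 - cos \<theta>))) * exp (- \<i> * of_int (m - n) * of_real \<theta>))"

definition sqrt_lap_op ::
    "(real \<Rightarrow> complex) \<Rightarrow> ((int \<Rightarrow> complex) \<Rightarrow> complex) set \<Rightarrow> int \<Rightarrow> complex" where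
  "sqrt_lap_op F U n = dual_inf_of U (sqrt_lap_kernel F n)"

abbreviation dyadic_op ::
    "(real \<Rightarrow> complex) \<Rightarrow> int \<Rightarrow> ((int \<Rightarrow> complex) \<Rightarrow> complex) set \<Rightarrow> int \<Rightarrow> complex" where
  "dyadic_op \<psi> j U \<equiv> sqrt_lap_op (\<lambda>x. \<psi> (2 powi (- j) * x)) U"

definition besov_lap_norm ::
    "(real \<Rightarrow> complex) \<Rightarrow> real \<Rightarrow> ennreal \<Rightarrow> ennreal \<Rightarrow> ((int \<Rightarrow> complex) \<Rightarrow> complex) set \<Rightarrow> ennreal" where
  "besov_lap_norm \<psi> \<alpha> p q U =
     lpnorm q {j::int. j < 0} (\<lambda>j. ennreal (2 powr (of_int j * \<alpha>)) *
       lpnorm p UNIV (\<lambda>n. ennreal (cmod (dyadic_op \<psi> j U n))))"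

definition triebel_lap_norm ::
    "(real \<Rightarrow> complex) \<Rightarrow> real \<Rightarrow> ennreal \<Rightarrow> ennreal \<Rightarrow> ((int \<Rightarrow> complex) \<Rightarrow> complex) set \<Rightarrow> ennreal" where
  "triebel_lap_norm \<psi> \<alpha> p q U =
     lpnorm p UNIV (\<lambda>n. lpnorm q {j::int. j < 0} (\<lambda>j.
       ennreal (2 powr (of_int j * \<alpha>)) * ennreal (cmod (dyadic_op \<psi> j U n))))"

definition besov_lap where
  "besov_lap \<psi> \<alpha> p q = {U \<in> dist_mod_poly. besov_lap_norm \<psi> \<alpha> p q U < \<infinity>}"

definition triebel_lap where
  "triebel_lap \<psi> \<alpha> p q = {U \<in> dist_mod_poly. triebel_lap_norm \<psi> \<alpha> p q U < \<infinity>}"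


section \<open>Classical spaces\<close>

definition fourierZ :: "(int \<Rightarrow> complex) \<Rightarrow> real \<Rightarrow> complex" where
  "fourierZ f \<theta> = (\<Sum>\<^sub>\<infinity>n. f n * exp (\<i> * of_int n * of_real \<theta>))"

definition fourier_supp :: "(int \<Rightarrow> complex) \<Rightarrow> real set" where
  "fourier_supp f = closure {x \<in> {-pi..pi}. fourierZ f x \<noteq> 0}"

definition T_set :: "int \<Rightarrow> real set" where
  "T_set \<nu> =
     (if \<nu> = 0 then {-pi..pi} - {- (3 / 8 * pi)..3 / 8 * pi}
      else {- (3 * 2 powi (\<nu> - 2) * pi)..3 * 2 powi (\<nu> - 2) * pi}
         - {- (3 * 2 powi (\<nu> - 3) * pi)..3 * 2 powi (\<nu> - 3) * pi})"

definition admissible_pair :: "(int \<Rightarrow> int \<Rightarrow> complex) \<Rightarrow> (int \<Rightarrow> int \<Rightarrow> complex) \<Rightarrow> bool" where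
  "admissible_pair \<phi> \<eta> \<longleftrightarrow>
     (\<forall>\<nu>\<le>0. \<phi> \<nu> \<in> schwartz \<and> \<eta> \<nu> \<in> schwartz) \<and>
     (\<forall>\<nu>\<le>0. \<forall>f\<in>{\<phi> \<nu>, \<eta> \<nu>}. fourier_supp f \<subseteq>
        {- (2 powi \<nu> * pi)..2 powi \<nu> * pi} - {- (2 powi (\<nu> - 2) * pi)..2 powi (\<nu> - 2) * pi}) \<and>
     (\<forall>x\<in>{-pi..pi} - {0}.
        ((\<lambda>\<nu>. cnj (fourierZ (\<phi> \<nu>) x) * fourierZ (\<eta> \<nu>) x) has_sum 1) {..0}) \<and>
     (\<exists>(A::real) (Ak :: nat \<Rightarrow> real). A > 0 \<and>
        (\<forall>\<nu>\<le>0. \<forall>f\<in>{\<phi> \<nu>, \<eta> \<nu>}.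
           (\<forall>x\<in>{-pi..pi}. \<forall>k. cmod (iter_deriv k (fourierZ f) x) \<le> Ak k * 2 powi (- (int k * \<nu>))) \<and>
           (\<forall>x\<in>T_set \<nu>. A \<le> cmod (fourierZ f x))))"

definition conv_dist ::
    "(int \<Rightarrow> complex) \<Rightarrow> ((int \<Rightarrow> complex) \<Rightarrow> complex) set \<Rightarrow> int \<Rightarrow> complex" where
  "conv_dist f U n = (\<Sum>\<^sub>\<infinity>m. f (n - m) * dist_fun (dist_rep U) m)"

definition besov_norm ::
    "(int \<Rightarrow> int \<Rightarrow> complex) \<Rightarrow> real \<Rightarrow> ennreal \<Rightarrow> ennreal \<Rightarrow> ((int \<Rightarrow> complex) \<Rightarrow> complex) set \<Rightarrow> ennreal" where
  "besov_norm \<phi> \<alpha> p q U =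
     lpnorm q {\<nu>::int. \<nu> \<le> 0} (\<lambda>\<nu>. ennreal (2 powr (of_int \<nu> * \<alpha>)) *
       lpnorm p UNIV (\<lambda>n. ennreal (cmod (conv_dist (\<phi> \<nu>) U n))))"

definition triebel_norm ::
    "(int \<Rightarrow> int \<Rightarrow> complex) \<Rightarrow> real \<Rightarrow> ennreal \<Rightarrow> ennreal \<Rightarrow> ((int \<Rightarrow> complex) \<Rightarrow> complex) set \<Rightarrow> ennreal" where
  "triebel_norm \<phi> \<alpha> p q U =
     lpnorm p UNIV (\<lambda>n. lpnorm q {\<nu>::int. \<nu> \<le> 0} (\<lambda>\<nu>.
       ennreal (2 powr (of_int \<nu> * \<alpha>)) * ennreal (cmod (conv_dist (\<phi> \<nu>) U n))))"

definition besov where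
  "besov \<phi> \<alpha> p q = {U \<in> dist_mod_poly. besov_norm \<phi> \<alpha> p q U < \<infinity>}"

definition triebel where
  "triebel \<phi> \<alpha> p q = {U \<in> dist_mod_poly. triebel_norm \<phi> \<alpha> p q U < \<infinity>}"

definition equivalent_on :: "'a set \<Rightarrow> ('a \<Rightarrow> ennreal) \<Rightarrow> ('a \<Rightarrow> ennreal) \<Rightarrow> bool" where
  "equivalent_on X N M \<longleftrightarrow>
     (\<exists>C>0. \<forall>U\<in>X. N U \<le> ennreal C * M U \<and> M U \<le> ennreal C * N U)"

end

theory Submission
  imports Defs
begin

text \<open>
  Let \<open>u\<close> be a representative of a class of distributions and put \<open>v\<^sub>\<nu> = \<phi>\<^sub>\<nu> * u\<close> and
  \<open>w\<^sub>j = \<psi>\<^sub>j(\<surd>\<Delta>) u = K\<^sub>j * u\<close>, where \<open>K\<^sub>j\<close> has the Fourier coefficients of \<open>\<psi>(2\<^sup>-\<^sup>j 2 |sin (\<theta>/2)|)\<close>. Since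
  \<open>2 |sin (\<theta>/2)|\<close> is comparable with \<open>|\<theta>|\<close> on \<open>[-\<pi>, \<pi>]\<close>, the symbols of \<open>K\<^sub>j\<close> and \<open>\<phi>\<^sub>\<nu>\<close> overlap only for
  \<open>|j - \<nu>| \<le> 4\<close>. The two partitions of unity therefore give the finite sums
  \<open>\<phi>\<^sub>\<nu> = \<Sum>\<^sub>j K\<^sub>j * \<phi>\<^sub>\<nu>\<close> (\<open>dker_sum_reproduces_admissible\<close>) and
  \<open>K\<^sub>j = \<Sum>\<^sub>\<nu> (K\<^sub>j * \<eta>'\<^sub>\<nu>) * \<phi>\<^sub>\<nu>\<close> with \<open>\<eta>'(n)\<close> the conjugate of \<open>\<eta>(-n)\<close> (\<open>dker_decomposition\<close>). So each \<open>v\<^sub>\<nu>\<close> is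
  a sum of boundedly many convolutions of functions \<open>w\<^sub>j\<close> of a comparable scale with kernels of that scale, and
  conversely. All the kernels \<open>H\<close> that occur satisfy \<open>|H(n)| \<le> C\<^sub>M 2\<^sup>\<nu> (1 + 2\<^sup>\<nu> |n|)\<^sup>-\<^sup>M\<close>: for \<open>\<phi>\<close> and \<open>\<eta>\<close> this is
  contained in the conditions on an admissible pair (\<open>scaled_of_fourier\<close>), for \<open>K\<^sub>j\<close> it follows by integration
  by parts (\<open>sine_int_bound\<close>).

  As \<open>v\<^sub>\<nu>\<close> and \<open>w\<^sub>j\<close> are themselves reproduced by such kernels, the inequality of Peetre (\<open>peetre\<close>) gives, for
  every \<open>0 < r \<le> 1\<close>, the pointwise bound \<open>|H * v\<^sub>\<nu>| \<le> C (A\<^sub>\<nu> |v\<^sub>\<nu>|\<^sup>r)\<^sup>1\<^sup>/\<^sup>r\<close> where \<open>A\<^sub>\<nu>\<close> is the convolution with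
  \<open>2\<^sup>\<nu> (1 + 2\<^sup>\<nu> |n|)\<^sup>-\<^sup>2\<close>, and likewise for \<open>w\<^sub>j\<close>. It remains to remove the averages for some \<open>r < min p q\<close>.
  In the Besov case this is the boundedness of convolutions on \<open>\<ell>\<^sup>p\<^sup>/\<^sup>r\<close> (\<open>lpnorm_avg_le\<close>).

  In the Triebel-Lizorkin case (\<open>triebel_avg_le\<close>) the main tool is the dual Doob inequality
  \<open>\<Sum>\<^sub>n (\<Sum>\<^sub>k B\<^sub>k\<^sub>+\<^sub>d g\<^sub>k)\<^sup>s \<le> C \<Sum>\<^sub>n (\<Sum>\<^sub>k g\<^sub>k)\<^sup>s\<close> for \<open>s \<ge> 1\<close>, \<open>g\<^sub>k \<ge> 0\<close> and averages \<open>B\<^sub>k\<close> over intervals of radius \<open>2\<^sup>k\<close>,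
  uniformly in \<open>d\<close> (\<open>dual_doob_ball\<close>). The maximal inequality on \<open>\<ell>\<^sup>s\<close>, \<open>s > 1\<close>, is dual to it (\<open>ball_maximal\<close>). For
  \<open>q \<le> p\<close> the dual Doob inequality and convexity suffice, for \<open>q = \<infinity>\<close> the maximal inequality does, and for \<open>p < q\<close>
  the Hoelder inequality reduces the claim to the maximal inequality.
\<close>

section \<open>Powers of extended nonnegative reals\<close>

lemma ennpow_0 [simp]: "ennpow 0 r = 0"
  by (simp add: ennpow_def)

lemma ennpow_top [simp]: "ennpow top r = top" "ennpow \<infinity> r = top"
  by (simp_all add: ennpow_def)

lemma ennpow_ennreal: "0 \<le> x \<Longrightarrow> ennpow (ennreal x) r = ennreal (x powr r)"
  by (simp add: ennpow_def)

lemma ennpow_mult: "ennpow (x * y) r = ennpow x r * ennpow y r"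
proof (cases "x = 0 \<or> y = 0")
  case False
  then show ?thesis
    by (cases x; cases y) (auto simp: ennpow_ennreal ennreal_mult[symmetric] powr_mult ennreal_mult_top ennreal_top_mult)
qed auto

lemma ennpow_ennpow: "ennpow (ennpow x a) b = ennpow x (a * b)"
  by (cases x) (auto simp: ennpow_ennreal powr_powr)

lemma ennpow_add: "ennpow x (a + b) = ennpow x a * ennpow x b"
  by (cases x) (auto simp: ennpow_ennreal powr_add ennreal_mult)

lemma ennpow_one [simp]: "ennpow x 1 = x"
  by (cases x) (auto simp: ennpow_ennreal)

lemma ennpow_1 [simp]: "ennpow 1 r = 1"
  by (simp add: ennpow_def)

lemma ennpow_mono: "x \<le> y \<Longrightarrow> 0 \<le> r \<Longrightarrow> ennpow x r \<le> ennpow y r"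
  by (cases x; cases y) (auto simp: ennpow_ennreal ennreal_leI powr_mono2 top_unique)

lemma ennpow_eq_0_iff [simp]: "ennpow x r = 0 \<longleftrightarrow> x = 0"
  by (cases x) (auto simp: ennpow_ennreal)

lemma ennpow_eq_top_iff [simp]: "ennpow x r = top \<longleftrightarrow> x = top"
  by (cases x) (auto simp: ennpow_ennreal)

lemma ennpow_le_iff: "0 < r \<Longrightarrow> ennpow x r \<le> ennpow y r \<longleftrightarrow> x \<le> y"
  using ennpow_mono[of x y r] ennpow_mono[of "ennpow x r" "ennpow y r" "1/r"]
  by (auto simp: ennpow_ennpow)

lemma ennpow_inverse_cancel: "x \<noteq> 0 \<Longrightarrow> x \<noteq> top \<Longrightarrow> ennpow x r * ennpow x (- r) = 1"
  using ennpow_add[of x r "-r"] by (cases x) (auto simp: ennpow_ennreal)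

lemma ennpow_SUP:
  assumes "0 < r" "I \<noteq> {}"
  shows "ennpow (SUP i\<in>I. f i) r = (SUP i\<in>I. ennpow (f i) r)"
proof (rule antisym)
  have "(SUP i\<in>I. f i) \<le> ennpow (SUP i\<in>I. ennpow (f i) r) (1/r)"
  proof (rule SUP_least)
    fix i assume "i \<in> I"
    then have "ennpow (f i) r \<le> (SUP i\<in>I. ennpow (f i) r)" by (rule SUP_upper)
    from ennpow_mono[OF this, of "1/r"] show "f i \<le> ennpow (SUP i\<in>I. ennpow (f i) r) (1/r)"
      using assms by (simp add: ennpow_ennpow)
  qed
  from ennpow_mono[OF this, of r] show "ennpow (SUP i\<in>I. f i) r \<le> (SUP i\<in>I. ennpow (f i) r)"
    using assms by (simp add: ennpow_ennpow)
  show "(SUP i\<in>I. ennpow (f i) r) \<le> ennpow (SUP i\<in>I. f i) r"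
    using assms by (intro SUP_least ennpow_mono SUP_upper) auto
qed

lemma ennpow_sum_le:
  assumes "finite D" "0 < r"
  shows "ennpow (\<Sum>d\<in>D. f d) r \<le> ennreal (real (card D) powr r) * (\<Sum>d\<in>D. ennpow (f d) r)"
proof (cases "D = {}")
  case False
  define M where "M = Max (f ` D)"
  have "M \<in> f ` D" unfolding M_def using assms False by (intro Max_in) auto
  then obtain d0 where d0: "d0 \<in> D" "f d0 = M" by auto
  have "(\<Sum>d\<in>D. f d) \<le> of_nat (card D) * M"
    unfolding M_def using assms by (intro sum_bounded_above) auto
  then have "ennpow (\<Sum>d\<in>D. f d) r \<le> ennpow (of_nat (card D) * M) r"
    using assms by (intro ennpow_mono) auto
  also have "\<dots> = ennreal (real (card D) powr r) * ennpow (f d0) r"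
    by (simp add: ennpow_mult d0 ennreal_of_nat_eq_real_of_nat ennpow_ennreal)
  also have "\<dots> \<le> ennreal (real (card D) powr r) * (\<Sum>d\<in>D. ennpow (f d) r)"
    using assms d0 by (intro mult_left_mono member_le_sum) auto
  finally show ?thesis .
qed auto

text \<open>Absorption of a finite quantity that occurs on both sides with a factor below 1.\<close>
lemma ennreal_absorb:
  fixes X Y K :: ennreal
  assumes "X \<le> K * Y + X / 2" "X < top"
  shows "X \<le> 2 * K * Y"
proof (cases "K * Y = top")
  case True
  then show ?thesis by (simp add: mult.assoc ennreal_mult_top)
next
  case False
  then obtain z where z: "K * Y = ennreal z" "0 \<le> z" by (cases "K * Y") auto
  obtain x where x: "X = ennreal x" "0 \<le> x" using assms(2) by (cases X) auto
  have "ennreal x \<le> ennreal z + ennreal x / ennreal 2" using assms z x by simp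
  also have "\<dots> = ennreal (z + x/2)"
    using z x by (subst divide_ennreal) (auto simp: ennreal_plus simp del: ennreal_numeral)
  finally have "ennreal x \<le> ennreal (z + x/2)" .
  then have "x \<le> z + x/2" by (rule ennreal_le_iff[THEN iffD1, rotated]) (use z x in simp)
  then have "x \<le> 2*z" by simp
  then have "X \<le> ennreal (2*z)" using x by (simp add: ennreal_leI)
  also have "\<dots> = 2 * (K*Y)" using z by (simp add: ennreal_mult)
  finally show ?thesis by (simp add: mult.assoc)
qed

text \<open>The Young inequality without the factors \<open>1/s\<close> and \<open>1/t\<close>; constants play no role below.\<close>
lemma young_ennreal:
  fixes x y :: ennreal and s t :: real
  assumes st: "1 < s" "1 < t" "1/s + 1/t = 1"
  shows "x * y \<le> ennpow x s + ennpow y t"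
proof (cases "x = top \<or> y = top")
  case False
  then obtain a b where ab: "x = ennreal a" "y = ennreal b" "0 \<le> a" "0 \<le> b"
    by (cases x; cases y) auto
  have t: "t = s / (s - 1)" using st by (simp add: field_simps)
  have "a * b \<le> a powr s + b powr t"
  proof (cases "b \<le> a powr (s - 1)")
    case True
    then have "a * b \<le> a * a powr (s-1)" using ab by (simp add: mult_left_mono)
    also have "\<dots> = a powr s" using ab st by (cases "a = 0") (auto simp: powr_mult_base)
    finally show ?thesis by (simp add: add_increasing2)
  next
    case False
    have "a = (a powr (s-1)) powr (1/(s-1))" using ab st by (simp add: powr_powr)
    also have "\<dots> \<le> b powr (1/(s-1))" using False st by (intro powr_mono2) auto
    finally have "a * b \<le> b powr (1/(s-1)) * b powr 1" using ab by (simp add: mult_right_mono)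
    also have "\<dots> = b powr (1/(s-1) + 1)" by (simp only: powr_add)
    also have "1/(s-1) + 1 = t" using t st by (simp add: field_simps)
    finally show ?thesis by (simp add: add_increasing)
  qed
  then show ?thesis using ab by (simp add: ennpow_ennreal ennreal_mult[symmetric] ennreal_leI flip: ennreal_plus)
qed (use assms in auto)

text \<open>A Young inequality in which the second term has the fixed small factor \<open>1/2\<close>, so that it can
  be absorbed.\<close>
lemma weighted_young_ennreal:
  fixes x y :: ennreal
  assumes s: "1 \<le> s" and C: "0 < C"
  shows "ennreal C * (x * ennpow y (s - 1)) \<le> ennreal (C * (2 * C) powr (s - 1)) * ennpow x s + ennpow y s / 2"
proof (cases "ennreal (2 * C) * x \<le> y")
  case True
  have "ennreal C * (x * ennpow y (s - 1)) = ((ennreal (2 * C) * x) * ennpow y (s-1)) / 2"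
  proof -
    have "ennreal (2 * C) / 2 = ennreal C"
      using C by (subst ennreal_numeral[symmetric], subst divide_ennreal) auto
    then show ?thesis
      by (metis ennreal_times_divide mult.assoc mult.commute)
  qed
  also have "\<dots> \<le> (y * ennpow y (s-1)) / 2"
    using True by (intro divide_right_mono_ennreal mult_right_mono) auto
  also have "y * ennpow y (s-1) = ennpow y s" using ennpow_add[of y 1 "s-1"] by simp
  finally show ?thesis by (simp add: add_increasing)
next
  case False
  then have "ennpow y (s-1) \<le> ennpow (ennreal (2*C) * x) (s-1)" using s by (intro ennpow_mono) auto
  also have "\<dots> = ennreal ((2*C) powr (s-1)) * ennpow x (s-1)" using C by (simp add: ennpow_mult ennpow_ennreal)
  finally have "ennreal C * (x * ennpow y (s - 1)) \<le> ennreal C * (x * (ennreal ((2*C) powr (s-1)) * ennpow x (s-1)))"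
    by (intro mult_left_mono) auto
  also have "\<dots> = ennreal (C * (2 * C) powr (s - 1)) * (x * ennpow x (s-1))"
    using C by (simp add: ennreal_mult mult_ac)
  also have "x * ennpow x (s-1) = ennpow x s" using ennpow_add[of x 1 "s-1"] by simp
  finally show ?thesis by (simp add: add_increasing2)
qed

section \<open>Sums of nonnegative terms and the Hoelder inequality\<close>

text \<open>The unordered sum over a whole type, as an integral over the counting measure.\<close>
abbreviation tsum :: "('i \<Rightarrow> ennreal) \<Rightarrow> ennreal" where
  "tsum f \<equiv> (\<integral>\<^sup>+ i. f i \<partial>count_space UNIV)"

lemma tsum_mono: "(\<And>i. f i \<le> g i) \<Longrightarrow> tsum f \<le> tsum g"
  by (rule nn_integral_mono) auto

lemma tsum_cmult: "tsum (\<lambda>i. c * f i) = c * tsum f"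
  by (rule nn_integral_cmult) auto

lemma tsum_multc: "tsum (\<lambda>i. f i * c) = tsum f * c"
  by (rule nn_integral_multc) auto

lemma tsum_add: "tsum (\<lambda>i. f i + g i) = tsum f + tsum g"
  by (rule nn_integral_add) auto

lemma tsum_sum: "finite D \<Longrightarrow> tsum (\<lambda>i. \<Sum>d\<in>D. f d i) = (\<Sum>d\<in>D. tsum (f d))"
  by (rule nn_integral_sum) auto

lemma tsum_swap:
  fixes f :: "'i::countable \<Rightarrow> 'j \<Rightarrow> ennreal"
  shows "tsum (\<lambda>j. tsum (\<lambda>i. f i j)) = tsum (\<lambda>i. tsum (\<lambda>j. f i j))"
  by (rule nn_integral_count_space_nn_integral) auto

lemma tsum_ge: "f i \<le> tsum f"
  using nn_integral_ge_point[of i UNIV f] by simp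

lemma tsum_eq_0: "tsum f = 0 \<longleftrightarrow> (\<forall>i. f i = 0)"
  by (auto simp: nn_integral_0_iff_AE AE_count_space)

lemma tsum_reindex: "bij g \<Longrightarrow> tsum (\<lambda>i. f (g i)) = tsum f"
  by (rule nn_integral_bij_count_space)

lemma tsum_shift: "tsum (\<lambda>m::int. f (n - m)) = tsum f"
  by (rule tsum_reindex) (rule bij_betw_byWitness[where f' = "\<lambda>m. n - m"], auto)

lemma tsum_SUP_incseq:
  "(\<And>x. incseq (\<lambda>N. f N x)) \<Longrightarrow> tsum (\<lambda>x. SUP N::nat. f N x) = (SUP N. tsum (f N))"
  by (rule nn_integral_monotone_convergence_SUP) (auto simp: incseq_def le_fun_def)

lemma tsum_nat_SUP: "tsum (f :: nat \<Rightarrow> ennreal) = (SUP N. \<Sum>k<N. f k)"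
  by (simp add: nn_integral_count_space_nat suminf_eq_SUP)

text \<open>The factor 2 comes from the Young inequality without its constants.\<close>
lemma tsum_hoelder:
  assumes st: "1 < s" "1 < t" "1/s + 1/t = 1"
  shows "tsum (\<lambda>i. f i * g i) \<le> 2 * (ennpow (tsum (\<lambda>i. ennpow (f i) s)) (1/s) * ennpow (tsum (\<lambda>i. ennpow (g i) t)) (1/t))"
proof -
  define X where "X = tsum (\<lambda>i. ennpow (f i) s)"
  define Y where "Y = tsum (\<lambda>i. ennpow (g i) t)"
  consider "X = 0" | "Y = 0" | "X \<noteq> 0" "Y \<noteq> 0" "X = top \<or> Y = top" | "X \<noteq> 0" "Y \<noteq> 0" "X \<noteq> top" "Y \<noteq> top"
    by blast
  then show ?thesis
  proof cases
    case 1
    then have "\<And>i. f i = 0" by (auto simp: X_def tsum_eq_0)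
    then show ?thesis by simp
  next
    case 2
    then have "\<And>i. g i = 0" by (auto simp: Y_def tsum_eq_0)
    then show ?thesis by simp
  next
    case 3
    then have "ennpow X (1/s) * ennpow Y (1/t) = top"
      by (auto simp: ennreal_mult_top ennreal_top_mult)
    then show ?thesis by (simp add: X_def Y_def ennreal_mult_top)
  next
    case 4
    define x where "x = ennpow X (-1/s)"
    define y where "y = ennpow Y (-1/t)"
    have xX: "ennpow x s * X = 1" "ennpow X (1/s) * x = 1"
      using ennpow_inverse_cancel[of X 1] ennpow_inverse_cancel[of X "1/s"] 4 st
      by (auto simp: x_def ennpow_ennpow mult.commute)
    have yY: "ennpow y t * Y = 1" "ennpow Y (1/t) * y = 1"
      using ennpow_inverse_cancel[of Y 1] ennpow_inverse_cancel[of Y "1/t"] 4 st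
      by (auto simp: y_def ennpow_ennpow mult.commute)
    have "tsum (\<lambda>i. f i * g i) = tsum (\<lambda>i. (ennpow X (1/s) * x) * (ennpow Y (1/t) * y) * (f i * g i))"
      by (simp add: xX yY)
    also have "\<dots> = ennpow X (1/s) * ennpow Y (1/t) * tsum (\<lambda>i. (x * f i) * (y * g i))"
      by (simp add: tsum_cmult[symmetric] mult_ac)
    finally have *: "tsum (\<lambda>i. f i * g i) = ennpow X (1/s) * ennpow Y (1/t) * tsum (\<lambda>i. (x * f i) * (y * g i))" .
    have "tsum (\<lambda>i. (x * f i) * (y * g i)) \<le> tsum (\<lambda>i. ennpow (x * f i) s + ennpow (y * g i) t)"
      by (intro tsum_mono young_ennreal st)
    also have "\<dots> = ennpow x s * X + ennpow y t * Y"
      by (simp add: tsum_add ennpow_mult tsum_cmult X_def Y_def)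
    also have "\<dots> = 2" using xX yY by simp
    finally have "ennpow X (1/s) * ennpow Y (1/t) * tsum (\<lambda>i. (x * f i) * (y * g i)) \<le> ennpow X (1/s) * ennpow Y (1/t) * 2"
      by (rule mult_left_mono) auto
    then show ?thesis by (simp add: * X_def Y_def mult_ac)
  qed
qed

lemma tsum_weighted_hoelder:
  assumes st: "1 < s" "1 < t" "1/s + 1/t = 1"
  shows "tsum (\<lambda>i. a i * (f i * g i)) \<le>
    2 * (ennpow (tsum (\<lambda>i. a i * ennpow (f i) s)) (1/s) * ennpow (tsum (\<lambda>i. a i * ennpow (g i) t)) (1/t))"
proof -
  have "ennpow (a i) (1/s) * f i * (ennpow (a i) (1/t) * g i) = a i * (f i * g i)" for i
    using ennpow_add[of "a i" "1/s" "1/t"] st by (simp add: mult_ac)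
  then show ?thesis
    using tsum_hoelder[OF st, of "\<lambda>i. ennpow (a i) (1/s) * f i" "\<lambda>i. ennpow (a i) (1/t) * g i"] st
    by (simp add: ennpow_mult ennpow_ennpow)
qed

lemma tsum_weighted_jensen:
  assumes t: "1 \<le> t" and a: "tsum a \<le> ennreal c" "0 \<le> c"
  shows "ennpow (tsum (\<lambda>i. a i * f i)) t \<le> ennreal (2 powr t * c powr (t - 1)) * tsum (\<lambda>i. a i * ennpow (f i) t)"
proof (cases "t = 1")
  case True
  have "tsum (\<lambda>i. a i * f i) = 0" if "c = 0"
    using a that by (simp add: tsum_eq_0)
  moreover have "1 * tsum (\<lambda>i. a i * f i) \<le> ennreal 2 * tsum (\<lambda>i. a i * f i)"
    by (intro mult_right_mono) (auto simp flip: ennreal_1 simp del: ennreal_numeral ennreal_1 intro!: ennreal_leI)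
  ultimately show ?thesis using True a by (cases "c = 0") auto
next
  case False
  define s where "s = t / (t - 1)"
  have st: "1 < t" "1 < s" "1/t + 1/s = 1" using t False by (auto simp: s_def field_simps)
  have "ennpow (tsum (\<lambda>i. a i * f i)) t \<le> ennpow (2 * (ennpow (tsum (\<lambda>i. a i * ennpow (f i) t)) (1/t) * ennpow (tsum a) (1/s))) t"
    using tsum_weighted_hoelder[OF st, of a f "\<lambda>_. 1"] t by (intro ennpow_mono) auto
  also have "\<dots> \<le> ennpow (2 * (ennpow (tsum (\<lambda>i. a i * ennpow (f i) t)) (1/t) * ennpow (ennreal c) (1/s))) t"
    using st t by (intro ennpow_mono mult_left_mono a) auto
  also have "\<dots> = ennpow 2 t * ennpow (ennreal c) (t/s) * tsum (\<lambda>i. a i * ennpow (f i) t)"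
    using st by (simp add: ennpow_mult ennpow_ennpow mult_ac)
  also have "ennpow 2 t * ennpow (ennreal c) (t/s) = ennreal (2 powr t * c powr (t-1))"
    using a st ennpow_ennreal[of 2 t] by (simp add: ennpow_ennreal ennreal_mult s_def)
  finally show ?thesis .
qed

section \<open>Convolution with nonnegative kernels on the integers\<close>

text \<open>Convolution on the integers with values in \<open>[0,\<infinity>]\<close>; no convergence has to be discussed.\<close>
definition kconv :: "(int \<Rightarrow> ennreal) \<Rightarrow> (int \<Rightarrow> ennreal) \<Rightarrow> int \<Rightarrow> ennreal" where
  "kconv a g n = tsum (\<lambda>m. a (n - m) * g m)"

lemma kconv_mono: "(\<And>m. a m \<le> b m) \<Longrightarrow> (\<And>m. g m \<le> h m) \<Longrightarrow> kconv a g n \<le> kconv b h n"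
  unfolding kconv_def by (intro tsum_mono mult_mono) auto

lemma kconv_cmult: "kconv a (\<lambda>m. c * g m) n = c * kconv a g n"
  unfolding kconv_def by (simp add: tsum_cmult[symmetric] mult_ac)

lemma kconv_adjoint:
  assumes "\<And>m. a (- m) = a m"
  shows "tsum (\<lambda>n. kconv a g n * h n) = tsum (\<lambda>m. g m * kconv a h m)"
proof -
  have "tsum (\<lambda>n. kconv a g n * h n) = tsum (\<lambda>n. tsum (\<lambda>m. a (n - m) * g m * h n))"
    by (simp add: kconv_def tsum_multc)
  also have "\<dots> = tsum (\<lambda>m. tsum (\<lambda>n. a (n - m) * g m * h n))"
    by (rule tsum_swap)
  also have "\<dots> = tsum (\<lambda>m. g m * kconv a h m)"
  proof -
    have "a (n - m) = a (m - n)" for n m using assms[of "m - n"] by simp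
    then show ?thesis by (simp add: kconv_def tsum_cmult[symmetric] mult_ac)
  qed
  finally show ?thesis .
qed

lemma tsum_kconv: "tsum (kconv a g) = tsum a * tsum g"
proof -
  have "tsum (kconv a g) = tsum (\<lambda>m. tsum (\<lambda>n. a (n - m) * g m))"
    unfolding kconv_def by (rule tsum_swap)
  also have "\<dots> = tsum (\<lambda>m. tsum a * g m)"
  proof -
    have "tsum (\<lambda>n. a (n - m)) = tsum a" for m :: int
      by (rule tsum_reindex) (rule bij_betw_byWitness[where f' = "\<lambda>n. n + m"], auto)
    then show ?thesis by (simp add: tsum_multc)
  qed
  finally show ?thesis by (simp add: tsum_cmult)
qed

lemma kconv_jensen:
  assumes "1 \<le> t" "tsum a \<le> ennreal c" "0 \<le> c"
  shows "ennpow (kconv a g n) t \<le> ennreal (2 powr t * c powr (t-1)) * kconv a (\<lambda>m. ennpow (g m) t) n"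
  unfolding kconv_def using assms by (intro tsum_weighted_jensen) (auto simp: tsum_shift)

lemma tsum_kconv_power:
  assumes "1 \<le> t" "tsum a \<le> ennreal c" "0 \<le> c"
  shows "tsum (\<lambda>n. ennpow (kconv a g n) t) \<le> ennreal (2 powr t * c powr t) * tsum (\<lambda>n. ennpow (g n) t)"
proof -
  have "tsum (\<lambda>n. ennpow (kconv a g n) t) \<le> tsum (\<lambda>n. ennreal (2 powr t * c powr (t-1)) * kconv a (\<lambda>m. ennpow (g m) t) n)"
    by (intro tsum_mono kconv_jensen assms)
  also have "\<dots> = ennreal (2 powr t * c powr (t-1)) * (tsum a * tsum (\<lambda>n. ennpow (g n) t))"
    by (simp add: tsum_cmult tsum_kconv)
  also have "\<dots> \<le> ennreal (2 powr t * c powr (t-1)) * (ennreal c * tsum (\<lambda>n. ennpow (g n) t))"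
    by (intro mult_left_mono mult_right_mono assms) auto
  also have "\<dots> = ennreal (2 powr t * (c powr (t-1) * c)) * tsum (\<lambda>n. ennpow (g n) t)"
    using assms by (simp add: ennreal_mult mult_ac)
  also have "c powr (t-1) * c = c powr t" using assms by (cases "c = 0") (auto simp: powr_mult_base mult.commute)
  finally show ?thesis .
qed

text \<open>Convolution with \<open>ball_kernel k\<close> is, up to a factor between 2 and 3, the average over the
  interval of radius \<open>2 ^ k\<close>.\<close>
definition ball_kernel :: "nat \<Rightarrow> int \<Rightarrow> ennreal" where
  "ball_kernel k m = (if \<bar>m\<bar> \<le> 2 ^ k then ennreal (1 / 2 ^ k) else 0)"

lemma ball_kernel_minus: "ball_kernel k (- m) = ball_kernel k m"
  by (simp add: ball_kernel_def)

lemma kconv_ball_adjoint: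
  "tsum (\<lambda>n. kconv (ball_kernel k) g n * h n) = tsum (\<lambda>m. g m * kconv (ball_kernel k) h m)"
  by (rule kconv_adjoint) (rule ball_kernel_minus)

lemma tsum_ball_kernel: "tsum (ball_kernel k) \<le> ennreal 3"
proof -
  have "tsum (ball_kernel k) = (\<Sum>m\<in>{-(2^k)..2^k}. ball_kernel k m)"
    by (rule nn_integral_count_space') (auto simp: ball_kernel_def)
  also have "\<dots> = (\<Sum>m\<in>{-(2^k)..(2^k::int)}. ennreal (1 / 2 ^ k))"
    by (rule sum.cong) (auto simp: ball_kernel_def)
  also have "\<dots> = ennreal (real (2 * 2 ^ k + 1) * (1/2^k))"
    by (simp add: nat_add_distrib nat_mult_distrib nat_power_eq ennreal_of_nat_eq_real_of_nat ennreal_mult[symmetric] del: of_nat_add of_nat_Suc of_nat_mult)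
  also have "\<dots> \<le> ennreal 3" by (intro ennreal_leI) (simp add: field_simps)
  finally show ?thesis .
qed

text \<open>An average over a long interval changes little when its centre moves by at most the radius, at
  the cost of doubling the radius.\<close>
lemma kconv_ball_le_shift:
  assumes "\<bar>n - m\<bar> \<le> 2 ^ i"
  shows "kconv (ball_kernel i) g n \<le> 2 * kconv (ball_kernel (Suc i)) g m"
  unfolding kconv_def tsum_cmult[symmetric]
proof (rule tsum_mono)
  fix l
  have "ball_kernel i (n - l) \<le> 2 * ball_kernel (Suc i) (m - l)"
  proof (cases "\<bar>n - l\<bar> \<le> 2 ^ i")
    case True
    then have "\<bar>m - l\<bar> \<le> 2 ^ Suc i" using assms by simp
    then show ?thesis using True
      by (simp add: ball_kernel_def ennreal_mult[symmetric] del: power_Suc ennreal_numeral flip: ennreal_numeral)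
        (simp add: ennreal_leI)
  qed (simp add: ball_kernel_def)
  from mult_right_mono[OF this, of "g l"]
  show "ball_kernel i (n - l) * g l \<le> 2 * (ball_kernel (Suc i) (m - l) * g l)"
    by (simp add: mult.assoc)
qed

section \<open>A dual Doob inequality for averages over intervals\<close>

text \<open>The convexity inequality \<open>z\<^sup>s - y\<^sup>s \<le> s z\<^sup>s\<^sup>-\<^sup>1 (z - y)\<close> for \<open>z = x + y\<close>, free of subtraction.\<close>
lemma ennpow_add_le:
  assumes s: "1 \<le> s"
  shows "ennpow (x + y) s \<le> ennreal s * (x * ennpow (x + y) (s - 1)) + ennpow y s"
proof (cases "x = top \<or> y = top \<or> x = 0")
  case True
  then show ?thesis
  proof (elim disjE)
    assume "x = top"
    then show ?thesis using s by (simp add: ennreal_mult_top)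
  qed (use s in auto)
next
  case False
  then obtain a b where ab: "x = ennreal a" "y = ennreal b" "0 < a" "0 \<le> b"
    by (cases x; cases y) (auto simp: less_le)
  have "(a + b) powr s \<le> s * (a * (a + b) powr (s-1)) + b powr s"
  proof (cases "b = 0")
    case True
    have "a powr s = a * a powr (s-1)" using ab by (simp add: powr_mult_base)
    then show ?thesis using True s ab mult_right_mono[of 1 s "a * a powr (s-1)"] by simp
  next
    case False
    then have "0 < b" using ab by simp
    have "\<exists>z. b < z \<and> z < a + b \<and> (a+b) powr s - b powr s = (a + b - b) * (s * z powr (s-1))"
      using ab \<open>0 < b\<close> by (intro MVT2) (auto intro!: derivative_eq_intros)
    then obtain z where z: "b < z" "z < a + b" "(a+b) powr s - b powr s = a * (s * z powr (s-1))"
      by auto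
    have "z powr (s-1) \<le> (a+b) powr (s-1)" using z ab s by (intro powr_mono2) auto
    then have "a * (s * z powr (s-1)) \<le> a * (s * (a+b) powr (s-1))"
      using ab s by (intro mult_left_mono) auto
    then show ?thesis using z(3) by (simp add: mult.left_commute[of s])
  qed
  then have "ennreal ((a + b) powr s) \<le> ennreal (s * (a * (a + b) powr (s-1)) + b powr s)"
    by (rule ennreal_leI)
  also have "\<dots> = ennreal s * (ennreal a * ennreal ((a + b) powr (s-1))) + ennreal (b powr s)"
    using ab s by (simp add: ennreal_mult)
  finally show ?thesis using ab
    by (simp add: ennpow_ennreal flip: ennreal_plus)
qed

text \<open>A power of a sum is dominated by pairing each term with a power of a tail; the tails contain the
  averages over the longer intervals only.\<close>
lemma ennpow_sum_abel:
  fixes a :: "nat \<Rightarrow> ennreal" and N :: nat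
  assumes s: "1 \<le> s"
  shows "ennpow (\<Sum>k<N. a k) s \<le> ennreal s * (\<Sum>k<N. a k * ennpow (\<Sum>i\<in>{k..<N}. a i) (s - 1))"
proof -
  have "k \<le> N \<Longrightarrow> ennpow (\<Sum>i\<in>{k..<N}. a i) s \<le>
     ennreal s * (\<Sum>j\<in>{k..<N}. a j * ennpow (\<Sum>i\<in>{j..<N}. a i) (s - 1))" for k
  proof (induction k rule: inc_induct)
    case (step k)
    let ?T = "\<lambda>k. \<Sum>i\<in>{k..<N}. a i"
    have T: "?T k = a k + ?T (Suc k)" using step by (simp add: sum.atLeast_Suc_lessThan)
    have "ennpow (?T k) s \<le> ennreal s * (a k * ennpow (?T k) (s-1)) + ennpow (?T (Suc k)) s"
      unfolding T by (rule ennpow_add_le[OF s])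
    also have "\<dots> \<le> ennreal s * (a k * ennpow (?T k) (s-1)) +
        ennreal s * (\<Sum>j\<in>{Suc k..<N}. a j * ennpow (?T j) (s - 1))"
      by (intro add_left_mono step.IH)
    also have "\<dots> = ennreal s * (\<Sum>j\<in>{k..<N}. a j * ennpow (?T j) (s - 1))"
      using step by (simp add: sum.atLeast_Suc_lessThan[of k N] distrib_left)
    finally show ?case .
  qed simp
  from this[of 0] show ?thesis by (simp add: lessThan_atLeast0)
qed

text \<open>The tail of the sum is essentially constant at the scale of its shortest interval, so the
  average of radius \<open>2 ^ (k + d)\<close> can be moved from \<open>g k\<close> to the tail and there be dropped. The price is
  the passage from \<open>d\<close> to \<open>d + 1\<close>.\<close>
lemma dual_doob_ball_step:
  fixes g :: "nat \<Rightarrow> int \<Rightarrow> ennreal" and N :: nat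
  assumes s: "1 \<le> s"
  defines "S \<equiv> \<lambda>d n. \<Sum>k<N. kconv (ball_kernel (k + d)) (g k) n"
  shows "tsum (\<lambda>n. ennpow (S d n) s) \<le>
     ennreal (3 * s * 2 powr (s-1)) * tsum (\<lambda>m. (\<Sum>k<N. g k m) * ennpow (S (Suc d) m) (s - 1))"
proof -
  \<comment> \<open>The tail that starts at the index k, consisting of the averages over the longer intervals.\<close>
  define T where "T k n = (\<Sum>i\<in>{k..<N}. kconv (ball_kernel (i + d)) (g i) n)" for k n
  have inner: "kconv (ball_kernel (k + d)) (\<lambda>n. ennpow (T k n) (s - 1)) m \<le>
      ennreal (3 * 2 powr (s-1)) * ennpow (S (Suc d) m) (s - 1)" if "k < N" for k m
  proof -
    have pt: "ball_kernel (k + d) (m - n) * ennpow (T k n) (s - 1) \<le>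
       ball_kernel (k + d) (m - n) * ennpow (2 * S (Suc d) m) (s - 1)" for n
    proof (cases "\<bar>m - n\<bar> \<le> 2 ^ (k + d)")
      case True
      have "T k n \<le> (\<Sum>i\<in>{k..<N}. 2 * kconv (ball_kernel (Suc (i + d))) (g i) m)"
        unfolding T_def
      proof (intro sum_mono kconv_ball_le_shift)
        fix i assume "i \<in> {k..<N}"
        then have "(2::int) ^ (k + d) \<le> 2 ^ (i + d)" by (intro power_increasing) auto
        then show "\<bar>n - m\<bar> \<le> 2 ^ (i + d)" using True by linarith
      qed
      also have "\<dots> \<le> (\<Sum>i<N. 2 * kconv (ball_kernel (Suc (i + d))) (g i) m)"
        by (intro sum_mono2) auto
      also have "\<dots> = 2 * S (Suc d) m" by (simp add: S_def sum_distrib_left)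
      finally show ?thesis using s by (intro mult_left_mono ennpow_mono) auto
    qed (simp add: ball_kernel_def)
    have "kconv (ball_kernel (k + d)) (\<lambda>n. ennpow (T k n) (s - 1)) m \<le>
        tsum (\<lambda>n. ball_kernel (k + d) (m - n) * ennpow (2 * S (Suc d) m) (s - 1))"
      unfolding kconv_def by (intro tsum_mono pt)
    also have "\<dots> = tsum (ball_kernel (k+d)) * ennpow (2 * S (Suc d) m) (s - 1)"
      by (simp add: tsum_multc tsum_shift)
    also have "\<dots> \<le> ennreal 3 * ennpow (2 * S (Suc d) m) (s - 1)"
      by (intro mult_right_mono tsum_ball_kernel) auto
    also have "\<dots> = ennreal (3 * 2 powr (s-1)) * ennpow (S (Suc d) m) (s - 1)"
      using ennpow_ennreal[of 2 "s-1"] by (simp add: ennpow_mult ennreal_mult mult_ac)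
    finally show ?thesis .
  qed
  have "tsum (\<lambda>n. ennpow (S d n) s) \<le> tsum (\<lambda>n. ennreal s * (\<Sum>k<N. kconv (ball_kernel (k + d)) (g k) n * ennpow (T k n) (s - 1)))"
    unfolding S_def T_def by (intro tsum_mono ennpow_sum_abel s)
  also have "\<dots> = ennreal s * (\<Sum>k<N. tsum (\<lambda>n. kconv (ball_kernel (k + d)) (g k) n * ennpow (T k n) (s - 1)))"
    by (simp add: tsum_cmult tsum_sum)
  also have "\<dots> = ennreal s * (\<Sum>k<N. tsum (\<lambda>m. g k m * kconv (ball_kernel (k + d)) (\<lambda>n. ennpow (T k n) (s - 1)) m))"
    by (simp add: kconv_ball_adjoint)
  also have "\<dots> \<le> ennreal s * (\<Sum>k<N. tsum (\<lambda>m. g k m * (ennreal (3 * 2 powr (s-1)) * ennpow (S (Suc d) m) (s - 1))))"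
    by (intro mult_left_mono sum_mono tsum_mono inner) auto
  also have "\<dots> = ennreal s * tsum (\<lambda>m. ennreal (3 * 2 powr (s-1)) * ((\<Sum>k<N. g k m) * ennpow (S (Suc d) m) (s - 1)))"
    by (simp add: tsum_sum[symmetric] sum_distrib_right sum_distrib_left mult_ac)
  also have "\<dots> = ennreal (3 * s * 2 powr (s-1)) * tsum (\<lambda>m. (\<Sum>k<N. g k m) * ennpow (S (Suc d) m) (s - 1))"
    unfolding tsum_cmult using s by (simp add: ennreal_mult mult_ac)
  finally show ?thesis .
qed

text \<open>The loss of one scale in each step is harmless since the bound is proved for all shifts \<open>d\<close> at
  once: the supremum over \<open>d\<close> is finite for finitely many terms, and then absorption applies.\<close>
lemma dual_doob_ball_finite:
  assumes s: "1 \<le> s"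
  shows "\<exists>C\<ge>1. \<forall>N d g. tsum (\<lambda>n. ennpow (\<Sum>k<N. kconv (ball_kernel (k + d)) (g k) n) s)
    \<le> ennreal C * tsum (\<lambda>n. ennpow (\<Sum>k<N. g k n) s)"
proof -
  define c where "c = 3 * s * 2 powr (s-1)"
  have c: "c > 0" using s by (simp add: c_def)
  define K where "K = c * (2 * c) powr (s - 1)"
  have K: "K \<ge> 0" using c by (simp add: K_def)
  have main: "tsum (\<lambda>n. ennpow (\<Sum>k<N. kconv (ball_kernel (k + d)) (g k) n) s)
    \<le> ennreal (2 * K + 1) * tsum (\<lambda>n. ennpow (\<Sum>k<N. g k n) s)" for N d g
  proof -
    define S where "S d n = (\<Sum>k<N. kconv (ball_kernel (k + d)) (g k) n)" for d n
    define G where "G n = (\<Sum>k<N. g k n)" for n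
    define Y where "Y = tsum (\<lambda>n. ennpow (G n) s)"
    define X where "X = (SUP d. tsum (\<lambda>n. ennpow (S d n) s))"
    show ?thesis
    proof (cases "Y = top")
      case True
      then show ?thesis using K by (simp add: Y_def G_def ennreal_mult_top)
    next
      case False
      have "tsum (\<lambda>n. ennpow (S d n) s) \<le> ennreal K * Y + X / 2" for d
      proof -
        have "tsum (\<lambda>n. ennpow (S d n) s) \<le> ennreal c * tsum (\<lambda>m. G m * ennpow (S (Suc d) m) (s - 1))"
          using dual_doob_ball_step[OF s, where N = N and g = g and d = d] by (simp add: S_def G_def c_def)
        also have "\<dots> = tsum (\<lambda>m. ennreal c * (G m * ennpow (S (Suc d) m) (s - 1)))"
          by (simp add: tsum_cmult)
        also have "\<dots> \<le> tsum (\<lambda>m. ennreal K * ennpow (G m) s + ennpow (S (Suc d) m) s / 2)"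
          unfolding K_def by (intro tsum_mono weighted_young_ennreal s c)
        also have "\<dots> = ennreal K * Y + tsum (\<lambda>m. ennpow (S (Suc d) m) s) / 2"
          by (simp add: tsum_add tsum_cmult Y_def nn_integral_divide)
        also have "\<dots> \<le> ennreal K * Y + X / 2"
          unfolding X_def by (intro add_left_mono divide_right_mono_ennreal SUP_upper) auto
        finally show ?thesis .
      qed
      then have 1: "X \<le> ennreal K * Y + X / 2" unfolding X_def by (intro SUP_least) auto
      \<comment> \<open>A crude bound, which depends on N but not on d; it only serves to make X finite.\<close>
      have "tsum (\<lambda>n. ennpow (S d n) s) \<le> ennreal (real N powr s) * (of_nat N * (ennreal (2 powr s * 3 powr s) * Y))" for d
      proof -
        have "tsum (\<lambda>n. ennpow (S d n) s) \<le> tsum (\<lambda>n. ennreal (real N powr s) * (\<Sum>k<N. ennpow (kconv (ball_kernel (k + d)) G n) s))"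
        proof (rule tsum_mono)
          fix n
          have "S d n \<le> (\<Sum>k<N. kconv (ball_kernel (k + d)) G n)"
            unfolding S_def G_def by (intro sum_mono kconv_mono) (auto intro: member_le_sum)
          then have "ennpow (S d n) s \<le> ennpow (\<Sum>k<N. kconv (ball_kernel (k + d)) G n) s"
            using s by (intro ennpow_mono) auto
          also have "\<dots> \<le> ennreal (real N powr s) * (\<Sum>k<N. ennpow (kconv (ball_kernel (k + d)) G n) s)"
            using ennpow_sum_le[of "{..<N}" s] s by simp
          finally show "ennpow (S d n) s \<le> ennreal (real N powr s) * (\<Sum>k<N. ennpow (kconv (ball_kernel (k + d)) G n) s)" .
        qed
        also have "\<dots> = ennreal (real N powr s) * (\<Sum>k<N. tsum (\<lambda>n. ennpow (kconv (ball_kernel (k + d)) G n) s))"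
          by (simp add: tsum_cmult tsum_sum)
        also have "\<dots> \<le> ennreal (real N powr s) * (\<Sum>k<N. ennreal (2 powr s * 3 powr s) * Y)"
          unfolding Y_def by (intro mult_left_mono sum_mono tsum_kconv_power s tsum_ball_kernel) auto
        finally show ?thesis by simp
      qed
      then have "X \<le> ennreal (real N powr s) * (of_nat N * (ennreal (2 powr s * 3 powr s) * Y))"
        unfolding X_def by (intro SUP_least) auto
      also have "\<dots> < top" using False by (simp add: ennreal_mult_less_top less_top ennreal_of_nat_eq_real_of_nat)
      finally have "X \<le> 2 * ennreal K * Y" using ennreal_absorb[OF 1] by simp
      also have "2 * ennreal K = ennreal (2 * K)" using K by (simp add: ennreal_mult)
      also have "ennreal (2 * K) * Y \<le> ennreal (2 * K + 1) * Y" by (intro mult_right_mono ennreal_leI) auto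
      finally have "tsum (\<lambda>n. ennpow (S d n) s) \<le> ennreal (2 * K + 1) * Y"
        unfolding X_def by (meson SUP_upper UNIV_I order_trans)
      then show ?thesis by (simp add: S_def Y_def G_def)
    qed
  qed
  then show ?thesis using K by (intro exI[of _ "2 * K + 1"]) auto
qed

lemma incseq_sum_nat: "incseq (\<lambda>N. \<Sum>k<N. (f k :: ennreal))"
  by (intro incseq_SucI) simp

lemma tsum_ennpow_tsum_nat:
  assumes "0 < s"
  shows "tsum (\<lambda>n. ennpow (tsum (\<lambda>k::nat. f k n)) s) = (SUP N. tsum (\<lambda>n. ennpow (\<Sum>k<N. f k n) s))"
proof -
  have "tsum (\<lambda>n. ennpow (tsum (\<lambda>k::nat. f k n)) s) = tsum (\<lambda>n. SUP N. ennpow (\<Sum>k<N. f k n) s)"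
    using assms by (simp add: tsum_nat_SUP ennpow_SUP)
  also have "\<dots> = (SUP N. tsum (\<lambda>n. ennpow (\<Sum>k<N. f k n) s))"
    using incseq_sum_nat[unfolded incseq_def] assms
    by (intro tsum_SUP_incseq) (auto simp: incseq_def intro!: ennpow_mono)
  finally show ?thesis .
qed

lemma dual_doob_ball:
  assumes s: "1 \<le> s"
  shows "\<exists>C\<ge>1. \<forall>d g. tsum (\<lambda>n. ennpow (tsum (\<lambda>k. kconv (ball_kernel (k + d)) (g k) n)) s)
    \<le> ennreal C * tsum (\<lambda>n. ennpow (tsum (\<lambda>k. g k n)) s)"
proof -
  obtain C where C: "C \<ge> 1" and *: "\<And>N d g. tsum (\<lambda>n. ennpow (\<Sum>k<N. kconv (ball_kernel (k + d)) (g k) n) s)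
    \<le> ennreal C * tsum (\<lambda>n. ennpow (\<Sum>k<N. g k n) s)" using dual_doob_ball_finite[OF s] by blast
  have "tsum (\<lambda>n. ennpow (tsum (\<lambda>k. kconv (ball_kernel (k + d)) (g k) n)) s)
    \<le> ennreal C * tsum (\<lambda>n. ennpow (tsum (\<lambda>k. g k n)) s)" for d g
    using s by (simp add: tsum_ennpow_tsum_nat)
      (auto intro!: SUP_least order_trans[OF *] mult_left_mono SUP_upper)
  then show ?thesis using C by blast
qed

section \<open>The maximal function\<close>

text \<open>The maximal inequality is dual to the preceding one: at each point a maximising radius is chosen,
  and the resulting linear operator is the adjoint of a sum of averages.\<close>
lemma ball_maximal_finite:
  assumes s: "1 < s"
  shows "\<exists>C\<ge>0. \<forall>N f. tsum (\<lambda>n. ennpow (SUP k\<in>{..<Suc N}. kconv (ball_kernel k) f n) s) \<le> ennreal C * tsum (\<lambda>n. ennpow (f n) s)"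
proof -
  define t where "t = s / (s - 1)"
  have t: "1 < t" using s by (simp add: t_def field_simps)
  obtain C where C: "C \<ge> 1" and doob: "\<And>N d g. tsum (\<lambda>n. ennpow (\<Sum>k<N. kconv (ball_kernel (k + d)) (g k) n) t)
    \<le> ennreal C * tsum (\<lambda>n. ennpow (\<Sum>k<N. g k n) t)" using dual_doob_ball_finite[of t] t by auto
  define b where "b = C powr (1/t)"
  have b: "b > 0" "b powr t = C" using C t by (auto simp: b_def powr_powr)
  define K where "K = 2 powr (s - 1) * b powr s"
  have K: "K \<ge> 0" by (simp add: K_def)
  have "tsum (\<lambda>n. ennpow (SUP k\<in>{..<Suc N}. kconv (ball_kernel k) f n) s) \<le> ennreal (2 * K + 1) * tsum (\<lambda>n. ennpow (f n) s)" for N f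
  proof -
    define M where "M n = (SUP k\<in>{..<Suc N}. kconv (ball_kernel k) f n)" for n
    have "\<exists>i<Suc N. M n = kconv (ball_kernel i) f n" for n
    proof -
      have "M n = Max ((\<lambda>k. kconv (ball_kernel k) f n) ` {..<Suc N})"
        unfolding M_def by (intro Max_Sup[symmetric]) auto
      also have "\<dots> \<in> (\<lambda>k. kconv (ball_kernel k) f n) ` {..<Suc N}" by (rule Max_in) auto
      finally show ?thesis by auto
    qed
    then obtain i where i: "\<And>n. i n < Suc N" "\<And>n. M n = kconv (ball_kernel (i n)) f n" by metis
    \<comment> \<open>The k-th component lives on the set where the radius with index k is maximising.\<close>
    define g where "g k n = (if k = i n then ennpow (M n) (s - 1) else 0)" for k n
    have gsum: "(\<Sum>k<Suc N. g k n) = ennpow (M n) (s - 1)" for n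
      unfolding g_def using i(1)[of n] by (subst sum.delta) auto
    define T where "T n = (\<Sum>k<Suc N. kconv (ball_kernel k) (g k) n)" for n
    define X where "X = tsum (\<lambda>n. ennpow (M n) s)"
    define Y where "Y = tsum (\<lambda>n. ennpow (f n) s)"
    have "X = tsum (\<lambda>n. \<Sum>k<Suc N. kconv (ball_kernel k) f n * g k n)"
    proof -
      have "ennpow (M n) s = (\<Sum>k<Suc N. kconv (ball_kernel k) f n * g k n)" for n
      proof -
        have "(\<Sum>k<Suc N. kconv (ball_kernel k) f n * g k n) = (\<Sum>k<Suc N. if k = i n then M n * ennpow (M n) (s-1) else 0)"
          by (intro sum.cong) (auto simp: g_def i(2)[symmetric])
        also have "\<dots> = M n * ennpow (M n) (s-1)" using i(1)[of n] by (subst sum.delta) auto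
        also have "\<dots> = ennpow (M n) s" using ennpow_add[of "M n" 1 "s-1"] by simp
        finally show ?thesis by simp
      qed
      then show ?thesis by (simp add: X_def)
    qed
    also have "\<dots> = tsum (\<lambda>m. f m * T m)"
      by (simp add: T_def tsum_sum kconv_ball_adjoint sum_distrib_left del: sum.lessThan_Suc)
    also have "\<dots> \<le> tsum (\<lambda>m. ennreal K * ennpow (f m) s + ennpow (T m) t * ennreal (1/C) / 2)"
    proof (rule tsum_mono)
      fix m
      \<comment> \<open>The weight b is chosen so that the power of T can be absorbed after the dual Doob inequality.\<close>
      define y where "y = ennpow (ennreal (1/b) * T m) (1/(s-1))"
      have "f m * T m = ennreal 1 * ((ennreal b * f m) * ennpow y (s-1))"
      proof -
        have "ennreal b * ennreal (1/b) = 1" using b by (simp flip: ennreal_mult)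
        then show ?thesis using s by (simp add: y_def ennpow_ennpow mult_ac) (metis mult.left_commute mult.right_neutral)
      qed
      also have "\<dots> \<le> ennreal (1 * (2 * 1) powr (s - 1)) * ennpow (ennreal b * f m) s + ennpow y s / 2"
        using s by (intro weighted_young_ennreal) auto
      also have "ennpow y s = ennpow (T m) t * ennreal (1/C)"
        using b s by (simp add: y_def ennpow_ennpow ennpow_mult ennpow_ennreal t_def powr_powr powr_divide mult.commute)
      also have "ennreal (1 * (2 * 1) powr (s - 1)) * ennpow (ennreal b * f m) s = ennreal K * ennpow (f m) s"
        using b by (simp add: K_def ennpow_mult ennpow_ennreal ennreal_mult mult_ac)
      finally show "f m * T m \<le> ennreal K * ennpow (f m) s + ennpow (T m) t * ennreal (1/C) / 2" .
    qed
    also have "\<dots> = ennreal K * Y + tsum (\<lambda>m. ennpow (T m) t) * ennreal (1/C) / 2"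
      by (simp add: tsum_add tsum_cmult tsum_multc nn_integral_divide Y_def)
    also have "\<dots> \<le> ennreal K * Y + ennreal C * X * ennreal (1/C) / 2"
    proof (intro add_left_mono divide_right_mono_ennreal mult_right_mono)
      show "tsum (\<lambda>m. ennpow (T m) t) \<le> ennreal C * X"
        using doob[where N = "Suc N" and d = 0 and g = g] s unfolding gsum T_def[symmetric]
        by (simp add: ennpow_ennpow X_def t_def T_def del: sum.lessThan_Suc)
    qed auto
    also have "ennreal C * X * ennreal (1/C) = X"
    proof -
      have "ennreal C * ennreal (1/C) = 1" using C by (simp flip: ennreal_mult)
      then show ?thesis by (metis mult.commute mult.left_commute mult.right_neutral)
    qed
    finally have 1: "X \<le> ennreal K * Y + X / 2" .
    show ?thesis
    proof (cases "Y = top")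
      case True
      then show ?thesis using K by (simp add: Y_def ennreal_mult_top)
    next
      case False
      have "X \<le> tsum (\<lambda>n. \<Sum>k<Suc N. ennpow (kconv (ball_kernel k) f n) s)"
        unfolding X_def
      proof (rule tsum_mono)
        fix n
        show "ennpow (M n) s \<le> (\<Sum>k<Suc N. ennpow (kconv (ball_kernel k) f n) s)"
          using i[of n] by (auto intro!: member_le_sum[of "i n" _ "\<lambda>k. ennpow (kconv (ball_kernel k) f n) s"] simp del: sum.lessThan_Suc)
      qed
      also have "\<dots> = (\<Sum>k<Suc N. tsum (\<lambda>n. ennpow (kconv (ball_kernel k) f n) s))"
        by (simp only: tsum_sum finite_lessThan)
      also have "\<dots> \<le> (\<Sum>k<Suc N. ennreal (2 powr s * 3 powr s) * Y)"
        unfolding Y_def using s by (intro sum_mono tsum_kconv_power tsum_ball_kernel) auto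
      also have "\<dots> < top" using False by (simp add: ennreal_mult_less_top less_top of_nat_less_top del: sum.lessThan_Suc)
      finally have "X \<le> 2 * ennreal K * Y" using ennreal_absorb[OF 1] by simp
      also have "2 * ennreal K = ennreal (2 * K)" using K by (simp add: ennreal_mult)
      also have "ennreal (2 * K) * Y \<le> ennreal (2 * K + 1) * Y" by (intro mult_right_mono ennreal_leI) auto
      finally show ?thesis by (simp add: X_def Y_def M_def)
    qed
  qed
  then show ?thesis using K by (intro exI[of _ "2 * K + 1"]) auto
qed

lemma ball_maximal:
  assumes s: "1 < s"
  shows "\<exists>C\<ge>0. \<forall>f. tsum (\<lambda>n. ennpow (SUP k. kconv (ball_kernel k) f n) s) \<le> ennreal C * tsum (\<lambda>n. ennpow (f n) s)"
proof -
  obtain C where C: "C \<ge> 0" and *: "\<And>N f. tsum (\<lambda>n. ennpow (SUP k\<in>{..<Suc N}. kconv (ball_kernel k) f n) s) \<le> ennreal C * tsum (\<lambda>n. ennpow (f n) s)"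
    using ball_maximal_finite[OF s] by blast
  have "tsum (\<lambda>n. ennpow (SUP k. kconv (ball_kernel k) f n) s) \<le> ennreal C * tsum (\<lambda>n. ennpow (f n) s)" for f
  proof -
    have inc: "incseq (\<lambda>N. SUP k\<in>{..<Suc N}. kconv (ball_kernel k) f n)" for n
      unfolding incseq_def by (auto intro!: SUP_subset_mono)
    have "(SUP k. kconv (ball_kernel k) f n) = (SUP N. SUP k\<in>{..<Suc N}. kconv (ball_kernel k) f n)" for n
    proof (intro antisym SUP_least)
      fix k
      have "kconv (ball_kernel k) f n \<le> (SUP k\<in>{..<Suc k}. kconv (ball_kernel k) f n)" by (intro SUP_upper) auto
      also have "\<dots> \<le> (SUP N. SUP k\<in>{..<Suc N}. kconv (ball_kernel k) f n)" by (rule SUP_upper[OF UNIV_I])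
      finally show "kconv (ball_kernel k) f n \<le> (SUP N. SUP k\<in>{..<Suc N}. kconv (ball_kernel k) f n)" .
    qed (rule SUP_upper[OF UNIV_I])
    then have "tsum (\<lambda>n. ennpow (SUP k. kconv (ball_kernel k) f n) s) = tsum (\<lambda>n. SUP N. ennpow (SUP k\<in>{..<Suc N}. kconv (ball_kernel k) f n) s)"
      using s by (simp add: ennpow_SUP)
    also have "\<dots> = (SUP N. tsum (\<lambda>n. ennpow (SUP k\<in>{..<Suc N}. kconv (ball_kernel k) f n) s))"
      using inc s unfolding incseq_def by (intro tsum_SUP_incseq) (auto simp: incseq_def intro!: ennpow_mono)
    also have "\<dots> \<le> ennreal C * tsum (\<lambda>n. ennpow (f n) s)"
      by (intro SUP_least *)
    finally show ?thesis .
  qed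
  then show ?thesis using C by blast
qed

section \<open>Vector-valued inequalities for kernels with quadratic decay\<close>

text \<open>The kernel \<open>2\<^sup>-\<^sup>k (1 + |m| / 2\<^sup>k)\<^sup>-\<^sup>2\<close>, which dominates, up to constants, all
  the kernels of scale \<open>2 ^ k\<close> that occur.\<close>
definition decay_kernel :: "nat \<Rightarrow> int \<Rightarrow> ennreal" where
  "decay_kernel k m = ennreal (1 / 2 ^ k / (1 + \<bar>real_of_int m\<bar> / 2 ^ k) ^ 2)"

lemma tsum_geometric: "tsum (\<lambda>i::nat. ennreal (4 / 2 ^ i)) = ennreal 8"
proof -
  have "(\<lambda>i. 4 * (1/2) ^ i :: real) sums (4 * (1 / (1 - 1/2)))"
    by (intro sums_mult geometric_sums) auto
  then have "(\<lambda>i. 4 / 2 ^ i :: real) sums 8" by (simp add: power_one_over)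
  then show ?thesis
    unfolding nn_integral_count_space_nat by (intro suminf_ennreal_eq) auto
qed

text \<open>The kernel is a superposition of interval averages with summable weights.\<close>
lemma decay_kernel_le: "decay_kernel k m \<le> tsum (\<lambda>i. ennreal (4 / 2 ^ i) * ball_kernel (k + i) m)"
proof -
  \<comment> \<open>One term of the superposition suffices: the one for the shortest interval that contains m.\<close>
  define P where "P i \<longleftrightarrow> \<bar>m\<bar> \<le> 2 ^ (k + i)" for i
  define i where "i = (LEAST i. P i)"
  have "\<exists>i. P i"
  proof -
    have "nat \<bar>m\<bar> < 2 ^ nat \<bar>m\<bar>" by simp
    also have "\<dots> \<le> 2 ^ (k + nat \<bar>m\<bar>)" by (intro power_increasing) auto
    finally have "\<bar>m\<bar> \<le> 2 ^ (k + nat \<bar>m\<bar>)" by (simp add: zless_nat_eq_int_zless nat_less_iff)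
    then show ?thesis unfolding P_def by blast
  qed
  then have Pi: "P i" unfolding i_def by (rule LeastI_ex)
  have "decay_kernel k m \<le> ennreal (4 / 2 ^ i) * ball_kernel (k + i) m"
  proof -
    have "1 / 2 ^ k / (1 + \<bar>real_of_int m\<bar> / 2 ^ k) ^ 2 \<le> 4 / 2 ^ i * (1 / 2 ^ (k + i))"
    proof (cases i)
      case 0
      have "1 \<le> (1 + \<bar>real_of_int m\<bar> / 2 ^ k) ^ 2" by (intro one_le_power) simp
      then have "1 / 2 ^ k / (1 + \<bar>real_of_int m\<bar> / 2 ^ k) ^ 2 \<le> 1 / 2 ^ k / 1"
        by (intro divide_left_mono mult_pos_pos zero_less_power add_pos_nonneg) auto
      also have "\<dots> \<le> 4 / 2 ^ k" by (simp add: divide_right_mono)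
      finally show ?thesis using 0 by simp
    next
      case (Suc l)
      then have "\<not> P l" unfolding i_def by (intro not_less_Least) auto
      then have "2 ^ (k + l) < \<bar>m\<bar>" by (simp add: P_def)
      then have "real_of_int (2 ^ (k + l)) < real_of_int \<bar>m\<bar>" by (simp only: of_int_less_iff)
      then have "2 ^ l \<le> 1 + \<bar>real_of_int m\<bar> / 2 ^ k" by (simp add: field_simps power_add add_increasing2)
      then have "(2 ^ l)^2 \<le> (1 + \<bar>real_of_int m\<bar> / 2 ^ k)^2" by (intro power_mono) auto
      then have "1 / 2 ^ k / (1 + \<bar>real_of_int m\<bar> / 2 ^ k) ^ 2 \<le> 1 / 2 ^ k / (2 ^ l)^2"
        by (intro divide_left_mono) (auto intro!: mult_pos_pos zero_less_power add_pos_nonneg)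
      also have "\<dots> = 4 / 2 ^ i * (1 / 2 ^ (k + i))"
        using Suc by (simp add: power_add power2_eq_square)
      finally show ?thesis .
    qed
    then show ?thesis using Pi
      by (simp add: decay_kernel_def ball_kernel_def P_def ennreal_mult[symmetric] ennreal_leI)
  qed
  also have "\<dots> \<le> tsum (\<lambda>i. ennreal (4 / 2 ^ i) * ball_kernel (k + i) m)"
    by (rule tsum_ge)
  finally show ?thesis .
qed

lemma kconv_decay_le: "kconv (decay_kernel k) g n \<le> tsum (\<lambda>i. ennreal (4 / 2 ^ i) * kconv (ball_kernel (k + i)) g n)"
proof -
  have "kconv (decay_kernel k) g n \<le> tsum (\<lambda>m. tsum (\<lambda>i. ennreal (4 / 2 ^ i) * ball_kernel (k + i) (n - m)) * g m)"
    unfolding kconv_def by (intro tsum_mono mult_right_mono decay_kernel_le) auto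
  also have "\<dots> = tsum (\<lambda>i. tsum (\<lambda>m. ennreal (4 / 2 ^ i) * ball_kernel (k + i) (n - m) * g m))"
    unfolding tsum_multc[symmetric] by (rule tsum_swap)
  also have "\<dots> = tsum (\<lambda>i. ennreal (4 / 2 ^ i) * kconv (ball_kernel (k + i)) g n)"
    by (simp add: kconv_def tsum_cmult[symmetric] mult.assoc)
  finally show ?thesis .
qed

lemma tsum_decay_kernel: "tsum (decay_kernel k) \<le> ennreal 24"
proof -
  have "tsum (decay_kernel k) \<le> tsum (\<lambda>m. tsum (\<lambda>i. ennreal (4 / 2 ^ i) * ball_kernel (k + i) m))"
    by (intro tsum_mono decay_kernel_le)
  also have "\<dots> = tsum (\<lambda>i. ennreal (4 / 2 ^ i) * tsum (ball_kernel (k + i)))"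
    unfolding tsum_cmult[symmetric] by (rule tsum_swap)
  also have "\<dots> \<le> tsum (\<lambda>i. ennreal (4 / 2 ^ i) * ennreal 3)"
    by (intro tsum_mono mult_left_mono tsum_ball_kernel) auto
  also have "\<dots> = ennreal 24" by (simp only: tsum_multc tsum_geometric) (simp flip: ennreal_mult)
  finally show ?thesis .
qed

lemma dual_doob_decay:
  assumes s: "1 \<le> s"
  shows "\<exists>C\<ge>0. \<forall>g. tsum (\<lambda>n. ennpow (tsum (\<lambda>k. kconv (decay_kernel k) (g k) n)) s)
    \<le> ennreal C * tsum (\<lambda>n. ennpow (tsum (\<lambda>k. g k n)) s)"
proof -
  obtain C where C: "C \<ge> 1" and doob: "\<And>d g. tsum (\<lambda>n. ennpow (tsum (\<lambda>k. kconv (ball_kernel (k + d)) (g k) n)) s)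
    \<le> ennreal C * tsum (\<lambda>n. ennpow (tsum (\<lambda>k. g k n)) s)" using dual_doob_ball[OF s] by blast
  define c where "c = 2 powr s * 8 powr (s - 1)"
  have "tsum (\<lambda>n. ennpow (tsum (\<lambda>k. kconv (decay_kernel k) (g k) n)) s)
    \<le> ennreal (c * (8 * C)) * tsum (\<lambda>n. ennpow (tsum (\<lambda>k. g k n)) s)" for g
  proof -
    define S where "S i n = tsum (\<lambda>k. kconv (ball_kernel (k + i)) (g k) n)" for i n
    define Y where "Y = tsum (\<lambda>n. ennpow (tsum (\<lambda>k. g k n)) s)"
    have "tsum (\<lambda>n. ennpow (tsum (\<lambda>k. kconv (decay_kernel k) (g k) n)) s)
       \<le> tsum (\<lambda>n. ennreal c * tsum (\<lambda>i. ennreal (4 / 2 ^ i) * ennpow (S i n) s))"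
    proof (rule tsum_mono)
      fix n
      have "tsum (\<lambda>k. kconv (decay_kernel k) (g k) n) \<le> tsum (\<lambda>k. tsum (\<lambda>i. ennreal (4 / 2 ^ i) * kconv (ball_kernel (k + i)) (g k) n))"
        by (intro tsum_mono kconv_decay_le)
      also have "\<dots> = tsum (\<lambda>i. ennreal (4 / 2 ^ i) * S i n)"
        by (subst tsum_swap) (simp add: S_def tsum_cmult)
      finally have "ennpow (tsum (\<lambda>k. kconv (decay_kernel k) (g k) n)) s \<le> ennpow (tsum (\<lambda>i. ennreal (4 / 2 ^ i) * S i n)) s"
        using s by (intro ennpow_mono) auto
      also have "\<dots> \<le> ennreal c * tsum (\<lambda>i. ennreal (4 / 2 ^ i) * ennpow (S i n) s)"
        unfolding c_def using s by (intro tsum_weighted_jensen) (auto simp: tsum_geometric)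
      finally show "ennpow (tsum (\<lambda>k. kconv (decay_kernel k) (g k) n)) s \<le> ennreal c * tsum (\<lambda>i. ennreal (4 / 2 ^ i) * ennpow (S i n) s)" .
    qed
    also have "\<dots> = ennreal c * tsum (\<lambda>i. ennreal (4 / 2 ^ i) * tsum (\<lambda>n. ennpow (S i n) s))"
      by (simp add: tsum_cmult) (subst tsum_swap, simp add: tsum_cmult)
    also have "\<dots> \<le> ennreal c * tsum (\<lambda>i. ennreal (4 / 2 ^ i) * (ennreal C * Y))"
      unfolding S_def Y_def by (intro mult_left_mono tsum_mono doob) auto
    also have "\<dots> = ennreal (c * (8 * C)) * Y"
      unfolding tsum_multc tsum_geometric using C by (simp add: c_def ennreal_mult mult_ac)
    finally show ?thesis by (simp add: Y_def)
  qed
  moreover have "c * (8 * C) \<ge> 0" using C by (simp add: c_def)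
  ultimately show ?thesis by blast
qed

lemma decay_maximal:
  assumes s: "1 < s"
  shows "\<exists>C\<ge>0. \<forall>f. tsum (\<lambda>n. ennpow (SUP k. kconv (decay_kernel k) f n) s) \<le> ennreal C * tsum (\<lambda>n. ennpow (f n) s)"
proof -
  obtain C where C: "C \<ge> 0" and *: "\<And>f. tsum (\<lambda>n. ennpow (SUP k. kconv (ball_kernel k) f n) s) \<le> ennreal C * tsum (\<lambda>n. ennpow (f n) s)"
    using ball_maximal[OF s] by blast
  have "tsum (\<lambda>n. ennpow (SUP k. kconv (decay_kernel k) f n) s) \<le> ennreal (8 powr s * C) * tsum (\<lambda>n. ennpow (f n) s)" for f
  proof -
    have "tsum (\<lambda>n. ennpow (SUP k. kconv (decay_kernel k) f n) s) \<le> tsum (\<lambda>n. ennpow (ennreal 8 * (SUP k. kconv (ball_kernel k) f n)) s)"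
    proof (intro tsum_mono ennpow_mono SUP_least)
      fix n k
      have "kconv (decay_kernel k) f n \<le> tsum (\<lambda>i. ennreal (4 / 2 ^ i) * (SUP k. kconv (ball_kernel k) f n))"
        by (rule order_trans[OF kconv_decay_le]) (intro tsum_mono mult_left_mono SUP_upper, auto)
      then show "kconv (decay_kernel k) f n \<le> ennreal 8 * (SUP k. kconv (ball_kernel k) f n)"
        unfolding tsum_multc tsum_geometric .
    qed (use s in auto)
    also have "\<dots> = ennreal (8 powr s) * tsum (\<lambda>n. ennpow (SUP k. kconv (ball_kernel k) f n) s)"
      unfolding ennpow_mult tsum_cmult by (simp add: ennpow_ennreal del: ennreal_numeral)
    also have "\<dots> \<le> ennreal (8 powr s) * (ennreal C * tsum (\<lambda>n. ennpow (f n) s))"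
      by (intro mult_left_mono *) auto
    finally show ?thesis using C by (simp add: ennreal_mult mult_ac)
  qed
  then show ?thesis using C by (intro exI[of _ "8 powr s * C"]) auto
qed

text \<open>The average of order \<open>r\<close> of \<open>x\<close> at scale \<open>2 ^ k\<close>, with quadratically decaying weights.\<close>
definition avg :: "real \<Rightarrow> nat \<Rightarrow> (int \<Rightarrow> ennreal) \<Rightarrow> int \<Rightarrow> ennreal" where
  "avg r k x n = ennpow (kconv (decay_kernel k) (\<lambda>m. ennpow (x m) r) n) (1 / r)"

lemma avg_cmult: "0 < r \<Longrightarrow> avg r k (\<lambda>m. c * x m) n = c * avg r k x n"
  by (simp add: avg_def ennpow_mult kconv_cmult ennpow_ennpow)

lemma lpnorm_top: "lpnorm top I g = (SUP i\<in>I. g i)" "lpnorm \<infinity> I g = (SUP i\<in>I. g i)"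
  by (auto simp: lpnorm_def)

lemma lpnorm_ennreal: "0 < p \<Longrightarrow> lpnorm (ennreal p) I g = ennpow (\<integral>\<^sup>+ i. ennpow (g i) p \<partial>count_space I) (1 / p)"
  by (auto simp: lpnorm_def)

lemma ennpow_lpnorm: "0 < p \<Longrightarrow> ennpow (lpnorm (ennreal p) I g) p = (\<integral>\<^sup>+ i. ennpow (g i) p \<partial>count_space I)"
  by (simp add: lpnorm_ennreal ennpow_ennpow)

lemma lpnorm_le_of_tsum_le:
  assumes p: "0 < p" and C: "0 \<le> C" and le: "tsum (\<lambda>i. ennpow (f i) p) \<le> ennreal C * tsum (\<lambda>i. ennpow (g i) p)"
  shows "lpnorm (ennreal p) UNIV f \<le> ennreal (C powr (1/p)) * lpnorm (ennreal p) UNIV g"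
  using ennpow_mono[OF le, of "1/p"] p C by (simp add: lpnorm_ennreal ennpow_mult ennpow_ennreal)

lemma lpnorm_avg_le:
  assumes r: "0 < r" "ennreal r \<le> p"
  shows "\<exists>C\<ge>0. \<forall>k x. lpnorm p UNIV (avg r k x) \<le> ennreal C * lpnorm p UNIV x"
proof (cases p)
  case top
  have "lpnorm p UNIV (avg r k x) \<le> ennreal (24 powr (1/r)) * lpnorm p UNIV x" for k x
    unfolding top lpnorm_top avg_def
  proof (rule SUP_least)
    fix n
    have "kconv (decay_kernel k) (\<lambda>m. ennpow (x m) r) n \<le> tsum (\<lambda>m. decay_kernel k (n - m) * ennpow (SUP m. x m) r)"
      unfolding kconv_def using r by (intro tsum_mono mult_left_mono ennpow_mono SUP_upper) auto
    also have "\<dots> = tsum (decay_kernel k) * ennpow (SUP m. x m) r" by (simp add: tsum_multc tsum_shift)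
    also have "\<dots> \<le> ennreal 24 * ennpow (SUP m. x m) r" by (intro mult_right_mono tsum_decay_kernel) auto
    finally have "ennpow (kconv (decay_kernel k) (\<lambda>m. ennpow (x m) r) n) (1/r) \<le> ennpow (ennreal 24 * ennpow (SUP m. x m) r) (1/r)"
      using r by (intro ennpow_mono) auto
    also have "\<dots> = ennreal (24 powr (1/r)) * (SUP m. x m)"
      using r ennpow_ennreal[of 24 "1/r"] by (simp add: ennpow_mult ennpow_ennpow)
    finally show "ennpow (kconv (decay_kernel k) (\<lambda>m. ennpow (x m) r) n) (1/r) \<le> ennreal (24 powr (1/r)) * (SUP m. x m)" .
  qed
  then show ?thesis by (intro exI[of _ "24 powr (1/r)"]) auto
next
  case (real p')
  then have rp: "r \<le> p'" "0 < p'" using r by (auto simp: ennreal_le_iff2)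
  define C where "C = 2 powr (p'/r) * 24 powr (p'/r)"
  have "tsum (\<lambda>n. ennpow (avg r k x n) p') \<le> ennreal C * tsum (\<lambda>n. ennpow (x n) p')" for k x
    using tsum_kconv_power[of "p'/r" "decay_kernel k" 24 "\<lambda>m. ennpow (x m) r"] rp r tsum_decay_kernel
    by (simp add: avg_def ennpow_ennpow C_def)
  then have "lpnorm p UNIV (avg r k x) \<le> ennreal (C powr (1/p')) * lpnorm p UNIV x" for k x
    unfolding real using rp by (intro lpnorm_le_of_tsum_le) (auto simp: C_def)
  then show ?thesis by (intro exI[of _ "C powr (1/p')"]) auto
qed

text \<open>The case \<open>q = \<infinity>\<close> of \<open>triebel_avg_le\<close>.\<close>
lemma triebel_avg_sup:
  assumes r: "0 < r" "r < p"
  shows "\<exists>C\<ge>0. \<forall>x. tsum (\<lambda>n. ennpow (SUP k. avg r k (x k) n) p) \<le> ennreal C * tsum (\<lambda>n. ennpow (SUP k. x k n) p)"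
proof -
  obtain C where C: "C \<ge> 0" and *: "\<And>f. tsum (\<lambda>n. ennpow (SUP k. kconv (decay_kernel k) f n) (p/r)) \<le> ennreal C * tsum (\<lambda>n. ennpow (f n) (p/r))"
    using decay_maximal[of "p/r"] r by auto
  have "tsum (\<lambda>n. ennpow (SUP k. avg r k (x k) n) p) \<le> ennreal C * tsum (\<lambda>n. ennpow (SUP k. x k n) p)" for x :: "nat \<Rightarrow> int \<Rightarrow> ennreal"
  proof -
    define X where "X n = ennpow (SUP k. x k n) r" for n
    have "tsum (\<lambda>n. ennpow (SUP k. avg r k (x k) n) p) \<le> tsum (\<lambda>n. ennpow (ennpow (SUP k. kconv (decay_kernel k) X n) (1/r)) p)"
    proof (intro tsum_mono ennpow_mono SUP_least)
      fix n k
      have "kconv (decay_kernel k) (\<lambda>m. ennpow (x k m) r) n \<le> kconv (decay_kernel k) X n"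
        unfolding X_def using r by (intro kconv_mono ennpow_mono SUP_upper) auto
      also have "\<dots> \<le> (SUP k. kconv (decay_kernel k) X n)" by (rule SUP_upper) auto
      finally show "avg r k (x k) n \<le> ennpow (SUP k. kconv (decay_kernel k) X n) (1/r)"
        unfolding avg_def using r by (intro ennpow_mono) auto
    qed (use r in auto)
    also have "\<dots> \<le> ennreal C * tsum (\<lambda>n. ennpow (X n) (p/r))" using *[of X] by (simp add: ennpow_ennpow)
    finally show ?thesis using r by (simp add: X_def ennpow_ennpow)
  qed
  then show ?thesis using C by blast
qed

text \<open>The case \<open>q \<le> p\<close> of \<open>triebel_avg_le\<close>: by the Jensen inequality the power \<open>q\<close> moves inside the averages, and the dual Doob
  inequality with exponent \<open>p / q\<close> applies.\<close>
lemma triebel_avg_ge: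
  assumes r: "0 < r" "r \<le> q" "q \<le> p"
  shows "\<exists>C\<ge>0. \<forall>x. tsum (\<lambda>n. ennpow (tsum (\<lambda>k. ennpow (avg r k (x k) n) q)) (p/q)) \<le>
    ennreal C * tsum (\<lambda>n. ennpow (tsum (\<lambda>k. ennpow (x k n) q)) (p/q))"
proof -
  obtain C where C: "C \<ge> 0" and doob: "\<And>g. tsum (\<lambda>n. ennpow (tsum (\<lambda>k. kconv (decay_kernel k) (g k) n)) (p/q))
    \<le> ennreal C * tsum (\<lambda>n. ennpow (tsum (\<lambda>k. g k n)) (p/q))" using dual_doob_decay[of "p/q"] r by auto
  define c where "c = 2 powr (q/r) * 24 powr (q/r - 1)"
  have "tsum (\<lambda>n. ennpow (tsum (\<lambda>k. ennpow (avg r k (x k) n) q)) (p/q)) \<le>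
    ennreal (c powr (p/q) * C) * tsum (\<lambda>n. ennpow (tsum (\<lambda>k. ennpow (x k n) q)) (p/q))" for x
  proof -
    have "tsum (\<lambda>n. ennpow (tsum (\<lambda>k. ennpow (avg r k (x k) n) q)) (p/q)) \<le>
       tsum (\<lambda>n. ennpow (tsum (\<lambda>k. ennreal c * kconv (decay_kernel k) (\<lambda>m. ennpow (x k m) q) n)) (p/q))"
    proof (intro tsum_mono ennpow_mono)
      fix n k
      show "ennpow (avg r k (x k) n) q \<le> ennreal c * kconv (decay_kernel k) (\<lambda>m. ennpow (x k m) q) n"
        using kconv_jensen[of "q/r" "decay_kernel k" 24 "\<lambda>m. ennpow (x k m) r" n] r tsum_decay_kernel
        by (simp add: avg_def ennpow_ennpow c_def)
    qed (use r in auto)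
    also have "\<dots> = ennreal (c powr (p/q)) * tsum (\<lambda>n. ennpow (tsum (\<lambda>k. kconv (decay_kernel k) (\<lambda>m. ennpow (x k m) q) n)) (p/q))"
      by (simp add: tsum_cmult ennpow_mult ennpow_ennreal c_def)
    also have "\<dots> \<le> ennreal (c powr (p/q)) * (ennreal C * tsum (\<lambda>n. ennpow (tsum (\<lambda>k. ennpow (x k n) q)) (p/q)))"
      by (intro mult_left_mono doob) auto
    finally show ?thesis using C by (simp add: ennreal_mult mult_ac)
  qed
  then show ?thesis using C by (intro exI[of _ "c powr (p/q) * C"]) auto
qed

text \<open>The case \<open>p < q < \<infinity>\<close> of \<open>triebel_avg_le\<close>. With \<open>V = (\<Sum>\<^sub>k x\<^sub>k\<^sup>q)\<^sup>1\<^sup>/\<^sup>q\<close> and \<open>b = 1 - p / q\<close>, the Hoelder inequality applied to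
  \<open>x\<^sub>k\<^sup>r = (x\<^sub>k\<^sup>r V\<^sup>-\<^sup>r\<^sup>b) V\<^sup>r\<^sup>b\<close> inside the averages separates a term that is linear in the averages and
  a maximal function of a power of \<open>V\<close>. The integral of each is bounded by that of \<open>V\<^sup>p\<close>.\<close>
lemma triebel_avg_less:
  assumes r: "0 < r" "r < p" "p < q"
  shows "\<exists>C\<ge>0. \<forall>x. tsum (\<lambda>n. ennpow (tsum (\<lambda>k. ennpow (avg r k (x k) n) q)) (p/q)) \<le>
    ennreal C * tsum (\<lambda>n. ennpow (tsum (\<lambda>k. ennpow (x k n) q)) (p/q))"
proof -
  define b where "b = 1 - p/q"
  define t where "t = q / r"
  define t' where "t' = q / (q - r)"
  have b: "0 < b" "b < 1" using r by (auto simp: b_def field_simps)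
  have t: "1 < t" "1 < t'" "1/t + 1/t' = 1" using r by (auto simp: t_def t'_def field_simps)
  define \<kappa> where "\<kappa> = p / (r * b * t')"
  have \<kappa>: "1 < \<kappa>"
  proof -
    \<comment> \<open>This is where the order r of the averages must be smaller than p.\<close>
    have "r * b * t' = r * (q - p) / (q - r)" using r by (simp add: b_def t'_def field_simps)
    also have "\<dots> < p"
    proof -
      have "r * (q - p) < p * (q - r)" using mult_strict_right_mono[of r p q] r by (simp add: algebra_simps)
      then show ?thesis using r by (simp add: pos_divide_less_eq)
    qed
    finally have "r * b * t' < p" .
    moreover have "0 < r * b * t'" using r b t by simp
    ultimately show ?thesis by (simp add: \<kappa>_def)
  qed
  obtain C where C: "C \<ge> 0" and max_bound: "\<And>f. tsum (\<lambda>n. ennpow (SUP k. kconv (decay_kernel k) f n) \<kappa>) \<le> ennreal C * tsum (\<lambda>n. ennpow (f n) \<kappa>)"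
    using decay_maximal[OF \<kappa>] by blast
  define D where "D = 2 powr (p/r) * (C + 24)"
  have "tsum (\<lambda>n. ennpow (tsum (\<lambda>k. ennpow (avg r k (x k) n) q)) (p/q)) \<le>
    ennreal D * tsum (\<lambda>n. ennpow (tsum (\<lambda>k. ennpow (x k n) q)) (p/q))" for x :: "nat \<Rightarrow> int \<Rightarrow> ennreal"
  proof (cases "tsum (\<lambda>n. ennpow (tsum (\<lambda>k. ennpow (x k n) q)) (p/q)) = top")
    case True
    have "ennreal D \<noteq> 0" using C by (simp add: D_def)
    then show ?thesis unfolding True by (simp add: ennreal_mult_top)
  next
    case False
    define V where "V n = ennpow (tsum (\<lambda>k. ennpow (x k n) q)) (1/q)" for n
    have Vq: "ennpow (V n) q = tsum (\<lambda>k. ennpow (x k n) q)" for n using r by (simp add: V_def ennpow_ennpow)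
    have Vp: "tsum (\<lambda>n. ennpow (V n) p) = tsum (\<lambda>n. ennpow (tsum (\<lambda>k. ennpow (x k n) q)) (p/q))"
      by (simp add: V_def ennpow_ennpow)
    have Vfin: "V n \<noteq> top" for n
    proof
      assume "V n = top"
      then have "ennpow (V n) p = top" by simp
      then have "tsum (\<lambda>n. ennpow (V n) p) = top" using tsum_ge[of "\<lambda>n. ennpow (V n) p" n] by (simp add: top_unique)
      with False Vp show False by simp
    qed
    have xV: "x k n = 0" if "V n = 0" for k n
    proof -
      have "ennpow (x k n) q \<le> ennpow (V n) q" unfolding Vq by (rule tsum_ge)
      then show ?thesis using that by simp
    qed
    define W where "W n = tsum (\<lambda>k. kconv (decay_kernel k) (\<lambda>m. ennpow (x k m) q * ennpow (V m) (- (q * b))) n)" for n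
    define Z where "Z n = (SUP k. kconv (decay_kernel k) (\<lambda>m. ennpow (V m) (r * b * t')) n)" for n
    \<comment> \<open>If V m = 0 then x k m = 0, and both sides vanish.\<close>
    have split: "ennpow (x k m) r = (ennpow (x k m) r * ennpow (V m) (- (r * b))) * ennpow (V m) (r * b)" for k m
      using ennpow_inverse_cancel[OF _ Vfin, of m "r * b"] xV[of m k] by (cases "V m = 0") (auto simp: mult_ac)
    have yk: "ennpow (avg r k (x k) n) q \<le> ennpow 2 t * ennpow (Z n) (t/t') *
        kconv (decay_kernel k) (\<lambda>m. ennpow (x k m) q * ennpow (V m) (- (q * b))) n" for k n
    proof -
      have "kconv (decay_kernel k) (\<lambda>m. ennpow (x k m) r) n =
          kconv (decay_kernel k) (\<lambda>m. (ennpow (x k m) r * ennpow (V m) (- (r * b))) * ennpow (V m) (r * b)) n"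
        using split by simp
      also have "\<dots> \<le> 2 * (ennpow (kconv (decay_kernel k) (\<lambda>m. ennpow (x k m) q * ennpow (V m) (- (q * b))) n) (1/t) *
           ennpow (kconv (decay_kernel k) (\<lambda>m. ennpow (V m) (r * b * t')) n) (1/t'))"
        using tsum_weighted_hoelder[OF t, of "\<lambda>m. decay_kernel k (n - m)" "\<lambda>m. ennpow (x k m) r * ennpow (V m) (- (r * b))" "\<lambda>m. ennpow (V m) (r * b)"] r
        by (simp add: kconv_def ennpow_mult ennpow_ennpow t_def mult.commute[of _ b])
      also have "\<dots> \<le> 2 * (ennpow (kconv (decay_kernel k) (\<lambda>m. ennpow (x k m) q * ennpow (V m) (- (q * b))) n) (1/t) *
           ennpow (Z n) (1/t'))"
        unfolding Z_def using t by (intro mult_left_mono ennpow_mono SUP_upper) auto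
      finally have "ennpow (kconv (decay_kernel k) (\<lambda>m. ennpow (x k m) r) n) t \<le> ennpow (2 * (ennpow (kconv (decay_kernel k) (\<lambda>m. ennpow (x k m) q * ennpow (V m) (- (q * b))) n) (1/t) *
           ennpow (Z n) (1/t'))) t" using t by (intro ennpow_mono) auto
      then show ?thesis using t by (simp add: avg_def ennpow_ennpow ennpow_mult t_def[symmetric] mult_ac)
    qed
    have "ennpow (tsum (\<lambda>k. ennpow (avg r k (x k) n) q)) (p/q) \<le> ennreal (2 powr (p/r)) * (ennpow (Z n) \<kappa> + W n)" for n
    proof -
      have "tsum (\<lambda>k. ennpow (avg r k (x k) n) q) \<le> ennpow 2 t * ennpow (Z n) (t/t') * W n"
        unfolding W_def tsum_cmult[symmetric] by (intro tsum_mono yk)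
      then have "ennpow (tsum (\<lambda>k. ennpow (avg r k (x k) n) q)) (p/q) \<le> ennpow (ennpow 2 t * ennpow (Z n) (t/t') * W n) (p/q)"
        using r by (intro ennpow_mono) auto
      also have "\<dots> = ennpow 2 (p/r) * (ennpow (Z n) (t/t' * (p/q)) * ennpow (W n) (p/q))"
        using r by (simp add: ennpow_mult ennpow_ennpow t_def mult.assoc)
      also have "\<dots> \<le> ennpow 2 (p/r) * (ennpow (ennpow (Z n) (t/t' * (p/q))) (1/b) + ennpow (ennpow (W n) (p/q)) (q/p))"
      proof (intro mult_left_mono young_ennreal)
        show "1 / (1 / b) + 1 / (q / p) = 1" using r by (simp add: b_def)
      qed (use b r in auto)
      also have "ennpow (ennpow (Z n) (t/t' * (p/q))) (1/b) = ennpow (Z n) \<kappa>"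
        using r by (simp add: ennpow_ennpow \<kappa>_def t_def mult_ac)
      also have "ennpow (ennpow (W n) (p/q)) (q/p) = W n" using r by (simp add: ennpow_ennpow)
      also have "ennpow 2 (p/r) = ennreal (2 powr (p/r))" using ennpow_ennreal[of 2 "p/r"] by simp
      finally show ?thesis .
    qed
    then have "tsum (\<lambda>n. ennpow (tsum (\<lambda>k. ennpow (avg r k (x k) n) q)) (p/q)) \<le> tsum (\<lambda>n. ennreal (2 powr (p/r)) * (ennpow (Z n) \<kappa> + W n))"
      by (rule tsum_mono)
    also have "\<dots> = ennreal (2 powr (p/r)) * (tsum (\<lambda>n. ennpow (Z n) \<kappa>) + tsum W)"
      by (simp add: tsum_cmult tsum_add)
    also have "\<dots> \<le> ennreal (2 powr (p/r)) * (ennreal C * tsum (\<lambda>n. ennpow (V n) p) + ennreal 24 * tsum (\<lambda>n. ennpow (V n) p))"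
    proof (intro mult_left_mono add_mono)
      have "r * b * t' * \<kappa> = p" using r b t by (simp add: \<kappa>_def)
      then show "tsum (\<lambda>n. ennpow (Z n) \<kappa>) \<le> ennreal C * tsum (\<lambda>n. ennpow (V n) p)"
        using max_bound[of "\<lambda>m. ennpow (V m) (r * b * t')"] by (simp add: Z_def ennpow_ennpow)
      have "tsum W = tsum (\<lambda>k. tsum (decay_kernel k) * tsum (\<lambda>m. ennpow (x k m) q * ennpow (V m) (- (q * b))))"
        unfolding W_def by (subst tsum_swap) (simp add: tsum_kconv)
      also have "\<dots> \<le> tsum (\<lambda>k. ennreal 24 * tsum (\<lambda>m. ennpow (x k m) q * ennpow (V m) (- (q * b))))"
        by (intro tsum_mono mult_right_mono tsum_decay_kernel) auto
      also have "\<dots> = ennreal 24 * tsum (\<lambda>m. tsum (\<lambda>k. ennpow (x k m) q) * ennpow (V m) (- (q * b)))"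
        unfolding tsum_cmult by (subst tsum_swap[symmetric]) (simp add: tsum_multc)
      also have "(\<lambda>m. tsum (\<lambda>k. ennpow (x k m) q) * ennpow (V m) (- (q * b))) = (\<lambda>m. ennpow (V m) p)"
      proof -
        have "q + - (q * b) = p" using r by (simp add: b_def field_simps)
        then show ?thesis unfolding Vq[symmetric] by (simp only: ennpow_add[symmetric])
      qed
      finally show "tsum W \<le> ennreal 24 * tsum (\<lambda>n. ennpow (V n) p)" .
    qed auto
    also have "\<dots> = ennreal D * tsum (\<lambda>n. ennpow (V n) p)"
      using C by (simp add: D_def ennreal_mult distrib_right mult.assoc)
    finally show ?thesis unfolding Vp .
  qed
  moreover have "D \<ge> 0" using C by (simp add: D_def)
  ultimately show ?thesis by blast
qed

text \<open>This takes the place of the vector-valued maximal inequality of Fefferman and Stein: only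
  one scale of averaging is attached to each component.\<close>
lemma triebel_avg_le:
  assumes r: "0 < r" "ennreal r < p" "ennreal r < q" and p: "p < \<infinity>"
  shows "\<exists>C\<ge>0. \<forall>x. lpnorm p UNIV (\<lambda>n. lpnorm q UNIV (\<lambda>k. avg r k (x k) n)) \<le>
    ennreal C * lpnorm p UNIV (\<lambda>n. lpnorm q UNIV (\<lambda>k. x k n))"
proof -
  obtain p' where p': "p = ennreal p'" "r < p'" using p r by (cases p) (auto simp: ennreal_less_iff)
  have "\<exists>C\<ge>0. \<forall>x. tsum (\<lambda>n. ennpow (lpnorm q UNIV (\<lambda>k. avg r k (x k) n)) p') \<le> ennreal C * tsum (\<lambda>n. ennpow (lpnorm q UNIV (\<lambda>k. x k n)) p')"
  proof (cases q)
    case top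
    then show ?thesis using triebel_avg_sup[OF r(1) p'(2)] by (simp add: lpnorm_top)
  next
    case (real q')
    then have "r < q'" using r by (auto simp: ennreal_less_iff)
    then show ?thesis
      using triebel_avg_ge[of r q' p'] triebel_avg_less[of r p' q'] r p' real
      by (cases "q' \<le> p'") (auto simp: lpnorm_ennreal ennpow_ennpow)
  qed
  then obtain C where C: "C \<ge> 0" "\<And>x. tsum (\<lambda>n. ennpow (lpnorm q UNIV (\<lambda>k. avg r k (x k) n)) p') \<le> ennreal C * tsum (\<lambda>n. ennpow (lpnorm q UNIV (\<lambda>k. x k n)) p')"
    by blast
  then show ?thesis unfolding p'(1) using r p'
    by (intro exI[of _ "C powr (1/p')"]) (auto intro!: lpnorm_le_of_tsum_le)
qed

section \<open>Comparison of dyadic quasi-norms\<close>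

lemma lpnorm_mono: "(\<And>i. i \<in> I \<Longrightarrow> f i \<le> g i) \<Longrightarrow> 0 < q \<Longrightarrow> lpnorm q I f \<le> lpnorm q I g"
  by (cases q) (auto simp: lpnorm_top lpnorm_ennreal intro!: SUP_mono ennpow_mono nn_integral_mono)

lemma lpnorm_cmult: "0 < q \<Longrightarrow> lpnorm q I (\<lambda>i. c * f i) = c * lpnorm q I f"
  by (cases q) (auto simp: lpnorm_top lpnorm_ennreal ennpow_mult nn_integral_cmult ennpow_ennpow SUP_mult_left_ennreal)

lemma lpnorm_restrict:
  assumes "0 < q"
  shows "lpnorm q I f = lpnorm q UNIV (\<lambda>i. if i \<in> I then f i else 0)"
proof (cases q)
  case top
  have "(SUP i\<in>I. f i) = (SUP i. if i \<in> I then f i else 0)"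
  proof (intro antisym SUP_least)
    fix i assume "i \<in> I"
    then show "f i \<le> (SUP i. if i \<in> I then f i else 0)" by (intro SUP_upper2[of i]) auto
  next
    fix i show "(if i \<in> I then f i else 0) \<le> (SUP i\<in>I. f i)" by (auto intro: SUP_upper)
  qed
  then show ?thesis by (simp add: top lpnorm_top)
next
  case (real r)
  then have r: "r > 0" using assms by auto
  have "(\<integral>\<^sup>+ i. ennpow (f i) r \<partial>count_space I) = (\<integral>\<^sup>+ i. ennpow (f i) r * indicator I i \<partial>count_space UNIV)"
    by (rule nn_integral_count_space_indicator) auto
  also have "\<dots> = tsum (\<lambda>i. ennpow (if i \<in> I then f i else 0) r)"
    by (intro nn_integral_cong) auto
  finally show ?thesis using r by (simp add: real lpnorm_ennreal)
qed

lemma lpnorm_bij_betw: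
  assumes "bij_betw g A B"
  shows "lpnorm q A (\<lambda>i. f (g i)) = lpnorm q B f"
proof -
  have "(SUP i\<in>A. f (g i)) = (SUP i\<in>B. f i)"
    using assms by (metis bij_betw_imp_surj_on image_image)
  moreover have "(\<integral>\<^sup>+ i. ennpow (f (g i)) s \<partial>count_space A) = (\<integral>\<^sup>+ i. ennpow (f i) s \<partial>count_space B)" for s
    by (rule nn_integral_bij_count_space[OF assms])
  ultimately show ?thesis by (simp add: lpnorm_def)
qed

lemma lpnorm_sum_le:
  fixes D :: "'d set"
  assumes q: "0 < q" and D: "finite D"
  shows "\<exists>C\<ge>0. \<forall>(I :: 'i set) f B. (\<forall>d\<in>D. lpnorm q I (f d) \<le> B) \<longrightarrow> lpnorm q I (\<lambda>i. \<Sum>d\<in>D. f d i) \<le> ennreal C * B"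
proof (cases q)
  case top
  have "(SUP i\<in>I. \<Sum>d\<in>D. f d i) \<le> ennreal (card D) * B" if "\<forall>d\<in>D. (SUP i\<in>I. f d i) \<le> B" for I :: "'i set" and f B
  proof (rule SUP_least)
    fix i assume i: "i \<in> I"
    have "(\<Sum>d\<in>D. f d i) \<le> (\<Sum>d\<in>D. B)"
      using that i by (intro sum_mono) (auto intro: order_trans[OF SUP_upper[OF i]])
    then show "(\<Sum>d\<in>D. f d i) \<le> ennreal (card D) * B" by (simp add: ennreal_of_nat_eq_real_of_nat)
  qed
  then show ?thesis unfolding top lpnorm_top by (intro exI[of _ "real (card D)"]) auto
next
  case (real r)
  then have r: "r > 0" using q by auto
  define C where "C = (real (card D) powr r * real (card D)) powr (1/r)"
  have "lpnorm q I (\<lambda>i. \<Sum>d\<in>D. f d i) \<le> ennreal C * B" if B: "\<forall>d\<in>D. lpnorm q I (f d) \<le> B" for I :: "'i set" and f B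
  proof -
    have "(\<integral>\<^sup>+ i. ennpow (\<Sum>d\<in>D. f d i) r \<partial>count_space I) \<le> (\<integral>\<^sup>+ i. ennreal (real (card D) powr r) * (\<Sum>d\<in>D. ennpow (f d i) r) \<partial>count_space I)"
      by (intro nn_integral_mono ennpow_sum_le r D)
    also have "\<dots> = ennreal (real (card D) powr r) * (\<Sum>d\<in>D. (\<integral>\<^sup>+ i. ennpow (f d i) r \<partial>count_space I))"
      using D by (simp add: nn_integral_cmult nn_integral_sum)
    also have "\<dots> \<le> ennreal (real (card D) powr r) * (\<Sum>d\<in>D. ennpow B r)"
    proof (intro mult_left_mono sum_mono)
      fix d assume "d \<in> D"
      then have "ennpow (lpnorm q I (f d)) r \<le> ennpow B r" using B r by (intro ennpow_mono) auto
      then show "(\<integral>\<^sup>+ i. ennpow (f d i) r \<partial>count_space I) \<le> ennpow B r"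
        using r by (simp add: real ennpow_lpnorm)
    qed auto
    also have "\<dots> = ennreal (real (card D) powr r * real (card D)) * ennpow B r"
      by (simp add: ennreal_mult ennreal_of_nat_eq_real_of_nat mult.assoc)
    finally have "ennpow (\<integral>\<^sup>+ i. ennpow (\<Sum>d\<in>D. f d i) r \<partial>count_space I) (1/r) \<le> ennpow (ennreal (real (card D) powr r * real (card D)) * ennpow B r) (1/r)"
      using r by (intro ennpow_mono) auto
    then show ?thesis using r by (simp add: real lpnorm_ennreal ennpow_mult ennpow_ennpow ennpow_ennreal C_def)
  qed
  then show ?thesis by (intro exI[of _ C]) (auto simp: C_def)
qed

text \<open>Sums over boundedly many neighbouring scales do not change a weighted \<open>\<ell>\<^sup>q\<close> quasi-norm by more than
  a constant factor.\<close>
lemma lpnorm_index_shift: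
  fixes q :: ennreal and \<alpha> C :: real
  assumes q: "0 < q" and C: "0 \<le> C"
  shows "\<exists>C'\<ge>0. \<forall>J J' W Y. (\<forall>j\<in>J. W j \<le> ennreal C * (\<Sum>\<nu>\<in>J' \<inter> {j-8..j+8}. Y \<nu>)) \<longrightarrow>
     lpnorm q J (\<lambda>j::int. ennreal (2 powr (of_int j * \<alpha>)) * W j) \<le>
     ennreal C' * lpnorm q J' (\<lambda>\<nu>. ennreal (2 powr (of_int \<nu> * \<alpha>)) * Y \<nu>)"
proof -
  obtain A where A: "A \<ge> 0" and sum: "\<And>(I::int set) f B. (\<forall>d\<in>{-8..8::int}. lpnorm q I (f d) \<le> B) \<Longrightarrow>
     lpnorm q I (\<lambda>i. \<Sum>d\<in>{-8..8}. f d i) \<le> ennreal A * B"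
    using lpnorm_sum_le[OF q, of "{-8..8::int}"] by blast
  define c where "c = C * 2 powr (8 * \<bar>\<alpha>\<bar>)"
  have c: "c \<ge> 0" using C by (simp add: c_def)
  have "lpnorm q J (\<lambda>j::int. ennreal (2 powr (of_int j * \<alpha>)) * W j) \<le>
     ennreal (c * A) * lpnorm q J' (\<lambda>\<nu>. ennreal (2 powr (of_int \<nu> * \<alpha>)) * Y \<nu>)"
    if H: "\<forall>j\<in>J. W j \<le> ennreal C * (\<Sum>\<nu>\<in>J' \<inter> {j-8..j+8}. Y \<nu>)" for J J' W Y
  proof -
    define Z where "Z \<nu> = (if \<nu> \<in> J' then ennreal (2 powr (of_int \<nu> * \<alpha>)) * Y \<nu> else 0)" for \<nu>
    have "ennreal (2 powr (of_int j * \<alpha>)) * W j \<le> ennreal c * (\<Sum>d\<in>{-8..8}. Z (j + d))" if "j \<in> J" for j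
    proof -
      have "ennreal (2 powr (of_int j * \<alpha>)) * W j \<le> ennreal (2 powr (of_int j * \<alpha>)) * (ennreal C * (\<Sum>\<nu>\<in>J' \<inter> {j-8..j+8}. Y \<nu>))"
        using H that by (intro mult_left_mono) auto
      also have "\<dots> = ennreal C * (\<Sum>\<nu>\<in>J' \<inter> {j-8..j+8}. ennreal (2 powr (of_int j * \<alpha>)) * Y \<nu>)"
        by (simp add: sum_distrib_left mult_ac)
      also have "\<dots> \<le> ennreal C * (\<Sum>\<nu>\<in>J' \<inter> {j-8..j+8}. ennreal (2 powr (8 * \<bar>\<alpha>\<bar>)) * Z \<nu>)"
      proof (intro mult_left_mono sum_mono)
        fix \<nu> assume \<nu>: "\<nu> \<in> J' \<inter> {j-8..j+8}"
        have "of_int (j - \<nu>) * \<alpha> \<le> \<bar>of_int (j - \<nu>) :: real\<bar> * \<bar>\<alpha>\<bar>"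
          by (metis abs_ge_self abs_mult)
        also have "\<dots> \<le> 8 * \<bar>\<alpha>\<bar>" using \<nu> by (intro mult_right_mono) auto
        finally have "2 powr (of_int j * \<alpha>) \<le> 2 powr (8 * \<bar>\<alpha>\<bar> + of_int \<nu> * \<alpha>)"
          by (intro powr_mono) (auto simp: algebra_simps)
        also have "\<dots> = 2 powr (8 * \<bar>\<alpha>\<bar>) * 2 powr (of_int \<nu> * \<alpha>)" by (rule powr_add)
        finally have "ennreal (2 powr (of_int j * \<alpha>)) \<le> ennreal (2 powr (8 * \<bar>\<alpha>\<bar>)) * ennreal (2 powr (of_int \<nu> * \<alpha>))"
          by (simp add: ennreal_leI flip: ennreal_mult)
        from mult_right_mono[OF this, of "Y \<nu>"]
        show "ennreal (2 powr (of_int j * \<alpha>)) * Y \<nu> \<le> ennreal (2 powr (8 * \<bar>\<alpha>\<bar>)) * Z \<nu>"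
          using \<nu> by (simp add: Z_def mult.assoc)
      qed auto
      also have "\<dots> = ennreal c * (\<Sum>\<nu>\<in>J' \<inter> {j-8..j+8}. Z \<nu>)"
        using C by (simp add: c_def ennreal_mult sum_distrib_left[symmetric] mult.assoc)
      also have "(\<Sum>\<nu>\<in>J' \<inter> {j-8..j+8}. Z \<nu>) = (\<Sum>\<nu>\<in>{j-8..j+8}. Z \<nu>)"
        by (intro sum.mono_neutral_left) (auto simp: Z_def)
      also have "\<dots> = (\<Sum>d\<in>{-8..8}. Z (j + d))"
        by (rule sum.reindex_bij_witness[of _ "\<lambda>d. j + d" "\<lambda>\<nu>. \<nu> - j"]) auto
      finally show ?thesis .
    qed
    then have "lpnorm q J (\<lambda>j::int. ennreal (2 powr (of_int j * \<alpha>)) * W j) \<le> lpnorm q J (\<lambda>j. ennreal c * (\<Sum>d\<in>{-8..8}. Z (j + d)))"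
      by (intro lpnorm_mono q)
    also have "\<dots> = ennreal c * lpnorm q J (\<lambda>j. \<Sum>d\<in>{-8..8}. Z (j + d))" by (rule lpnorm_cmult[OF q])
    also have "\<dots> \<le> ennreal c * (ennreal A * lpnorm q UNIV Z)"
    proof (intro mult_left_mono sum ballI)
      fix d :: int
      have "lpnorm q J (\<lambda>j. Z (j + d)) \<le> lpnorm q UNIV (\<lambda>j. Z (j + d))"
        unfolding lpnorm_restrict[OF q, of J] by (intro lpnorm_mono q) auto
      also have "\<dots> = lpnorm q UNIV Z"
        by (rule lpnorm_bij_betw) (rule bij_betw_byWitness[where f' = "\<lambda>j. j - d"], auto)
      finally show "lpnorm q J (\<lambda>j. Z (j + d)) \<le> lpnorm q UNIV Z" .
    qed auto
    also have "lpnorm q UNIV Z = lpnorm q J' (\<lambda>\<nu>. ennreal (2 powr (of_int \<nu> * \<alpha>)) * Y \<nu>)"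
      unfolding Z_def lpnorm_restrict[OF q, of J'] ..
    finally show ?thesis using c A by (simp add: ennreal_mult mult.assoc)
  qed
  then show ?thesis using c A by (intro exI[of _ "c * A"]) auto
qed

text \<open>A family \<open>w\<close> that is bounded pointwise by averages of neighbouring members of a family \<open>v\<close> is bounded
  by it in quasi-norm. The index sets are arbitrary, so that the roles can be exchanged.\<close>
lemma besov_compare:
  fixes p q :: ennreal and \<alpha> C r :: real
  assumes pq: "0 < p" "0 < q" and C: "0 \<le> C" and r: "0 < r" "ennreal r \<le> p"
  shows "\<exists>C'\<ge>0. \<forall>J J' w v.
     (\<forall>j\<in>J. \<forall>n. w j n \<le> ennreal C * (\<Sum>\<nu>\<in>J' \<inter> {j-8..j+8}. avg r (nat (- \<nu>)) (v \<nu>) n)) \<longrightarrow>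
     lpnorm q J (\<lambda>j::int. ennreal (2 powr (of_int j * \<alpha>)) * lpnorm p UNIV (w j)) \<le>
     ennreal C' * lpnorm q J' (\<lambda>\<nu>. ennreal (2 powr (of_int \<nu> * \<alpha>)) * lpnorm p UNIV (v \<nu>))"
proof -
  obtain A where A: "A \<ge> 0" and sum: "\<And>(I::int set) f B. (\<forall>d\<in>{-8..8::int}. lpnorm p I (f d) \<le> B) \<Longrightarrow>
     lpnorm p I (\<lambda>i. \<Sum>d\<in>{-8..8}. f d i) \<le> ennreal A * B"
    using lpnorm_sum_le[OF pq(1), of "{-8..8::int}"] by blast
  obtain B where B: "B \<ge> 0" "\<And>k x. lpnorm p UNIV (avg r k x) \<le> ennreal B * lpnorm p UNIV x"
    using lpnorm_avg_le[OF r] by blast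
  define D where "D = C * (A * B)"
  have D: "D \<ge> 0" using A B C by (simp add: D_def)
  have *: "lpnorm p UNIV (w j) \<le> ennreal D * (\<Sum>\<nu>\<in>J' \<inter> {j-8..j+8}. lpnorm p UNIV (v \<nu>))"
    if "\<forall>n. w j n \<le> ennreal C * (\<Sum>\<nu>\<in>J' \<inter> {j-8..j+8}. avg r (nat (- \<nu>)) (v \<nu>) n)" for J' :: "int set" and w v j
  proof -
    define f where "f d n = (if j + d \<in> J' then avg r (nat (- (j+d))) (v (j+d)) n else 0)" for d n
    let ?S = "\<Sum>\<nu>\<in>J' \<inter> {j-8..j+8}. lpnorm p UNIV (v \<nu>)"
    have "(\<Sum>\<nu>\<in>J' \<inter> {j-8..j+8}. avg r (nat (- \<nu>)) (v \<nu>) n) = (\<Sum>d\<in>{-8..8}. f d n)" for n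
    proof -
      have "(\<Sum>\<nu>\<in>J' \<inter> {j-8..j+8}. avg r (nat (- \<nu>)) (v \<nu>) n) = (\<Sum>\<nu>\<in>{j-8..j+8}. if \<nu> \<in> J' then avg r (nat (- \<nu>)) (v \<nu>) n else 0)"
        by (subst Int_commute, rule sum.inter_restrict) simp
      also have "\<dots> = (\<Sum>d\<in>{-8..8}. f d n)" unfolding f_def
        by (rule sum.reindex_bij_witness[of _ "\<lambda>d. j + d" "\<lambda>\<nu>. \<nu> - j"]) auto
      finally show ?thesis .
    qed
    with that have "lpnorm p UNIV (w j) \<le> lpnorm p UNIV (\<lambda>n. ennreal C * (\<Sum>d\<in>{-8..8}. f d n))"
      by (intro lpnorm_mono pq) auto
    also have "\<dots> = ennreal C * lpnorm p UNIV (\<lambda>n. \<Sum>d\<in>{-8..8}. f d n)" by (rule lpnorm_cmult[OF pq(1)])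
    also have "\<dots> \<le> ennreal C * (ennreal A * (ennreal B * ?S))"
    proof (intro mult_left_mono sum ballI)
      fix d :: int assume d: "d \<in> {-8..8}"
      show "lpnorm p UNIV (f d) \<le> ennreal B * ?S"
      proof (cases "j + d \<in> J'")
        case True
        then have "f d = avg r (nat (- (j + d))) (v (j + d))" by (auto simp: f_def)
        then have "lpnorm p UNIV (f d) \<le> ennreal B * lpnorm p UNIV (v (j + d))" by (simp add: B)
        also have "lpnorm p UNIV (v (j + d)) \<le> ?S" using True d by (intro member_le_sum) auto
        finally show ?thesis by (simp add: mult_left_mono)
      next
        case False
        have "lpnorm p UNIV (\<lambda>n::int. 0) = 0"
          using lpnorm_cmult[OF pq(1), of UNIV 0 "\<lambda>_. 0"] by simp
        moreover have "f d = (\<lambda>n. 0)" using False by (auto simp: f_def)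
        ultimately show ?thesis by simp
      qed
    qed auto
    also have "\<dots> = ennreal D * ?S" using A B C by (simp add: D_def ennreal_mult mult.assoc)
    finally show ?thesis .
  qed
  obtain C' where C': "C' \<ge> 0" "\<And>J J' W Y. (\<forall>j\<in>J. W j \<le> ennreal D * (\<Sum>\<nu>\<in>J' \<inter> {j-8..j+8}. Y \<nu>)) \<Longrightarrow>
     lpnorm q J (\<lambda>j::int. ennreal (2 powr (of_int j * \<alpha>)) * W j) \<le>
     ennreal C' * lpnorm q J' (\<lambda>\<nu>. ennreal (2 powr (of_int \<nu> * \<alpha>)) * Y \<nu>)"
    using lpnorm_index_shift[OF pq(2) D, of \<alpha>] by blast
  then show ?thesis using * by (intro exI[of _ C']) (auto intro!: C'(2))
qed

lemma triebel_compare: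
  fixes p q :: ennreal and \<alpha> C r :: real
  assumes pq: "0 < p" "0 < q" "p < \<infinity>" and C: "0 \<le> C" and r: "0 < r" "ennreal r < p" "ennreal r < q"
  shows "\<exists>C'\<ge>0. \<forall>J J' w v. J' \<subseteq> {..0} \<longrightarrow>
     (\<forall>j\<in>J. \<forall>n. w j n \<le> ennreal C * (\<Sum>\<nu>\<in>J' \<inter> {j-8..j+8}. avg r (nat (- \<nu>)) (v \<nu>) n)) \<longrightarrow>
     lpnorm p UNIV (\<lambda>n. lpnorm q J (\<lambda>j::int. ennreal (2 powr (of_int j * \<alpha>)) * w j n)) \<le>
     ennreal C' * lpnorm p UNIV (\<lambda>n. lpnorm q J' (\<lambda>\<nu>. ennreal (2 powr (of_int \<nu> * \<alpha>)) * v \<nu> n))"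
proof -
  obtain A where A: "A \<ge> 0" "\<And>J J' W Y. (\<forall>j\<in>J. W j \<le> ennreal C * (\<Sum>\<nu>\<in>J' \<inter> {j-8..j+8}. Y \<nu>)) \<Longrightarrow>
     lpnorm q J (\<lambda>j::int. ennreal (2 powr (of_int j * \<alpha>)) * W j) \<le>
     ennreal A * lpnorm q J' (\<lambda>\<nu>. ennreal (2 powr (of_int \<nu> * \<alpha>)) * Y \<nu>)"
    using lpnorm_index_shift[OF pq(2) C, of \<alpha>] by blast
  obtain B where B: "B \<ge> 0" "\<And>x. lpnorm p UNIV (\<lambda>n. lpnorm q UNIV (\<lambda>k. avg r k (x k) n)) \<le>
    ennreal B * lpnorm p UNIV (\<lambda>n. lpnorm q UNIV (\<lambda>k. x k n))"
    using triebel_avg_le[OF r pq(3)] by blast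
  have nat_index: "lpnorm q J' f = lpnorm q UNIV (\<lambda>k::nat. if - int k \<in> J' then f (- int k) else 0)"
    if J': "J' \<subseteq> {..0}" for J' f
  proof -
    have "lpnorm q J' f = lpnorm q {k. - int k \<in> J'} (\<lambda>k. f (- int k))"
      by (rule lpnorm_bij_betw[symmetric], rule bij_betw_byWitness[where f' = "\<lambda>j. nat (- j)"]) (use J' in auto)
    then show ?thesis by (subst (asm) (2) lpnorm_restrict[OF pq(2)]) simp
  qed
  have "lpnorm p UNIV (\<lambda>n. lpnorm q J (\<lambda>j::int. ennreal (2 powr (of_int j * \<alpha>)) * w j n)) \<le>
     ennreal (A * B) * lpnorm p UNIV (\<lambda>n. lpnorm q J' (\<lambda>\<nu>. ennreal (2 powr (of_int \<nu> * \<alpha>)) * v \<nu> n))"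
    if J': "J' \<subseteq> {..0}" and H: "\<forall>j\<in>J. \<forall>n. w j n \<le> ennreal C * (\<Sum>\<nu>\<in>J' \<inter> {j-8..j+8}. avg r (nat (- \<nu>)) (v \<nu>) n)"
    for J J' w v
  proof -
    define x where "x k m = (if - int k \<in> J' then ennreal (2 powr (of_int (- int k) * \<alpha>)) * v (- int k) m else 0)" for k m
    have "lpnorm p UNIV (\<lambda>n. lpnorm q J (\<lambda>j::int. ennreal (2 powr (of_int j * \<alpha>)) * w j n)) \<le>
       lpnorm p UNIV (\<lambda>n. ennreal A * lpnorm q J' (\<lambda>\<nu>. ennreal (2 powr (of_int \<nu> * \<alpha>)) * avg r (nat (- \<nu>)) (v \<nu>) n))"
      using H by (intro lpnorm_mono pq A(2)) auto
    also have "\<dots> = ennreal A * lpnorm p UNIV (\<lambda>n. lpnorm q J' (\<lambda>\<nu>. ennreal (2 powr (of_int \<nu> * \<alpha>)) * avg r (nat (- \<nu>)) (v \<nu>) n))"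
      by (rule lpnorm_cmult[OF pq(1)])
    also have "(\<lambda>n. lpnorm q J' (\<lambda>\<nu>. ennreal (2 powr (of_int \<nu> * \<alpha>)) * avg r (nat (- \<nu>)) (v \<nu>) n)) = (\<lambda>n. lpnorm q UNIV (\<lambda>k. avg r k (x k) n))"
    proof
      fix n
      have "avg r k (\<lambda>m. 0) n = 0" for k using r by (simp add: avg_def kconv_def)
      then have "(\<lambda>k. if - int k \<in> J' then ennreal (2 powr (of_int (- int k) * \<alpha>)) * avg r (nat (- (- int k))) (v (- int k)) n else 0) = (\<lambda>k. avg r k (x k) n)"
      proof (intro ext)
        fix k
        have "x k = (if - int k \<in> J' then (\<lambda>m. ennreal (2 powr (of_int (- int k) * \<alpha>)) * v (- int k) m) else (\<lambda>m. 0))"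
          by (auto simp: x_def)
        with \<open>avg r k (\<lambda>m. 0) n = 0\<close> show "(if - int k \<in> J' then ennreal (2 powr (of_int (- int k) * \<alpha>)) * avg r (nat (- (- int k))) (v (- int k)) n else 0) = avg r k (x k) n"
          using avg_cmult[OF r(1)] by simp
      qed
      then show "lpnorm q J' (\<lambda>\<nu>. ennreal (2 powr (of_int \<nu> * \<alpha>)) * avg r (nat (- \<nu>)) (v \<nu>) n) = lpnorm q UNIV (\<lambda>k. avg r k (x k) n)"
        unfolding nat_index[OF J'] by simp
    qed
    also have "ennreal A * lpnorm p UNIV (\<lambda>n. lpnorm q UNIV (\<lambda>k. avg r k (x k) n)) \<le> ennreal A * (ennreal B * lpnorm p UNIV (\<lambda>n. lpnorm q UNIV (\<lambda>k. x k n)))"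
      by (intro mult_left_mono B) auto
    also have "(\<lambda>n. lpnorm q UNIV (\<lambda>k. x k n)) = (\<lambda>n. lpnorm q J' (\<lambda>\<nu>. ennreal (2 powr (of_int \<nu> * \<alpha>)) * v \<nu> n))"
      unfolding nat_index[OF J'] x_def ..
    finally show ?thesis using A B by (simp add: ennreal_mult mult.assoc)
  qed
  then show ?thesis using A B by (intro exI[of _ "A * B"]) auto
qed

section \<open>Sequences of rapid decrease and of polynomial growth\<close>

lemma sum_le_tsum:
  assumes "finite F"
  shows "(\<Sum>x\<in>F. f x) \<le> tsum f"
proof -
  have "(\<Sum>x\<in>F. f x) = (\<integral>\<^sup>+x. f x * indicator F x \<partial>count_space UNIV)"
    using assms by (subst nn_integral_count_space_indicator[symmetric]) (auto simp: nn_integral_count_space_finite)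
  also have "\<dots> \<le> tsum f" by (intro nn_integral_mono) (auto simp: indicator_def)
  finally show ?thesis .
qed

lemma tsum_imp_abs_summable:
  assumes "tsum (\<lambda>x. ennreal (norm (f x))) < top"
  shows "(\<lambda>x. norm (f x)) summable_on UNIV"
proof (rule nonneg_bdd_above_summable_on)
  obtain c where c: "tsum (\<lambda>x. ennreal (norm (f x))) = ennreal c" "0 \<le> c" using assms
    by (cases "tsum (\<lambda>x. ennreal (norm (f x)))") auto
  show "bdd_above (sum (\<lambda>x. norm (f x)) ` {F. F \<subseteq> UNIV \<and> finite F})"
  proof (rule bdd_aboveI2)
    fix F :: "'a set" assume F: "F \<in> {F. F \<subseteq> UNIV \<and> finite F}"
    have "ennreal (\<Sum>x\<in>F. norm (f x)) = (\<Sum>x\<in>F. ennreal (norm (f x)))" by (rule sum_ennreal[symmetric]) auto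
    also have "\<dots> \<le> ennreal c" using sum_le_tsum[of F "\<lambda>x. ennreal (norm (f x))"] F c by simp
    finally show "(\<Sum>x\<in>F. norm (f x)) \<le> c" using c by (simp add: ennreal_le_iff)
  qed
qed auto

lemma norm_infsum_le_tsum:
  fixes f :: "'a \<Rightarrow> complex"
  shows "ennreal (norm (infsum f UNIV)) \<le> tsum (\<lambda>x. ennreal (norm (f x)))"
proof (cases "tsum (\<lambda>x. ennreal (norm (f x))) = top")
  case False
  then have abs: "(\<lambda>x. norm (f x)) summable_on UNIV" by (intro tsum_imp_abs_summable) (simp add: less_top)
  obtain c where c: "tsum (\<lambda>x. ennreal (norm (f x))) = ennreal c" "0 \<le> c" using False
    by (cases "tsum (\<lambda>x. ennreal (norm (f x)))") auto
  have "norm (infsum f UNIV) \<le> infsum (\<lambda>x. norm (f x)) UNIV" by (rule norm_infsum_bound[OF abs])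
  also have "\<dots> \<le> c"
  proof (rule infsum_le_finite_sums[OF abs])
    fix F :: "'a set" assume F: "finite F"
    have "ennreal (\<Sum>x\<in>F. norm (f x)) = (\<Sum>x\<in>F. ennreal (norm (f x)))" by (rule sum_ennreal[symmetric]) auto
    also have "\<dots> \<le> ennreal c" using sum_le_tsum[of F "\<lambda>x. ennreal (norm (f x))"] F c by simp
    finally show "(\<Sum>x\<in>F. norm (f x)) \<le> c" using c by (simp add: ennreal_le_iff)
  qed
  finally show ?thesis using c by (simp add: ennreal_leI)
qed simp

text \<open>Distance from the origin in units of \<open>2 ^ k\<close>, increased by 1.\<close>
definition wt :: "nat \<Rightarrow> int \<Rightarrow> real" where
  "wt k n = 1 + \<bar>real_of_int n\<bar> / 2 ^ k"

lemma wt_ge_1: "1 \<le> wt k n" and wt_pos [simp]: "0 < wt k n" "0 \<le> wt k n" "wt k n \<noteq> 0"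
proof -
  show *: "1 \<le> wt k n" by (simp add: wt_def)
  show "0 < wt k n" "0 \<le> wt k n" "wt k n \<noteq> 0" using * by auto
qed

lemma wt_minus [simp]: "wt k (- n) = wt k n"
  by (simp add: wt_def)

lemma wt_commute: "wt k (m - n) = wt k (n - m)"
  by (simp add: wt_def abs_minus_commute)

lemma wt_mult: "wt k (m + n) \<le> wt k m * wt k n"
proof -
  have "\<bar>real_of_int (m + n)\<bar> / 2 ^ k \<le> \<bar>real_of_int m\<bar> / 2 ^ k + \<bar>real_of_int n\<bar> / 2 ^ k"
    by (simp add: add_divide_distrib[symmetric] divide_right_mono)
  moreover have "wt k m * wt k n = 1 + \<bar>real_of_int m\<bar> / 2 ^ k + \<bar>real_of_int n\<bar> / 2 ^ k + (\<bar>real_of_int m\<bar> / 2 ^ k) * (\<bar>real_of_int n\<bar> / 2 ^ k)"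
    by (simp add: wt_def algebra_simps)
  moreover have "0 \<le> (\<bar>real_of_int m\<bar> / 2 ^ k) * (\<bar>real_of_int n\<bar> / 2 ^ k)" by simp
  ultimately show ?thesis unfolding wt_def by linarith
qed

lemma wt_triangle: "wt k (m - n) \<le> wt k (m - l) * wt k (l - n)"
  using wt_mult[of k "m - l" "l - n"] by simp

lemma decay_kernel_wt: "decay_kernel k n = ennreal (1 / 2 ^ k / wt k n ^ 2)"
  by (simp add: decay_kernel_def wt_def)

text \<open>Decay of order \<open>M\<close> at scale \<open>2 ^ k\<close>, normalised so that the \<open>\<ell>\<^sup>1\<close> norm is bounded independently of \<open>k\<close>
  when \<open>M \<ge> 2\<close>.\<close>
definition scaled :: "nat \<Rightarrow> nat \<Rightarrow> real \<Rightarrow> (int \<Rightarrow> complex) \<Rightarrow> bool" where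
  "scaled k M C f \<longleftrightarrow> (\<forall>n. cmod (f n) \<le> C / 2 ^ k / wt k n ^ M)"

text \<open>Decay of every polynomial order; these sequences are the elements of \<open>schwartz\<close>.\<close>
definition rapid :: "(int \<Rightarrow> complex) \<Rightarrow> bool" where
  "rapid f \<longleftrightarrow> (\<forall>M. \<exists>C. scaled 0 M C f)"

text \<open>At most polynomial growth.\<close>
definition tempered :: "(int \<Rightarrow> complex) \<Rightarrow> bool" where
  "tempered u \<longleftrightarrow> (\<exists>K C. \<forall>n. cmod (u n) \<le> C * wt 0 n ^ K)"

lemma scaled_nonneg: "scaled k M C f \<Longrightarrow> 0 \<le> C"
proof -
  assume "scaled k M C f"
  then have "0 \<le> C / 2 ^ k / wt k 0 ^ M" unfolding scaled_def by (metis norm_ge_zero order_trans)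
  moreover have "0 < (2::real) ^ k" by simp
  ultimately show ?thesis by (simp add: wt_def zero_le_divide_iff del: zero_less_power)
qed

lemma scaled_mono:
  assumes "scaled k M C f" "N \<le> M" "C \<le> D"
  shows "scaled k N D f"
  unfolding scaled_def
proof
  fix n
  have "cmod (f n) \<le> C / 2 ^ k / wt k n ^ M" using assms by (simp add: scaled_def)
  also have "\<dots> \<le> D / 2 ^ k / wt k n ^ N"
    using assms scaled_nonneg[OF assms(1)]
    by (intro frac_le divide_right_mono power_increasing wt_ge_1) auto
  finally show "cmod (f n) \<le> D / 2 ^ k / wt k n ^ N" .
qed

lemma scaled_change:
  assumes f: "scaled k M C f" and kl: "k \<le> l + d" "l \<le> k + d"
  shows "scaled l M (2 ^ d * (2 ^ d) ^ M * C) f"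
  unfolding scaled_def
proof
  fix n
  have p: "(2::real) ^ k \<le> 2 ^ l * 2 ^ d" "(2::real) ^ l \<le> 2 ^ k * 2 ^ d"
    using kl power_increasing[of k "l + d" "2::real"] power_increasing[of l "k + d" "2::real"] by (auto simp: power_add)
  have "\<bar>real_of_int n\<bar> * 2 ^ k \<le> \<bar>real_of_int n\<bar> * (2 ^ l * 2 ^ d)" by (intro mult_left_mono p) auto
  then have "\<bar>real_of_int n\<bar> / 2 ^ l \<le> 2 ^ d * (\<bar>real_of_int n\<bar> / 2 ^ k)"
    by (simp add: field_simps)
  then have "wt l n \<le> 2 ^ d * wt k n"
    using one_le_power[of "2::real" d] unfolding wt_def distrib_left by linarith
  then have "wt l n ^ M \<le> (2 ^ d * wt k n) ^ M" by (intro power_mono) auto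
  then have w: "1 / wt k n ^ M \<le> (2 ^ d) ^ M / wt l n ^ M" by (simp add: field_simps power_mult_distrib)
  have q: "1 / 2 ^ k \<le> (2::real) ^ d / 2 ^ l" using p by (simp add: field_simps)
  have "cmod (f n) \<le> C * ((1 / 2 ^ k) * (1 / wt k n ^ M))" using f by (simp add: scaled_def)
  also have "\<dots> \<le> C * ((2 ^ d / 2 ^ l) * ((2 ^ d) ^ M / wt l n ^ M))"
    using scaled_nonneg[OF f] by (intro mult_left_mono mult_mono w q) auto
  finally show "cmod (f n) \<le> 2 ^ d * (2 ^ d) ^ M * C / 2 ^ l / wt l n ^ M" by (simp add: mult_ac)
qed

lemma rapidI_scaled:
  assumes "\<And>M. \<exists>C. scaled k M C f"
  shows "rapid f"
  unfolding rapid_def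
proof
  fix M
  obtain C where "scaled k M C f" using assms by blast
  from scaled_change[OF this, of 0 k] show "\<exists>C. scaled 0 M C f" by auto
qed

lemma rapid_bound: "rapid f \<Longrightarrow> \<exists>C\<ge>0. \<forall>n. cmod (f n) \<le> C / wt 0 n ^ M"
  unfolding rapid_def by (metis scaled_def scaled_nonneg div_by_1 power_0)

text \<open>Convolution of sequences. The infinite sum is 0 when it does not converge.\<close>
definition conv :: "(int \<Rightarrow> complex) \<Rightarrow> (int \<Rightarrow> complex) \<Rightarrow> int \<Rightarrow> complex" where
  "conv f u n = (\<Sum>\<^sub>\<infinity>m. f (n - m) * u m)"

lemma tsum_decay_kernel_shift: "tsum (\<lambda>m. decay_kernel k (n - m)) \<le> ennreal 24"
  unfolding tsum_shift by (rule tsum_decay_kernel)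

lemma scaled_conv:
  assumes f: "scaled k (M + 2) C f" and g: "scaled k (M + 2) D g"
  shows "scaled k M (24 * C * D) (conv f g)"
  unfolding scaled_def
proof
  fix n
  have CD: "C \<ge> 0" "D \<ge> 0" using scaled_nonneg f g by blast+
  define E where "E = C * D / 2 ^ k / wt k n ^ M"
  have E: "E \<ge> 0" using CD by (simp add: E_def)
  have "ennreal (cmod (conv f g n)) \<le> tsum (\<lambda>m. ennreal (cmod (f (n - m) * g m)))"
    unfolding conv_def by (rule norm_infsum_le_tsum)
  also have "\<dots> \<le> tsum (\<lambda>m. ennreal E * decay_kernel k m)"
  proof (rule tsum_mono)
    fix m
    have "cmod (f (n - m) * g m) \<le> (C / 2 ^ k / wt k (n - m) ^ (M + 2)) * (D / 2 ^ k / wt k m ^ (M + 2))"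
      unfolding norm_mult using f g CD by (intro mult_mono) (auto simp: scaled_def)
    also have "\<dots> \<le> (C / 2 ^ k / wt k (n - m) ^ M) * (D / 2 ^ k / wt k m ^ (M + 2))"
      using CD by (intro mult_right_mono divide_left_mono power_increasing wt_ge_1) auto
    also have "\<dots> = C * D / 2 ^ k * (1 / (wt k (n - m) * wt k m) ^ M) * (1 / 2 ^ k / wt k m ^ 2)"
      by (simp add: power_add power_mult_distrib power2_eq_square)
    also have "\<dots> \<le> C * D / 2 ^ k * (1 / wt k n ^ M) * (1 / 2 ^ k / wt k m ^ 2)"
      using CD wt_mult[of k "n - m" m]
      by (intro mult_right_mono mult_left_mono divide_left_mono power_mono) auto
    also have "\<dots> = E * (1 / 2 ^ k / wt k m ^ 2)" by (simp add: E_def)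
    finally show "ennreal (cmod (f (n - m) * g m)) \<le> ennreal E * decay_kernel k m"
      using E by (simp add: decay_kernel_wt ennreal_leI flip: ennreal_mult)
  qed
  also have "\<dots> \<le> ennreal E * ennreal 24" unfolding tsum_cmult by (intro mult_left_mono tsum_decay_kernel) auto
  also have "\<dots> = ennreal (E * 24)" using E by (simp add: ennreal_mult)
  finally have "cmod (conv f g n) \<le> E * 24" using E by (simp add: ennreal_le_iff)
  then show "cmod (conv f g n) \<le> 24 * C * D / 2 ^ k / wt k n ^ M" by (simp add: E_def mult_ac)
qed

lemma rapid_conv:
  assumes "rapid f" "rapid g"
  shows "rapid (conv f g)"
  unfolding rapid_def
proof
  fix M
  obtain C D where "scaled 0 (M + 2) C f" "scaled 0 (M + 2) D g" using assms unfolding rapid_def by meson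
  from scaled_conv[OF this] show "\<exists>C. scaled 0 M C (conv f g)" by blast
qed

lemma rapid_tempered: "rapid f \<Longrightarrow> tempered f"
proof -
  assume "rapid f"
  then obtain C where "\<forall>n. cmod (f n) \<le> C / wt 0 n ^ 0" using rapid_bound by blast
  then have "\<forall>n. cmod (f n) \<le> C * wt 0 n ^ 0" by simp
  then show ?thesis unfolding tempered_def by blast
qed

lemma conv_terms_bound:
  assumes f: "rapid f" and u: "tempered u"
  shows "\<exists>B K. B \<ge> 0 \<and> (\<forall>n. tsum (\<lambda>m. ennreal (norm (f (n - m) * u m))) \<le> ennreal (B * wt 0 n ^ K))"
proof -
  obtain K D where D: "\<And>n. cmod (u n) \<le> D * wt 0 n ^ K" using u unfolding tempered_def by blast
  have D0: "D \<ge> 0" using D[of 0] by (simp add: wt_def) (meson norm_ge_zero order_trans)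
  obtain C where C: "C \<ge> 0" "\<And>n. cmod (f n) \<le> C / wt 0 n ^ (K + 2)" using rapid_bound[OF f] by meson
  have "tsum (\<lambda>m. ennreal (norm (f (n - m) * u m))) \<le> ennreal ((24 * C * D) * wt 0 n ^ K)" for n
  proof -
    have "tsum (\<lambda>m. ennreal (norm (f (n - m) * u m))) \<le> tsum (\<lambda>m. ennreal (C * D * wt 0 n ^ K) * decay_kernel 0 (n - m))"
    proof (rule tsum_mono)
      fix m
      have "norm (f (n - m) * u m) \<le> (C / wt 0 (n - m) ^ (K + 2)) * (D * wt 0 m ^ K)"
        unfolding norm_mult using C D D0 by (intro mult_mono) auto
      also have "\<dots> \<le> (C / wt 0 (n - m) ^ (K + 2)) * (D * (wt 0 n * wt 0 (n - m)) ^ K)"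
      proof -
        have "wt 0 m \<le> wt 0 n * wt 0 (n - m)" using wt_mult[of 0 n "m - n"] by (simp add: wt_commute)
        then show ?thesis using C D0 by (intro mult_left_mono power_mono) auto
      qed
      also have "\<dots> = C * D * wt 0 n ^ K * (1 / 2 ^ 0 / wt 0 (n - m) ^ 2)"
        by (simp add: power_add power_mult_distrib power2_eq_square)
      finally show "ennreal (norm (f (n - m) * u m)) \<le> ennreal (C * D * wt 0 n ^ K) * decay_kernel 0 (n - m)"
        using C D0 by (simp add: decay_kernel_wt ennreal_leI flip: ennreal_mult)
    qed
    also have "\<dots> \<le> ennreal (C * D * wt 0 n ^ K) * ennreal 24"
      unfolding tsum_cmult by (intro mult_left_mono tsum_decay_kernel_shift) auto
    also have "\<dots> = ennreal ((24 * C * D) * wt 0 n ^ K)" using C D0 by (simp add: ennreal_mult mult_ac)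
    finally show ?thesis .
  qed
  then show ?thesis using C(1) D0 by (intro exI[of _ "24 * C * D"] exI[of _ K]) auto
qed

lemma conv_abs_summable:
  assumes "rapid f" "tempered u"
  shows "(\<lambda>m. norm (f (n - m) * u m)) summable_on UNIV"
proof (rule tsum_imp_abs_summable)
  obtain B K where "tsum (\<lambda>m. ennreal (norm (f (n - m) * u m))) \<le> ennreal (B * wt 0 n ^ K)"
    using conv_terms_bound[OF assms] by blast
  then show "tsum (\<lambda>m. ennreal (norm (f (n - m) * u m))) < top" by (rule le_less_trans) simp
qed

lemma conv_summable: "rapid f \<Longrightarrow> tempered u \<Longrightarrow> (\<lambda>m. f (n - m) * u m) summable_on UNIV"
  using conv_abs_summable by (rule Infinite_Sum.abs_summable_summable)

lemma tempered_conv: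
  assumes "rapid f" "tempered u"
  shows "tempered (conv f u)"
proof -
  obtain B K where B: "B \<ge> 0" "\<And>n. tsum (\<lambda>m. ennreal (norm (f (n - m) * u m))) \<le> ennreal (B * wt 0 n ^ K)"
    using conv_terms_bound[OF assms] by blast
  have "cmod (conv f u n) \<le> B * wt 0 n ^ K" for n
  proof -
    have "ennreal (cmod (conv f u n)) \<le> ennreal (B * wt 0 n ^ K)"
      unfolding conv_def by (rule order_trans[OF norm_infsum_le_tsum B(2)])
    then show ?thesis using B(1) by (simp add: ennreal_le_iff)
  qed
  then show ?thesis unfolding tempered_def by blast
qed

lemma conv_assoc:
  assumes f: "rapid f" and g: "rapid g" and u: "tempered u"
  shows "conv (conv f g) u n = conv f (conv g u) n"
proof -
  have summ: "(\<lambda>(l, m). f (n - l) * (g (l - m) * u m)) summable_on UNIV \<times> UNIV"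
  proof -
    obtain K D where D: "\<And>n. cmod (u n) \<le> D * wt 0 n ^ K" using u unfolding tempered_def by blast
    have D0: "D \<ge> 0" using D[of 0] by (simp add: wt_def) (meson norm_ge_zero order_trans)
    obtain C where C: "C \<ge> 0" "\<And>n. cmod (f n) \<le> C / wt 0 n ^ (K + 2)" using rapid_bound[OF f] by meson
    obtain E where E: "E \<ge> 0" "\<And>n. cmod (g n) \<le> E / wt 0 n ^ (K + 2)" using rapid_bound[OF g] by meson
    define B where "B = C * (E * D) * wt 0 n ^ K"
    have B: "B \<ge> 0" using C E D0 by (simp add: B_def)
    have bound: "ennreal (norm (f (n - l) * (g (l - m) * u m))) \<le> ennreal B * (decay_kernel 0 (n - l) * decay_kernel 0 (l - m))" for l m
    proof -
      have "norm (f (n - l) * (g (l - m) * u m)) \<le> (C / wt 0 (n - l) ^ (K + 2)) * ((E / wt 0 (l - m) ^ (K + 2)) * (D * wt 0 m ^ K))"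
        unfolding norm_mult using C D D0 E by (intro mult_mono) auto
      also have "\<dots> \<le> (C / wt 0 (n - l) ^ (K + 2)) * ((E / wt 0 (l - m) ^ (K + 2)) * (D * (wt 0 n * wt 0 (n - l) * wt 0 (l - m)) ^ K))"
      proof -
        have "wt 0 m \<le> wt 0 l * wt 0 (l - m)" using wt_mult[of 0 l "m - l"] by (simp add: wt_commute)
        also have "wt 0 l \<le> wt 0 n * wt 0 (n - l)" using wt_mult[of 0 n "l - n"] by (simp add: wt_commute)
        finally have "wt 0 m \<le> wt 0 n * wt 0 (n - l) * wt 0 (l - m)" by (simp add: mult_right_mono)
        then show ?thesis using C D0 E by (intro mult_left_mono power_mono) auto
      qed
      also have "\<dots> = B * ((1 / 2 ^ 0 / wt 0 (n - l) ^ 2) * (1 / 2 ^ 0 / wt 0 (l - m) ^ 2))"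
        by (simp add: power_add power_mult_distrib power2_eq_square B_def)
      finally show ?thesis using B
        by (simp add: decay_kernel_wt ennreal_leI flip: ennreal_mult)
    qed
    have "tsum (\<lambda>(l, m). ennreal (norm (f (n - l) * (g (l - m) * u m)))) = tsum (\<lambda>l. tsum (\<lambda>m. ennreal (norm (f (n - l) * (g (l - m) * u m)))))"
      by (subst nn_integral_fst_count_space[symmetric]) simp
    also have "\<dots> \<le> tsum (\<lambda>l. tsum (\<lambda>m. ennreal B * (decay_kernel 0 (n - l) * decay_kernel 0 (l - m))))"
      by (intro tsum_mono bound)
    also have "\<dots> \<le> tsum (\<lambda>l. ennreal B * (decay_kernel 0 (n - l) * ennreal 24))"
      unfolding tsum_cmult by (intro mult_left_mono tsum_mono tsum_decay_kernel_shift) auto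
    also have "\<dots> \<le> ennreal B * (ennreal 24 * ennreal 24)"
      unfolding tsum_cmult tsum_multc by (intro mult_left_mono mult_right_mono tsum_decay_kernel_shift) auto
    also have "\<dots> < top" by (simp add: ennreal_mult_less_top)
    finally have "(\<lambda>x. norm ((\<lambda>(l, m). f (n - l) * (g (l - m) * u m)) x)) summable_on UNIV"
      by (intro tsum_imp_abs_summable) (simp add: case_prod_unfold)
    then have "(\<lambda>(l, m). f (n - l) * (g (l - m) * u m)) summable_on UNIV" by (rule Infinite_Sum.abs_summable_summable)
    then show ?thesis by simp
  qed
  have "conv f (conv g u) n = (\<Sum>\<^sub>\<infinity>l. \<Sum>\<^sub>\<infinity>m. f (n - l) * (g (l - m) * u m))"
    unfolding conv_def by (intro infsum_cong infsum_cmult_right[symmetric] conv_summable g u)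
  also have "\<dots> = (\<Sum>\<^sub>\<infinity>m. \<Sum>\<^sub>\<infinity>l. f (n - l) * (g (l - m) * u m))"
    by (rule infsum_swap_banach[OF summ])
  also have "\<dots> = conv (conv f g) u n"
    unfolding conv_def
  proof (rule infsum_cong)
    fix m
    have "(\<Sum>\<^sub>\<infinity>l. f (n - l) * (g (l - m) * u m)) = (\<Sum>\<^sub>\<infinity>l. f (n - l) * g (l - m) * u m)"
      by (simp add: mult.assoc)
    also have "\<dots> = (\<Sum>\<^sub>\<infinity>l. f (n - m - l) * g l * u m)"
      by (rule infsum_reindex_bij_witness[of _ "\<lambda>l. l + m" "\<lambda>l. l - m"]) auto
    also have "\<dots> = (\<Sum>\<^sub>\<infinity>l. f (n - m - l) * g l) * u m"
      by (intro infsum_cmult_left conv_summable g f rapid_tempered)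
    finally show "(\<Sum>\<^sub>\<infinity>l. f (n - l) * (g (l - m) * u m)) = (\<Sum>\<^sub>\<infinity>l. f (n - m - l) * g l) * u m" .
  qed
  finally show ?thesis ..
qed

lemma conv_sum_left:
  assumes "finite D" "\<And>d. d \<in> D \<Longrightarrow> rapid (f d)" "tempered u"
  shows "conv (\<lambda>m. \<Sum>d\<in>D. f d m) u n = (\<Sum>d\<in>D. conv (f d) u n)"
proof -
  have "((\<lambda>m. \<Sum>d\<in>D. f d (n - m) * u m) has_sum (\<Sum>d\<in>D. conv (f d) u n)) UNIV"
    using assms(1,2)
  proof (induction D)
    case (insert d D)
    have "((\<lambda>m. f d (n - m) * u m) has_sum conv (f d) u n) UNIV"
      unfolding conv_def using insert assms(3) by (intro has_sum_infsum conv_summable) auto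
    from has_sum_add[OF this insert.IH] show ?case using insert by simp
  qed simp
  then show ?thesis by (simp add: conv_def sum_distrib_right infsumI)
qed

section \<open>The Peetre inequality\<close>

text \<open>If \<open>v\<close> is reproduced by a kernel of scale \<open>2 ^ k\<close>, then its values are controlled by averages of order
  \<open>r \<le> 1\<close>. Nothing has to be assumed about the growth of \<open>v\<close>: a single term of the average on the right
  bounds the corresponding value of \<open>v\<close>, so the Peetre maximal function is finite whenever the average is.\<close>
lemma peetre:
  fixes v \<Phi> :: "int \<Rightarrow> complex" and r C :: real
  assumes r: "0 < r" "r \<le> 1" and a: "2 \<le> a * r" and \<Phi>: "scaled k a C \<Phi>" and C: "0 < C"
    and v: "\<And>n. v n = conv \<Phi> v n"
  shows "ennreal (cmod (v m)) \<le> ennreal (C powr (1/r) * wt k (n - m) ^ a) * avg r k (\<lambda>l. ennreal (cmod (v l))) n"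
proof -
  define A where "A = kconv (decay_kernel k) (\<lambda>l. ennpow (ennreal (cmod (v l))) r) n"
  show ?thesis
  proof (cases "A = top")
    case True
    then have "avg r k (\<lambda>l. ennreal (cmod (v l))) n = top" by (simp add: avg_def A_def)
    moreover have "C powr (1/r) * wt k (n - m) ^ a > 0" using C by (intro mult_pos_pos zero_less_power) auto
    ultimately show ?thesis using C by (simp add: ennreal_mult_top)
  next
    case False
    then obtain b where b: "A = ennreal b" "0 \<le> b" by (cases A) auto
    have kernel_term: "decay_kernel k (n - l) * ennpow (ennreal (cmod (v l))) r = ennreal (cmod (v l) powr r / (2 ^ k * wt k (n - l) ^ 2))" for l
      by (simp add: decay_kernel_wt ennpow_ennreal flip: ennreal_mult)
    have wr: "wt k l ^ 2 \<le> (wt k l ^ a) powr r" for l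
    proof -
      have "wt k l ^ 2 = wt k l powr 2" by (simp add: powr_numeral)
      also have "\<dots> \<le> wt k l powr (a * r)" using a by (intro powr_mono wt_ge_1) auto
      also have "\<dots> = (wt k l ^ a) powr r" by (simp add: powr_powr flip: powr_realpow)
      finally show ?thesis .
    qed
    \<comment> \<open>Finiteness of the Peetre maximal function N, from a single term of the sum b.\<close>
    have bd: "cmod (v l) / wt k (n - l) ^ a \<le> (b * 2 ^ k) powr (1/r)" for l
    proof -
      have "decay_kernel k (n - l) * ennpow (ennreal (cmod (v l))) r \<le> A" unfolding A_def kconv_def by (rule tsum_ge)
      then have "cmod (v l) powr r / (2 ^ k * wt k (n - l) ^ 2) \<le> b"
        unfolding kernel_term b(1) using b by (subst (asm) ennreal_le_iff) auto
      then have "cmod (v l) powr r \<le> (b * 2 ^ k) * wt k (n - l) ^ 2" by (simp add: field_simps)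
      also have "\<dots> \<le> (b * 2 ^ k) * (wt k (n - l) ^ a) powr r" using b by (intro mult_left_mono wr) auto
      finally have "(cmod (v l) / wt k (n - l) ^ a) powr r \<le> b * 2 ^ k" by (simp add: powr_divide field_simps)
      then have "((cmod (v l) / wt k (n - l) ^ a) powr r) powr (1/r) \<le> (b * 2 ^ k) powr (1/r)"
        using r by (intro powr_mono2) auto
      then show ?thesis using r by (simp add: powr_powr)
    qed
    define N where "N = (SUP l. cmod (v l) / wt k (n - l) ^ a)"
    have bdd: "bdd_above (range (\<lambda>l. cmod (v l) / wt k (n - l) ^ a))" using bd by (intro bdd_aboveI2) auto
    have vN: "cmod (v l) \<le> N * wt k (n - l) ^ a" for l
    proof -
      have "cmod (v l) / wt k (n - l) ^ a \<le> N" unfolding N_def by (rule cSUP_upper[OF _ bdd]) simp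
      then show ?thesis by (simp add: field_simps)
    qed
    have N0: "0 \<le> N" using vN[of n] by (simp add: wt_def) (meson norm_ge_zero order_trans)
    have est: "cmod (v m) \<le> C * wt k (n - m) ^ a * N powr (1 - r) * b" for m
    proof -
      define B where "B = C * wt k (n - m) ^ a * N powr (1 - r)"
      have B: "B \<ge> 0" using C by (simp add: B_def)
      have "ennreal (cmod (v m)) = ennreal (cmod (conv \<Phi> v m))" using v[of m] by simp
      also have "\<dots> \<le> tsum (\<lambda>l. ennreal (cmod (\<Phi> (m - l) * v l)))"
        unfolding conv_def by (rule norm_infsum_le_tsum)
      also have "\<dots> \<le> tsum (\<lambda>l. ennreal B * (decay_kernel k (n - l) * ennpow (ennreal (cmod (v l))) r))"
      proof (rule tsum_mono)
        fix l
        \<comment> \<open>The power 1 - r of the value is estimated by the maximal function.\<close>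
        have vl: "cmod (v l) \<le> cmod (v l) powr r * (N powr (1 - r) * (wt k (n - l) ^ a / wt k (n - l) ^ 2))"
        proof (cases "v l = 0")
          case False
          have "cmod (v l) = cmod (v l) powr r * cmod (v l) powr (1 - r)"
            using False by (simp flip: powr_add)
          also have "cmod (v l) powr (1 - r) \<le> (N * wt k (n - l) ^ a) powr (1 - r)"
            using r by (intro powr_mono2 vN) auto
          also have "\<dots> = N powr (1 - r) * (wt k (n - l) ^ a / (wt k (n - l) ^ a) powr r)"
            using N0 by (simp add: powr_mult powr_diff)
          also have "\<dots> \<le> N powr (1 - r) * (wt k (n - l) ^ a / wt k (n - l) ^ 2)"
            using wr[of "n - l"] by (intro mult_left_mono divide_left_mono) auto
          finally show ?thesis by (simp add: mult_left_mono)
        qed simp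
        have "cmod (\<Phi> (m - l) * v l) \<le> (C / 2 ^ k / wt k (m - l) ^ a) * (cmod (v l) powr r * (N powr (1 - r) * (wt k (n - l) ^ a / wt k (n - l) ^ 2)))"
          unfolding norm_mult using \<Phi> C vl by (intro mult_mono) (auto simp: scaled_def)
        also have "\<dots> \<le> (C / 2 ^ k / wt k (m - l) ^ a) * (cmod (v l) powr r * (N powr (1 - r) * ((wt k (n - m) * wt k (m - l)) ^ a / wt k (n - l) ^ 2)))"
          using C by (intro mult_left_mono divide_right_mono power_mono wt_triangle) auto
        also have "\<dots> = B * (cmod (v l) powr r / (2 ^ k * wt k (n - l) ^ 2))"
          by (simp add: B_def power_mult_distrib)
        finally show "ennreal (cmod (\<Phi> (m - l) * v l)) \<le> ennreal B * (decay_kernel k (n - l) * ennpow (ennreal (cmod (v l))) r)"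
          unfolding kernel_term using B by (simp add: ennreal_leI flip: ennreal_mult)
      qed
      also have "\<dots> = ennreal B * ennreal b" unfolding tsum_cmult b(1)[symmetric] A_def kconv_def ..
      finally show ?thesis using B b by (simp add: B_def ennreal_le_iff flip: ennreal_mult)
    qed
    have "N \<le> (C * b) powr (1/r)"
    proof (cases "N = 0")
      case False
      have "N \<le> C * N powr (1 - r) * b"
        unfolding N_def[symmetric]
      proof (subst N_def, rule cSUP_least)
        fix l
        show "cmod (v l) / wt k (n - l) ^ a \<le> C * N powr (1 - r) * b" using est[of l] by (simp add: field_simps)
      qed simp
      then have "N powr r * N powr (1 - r) \<le> (C * b) * N powr (1 - r)"
        using False N0 by (simp add: mult_ac flip: powr_add)
      then have "N powr r \<le> C * b" using False N0 by simp
      then have "(N powr r) powr (1/r) \<le> (C * b) powr (1/r)" using r by (intro powr_mono2) auto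
      then show ?thesis using r N0 by (simp add: powr_powr)
    qed simp
    then have "cmod (v m) \<le> (C * b) powr (1/r) * wt k (n - m) ^ a"
      using vN[of m] by (meson mult_right_mono order_trans wt_pos(2) zero_le_power)
    also have "\<dots> = (C powr (1/r) * wt k (n - m) ^ a) * b powr (1/r)" using C b by (simp add: powr_mult)
    finally have "ennreal (cmod (v m)) \<le> ennreal (C powr (1/r) * wt k (n - m) ^ a) * ennreal (b powr (1/r))"
      using C by (simp add: ennreal_leI flip: ennreal_mult)
    also have "ennreal (b powr (1/r)) = avg r k (\<lambda>l. ennreal (cmod (v l))) n"
      using b(2) by (simp only: avg_def A_def[symmetric] b(1) ennpow_ennreal)
    finally show ?thesis .
  qed
qed

lemma conv_le_avg:
  fixes v \<Phi> H :: "int \<Rightarrow> complex" and r C D :: real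
  assumes r: "0 < r" "r \<le> 1" and a: "2 \<le> a * r" and \<Phi>: "scaled k a C \<Phi>" and C: "0 < C"
    and v: "\<And>n. v n = conv \<Phi> v n" and H: "scaled k (a + 2) D H"
  shows "ennreal (cmod (conv H v n)) \<le> ennreal (24 * D * C powr (1/r)) * avg r k (\<lambda>l. ennreal (cmod (v l))) n"
proof -
  let ?Q = "avg r k (\<lambda>l. ennreal (cmod (v l))) n"
  have D: "D \<ge> 0" using scaled_nonneg[OF H] .
  have "ennreal (cmod (conv H v n)) \<le> tsum (\<lambda>m. ennreal (cmod (H (n - m) * v m)))"
    unfolding conv_def by (rule norm_infsum_le_tsum)
  also have "\<dots> \<le> tsum (\<lambda>m. decay_kernel k (n - m) * (ennreal (D * C powr (1/r)) * ?Q))"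
  proof (rule tsum_mono)
    fix m
    have "ennreal (cmod (H (n - m) * v m)) = ennreal (cmod (H (n - m))) * ennreal (cmod (v m))"
      by (simp add: norm_mult ennreal_mult)
    also have "\<dots> \<le> ennreal (D / 2 ^ k / wt k (n - m) ^ (a + 2)) * (ennreal (C powr (1/r) * wt k (n - m) ^ a) * ?Q)"
      using H by (intro mult_mono ennreal_leI peetre[OF r a \<Phi> C v]) (auto simp: scaled_def)
    also have "\<dots> = ennreal ((D / 2 ^ k / wt k (n - m) ^ (a + 2)) * (C powr (1/r) * wt k (n - m) ^ a)) * ?Q"
      using D C by (subst ennreal_mult) (auto simp: mult.assoc)
    also have "(D / 2 ^ k / wt k (n - m) ^ (a + 2)) * (C powr (1/r) * wt k (n - m) ^ a) = (1 / 2 ^ k / wt k (n - m) ^ 2) * (D * C powr (1/r))"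
      by (simp add: power_add power2_eq_square)
    finally show "ennreal (cmod (H (n - m) * v m)) \<le> decay_kernel k (n - m) * (ennreal (D * C powr (1/r)) * ?Q)"
      using D by (subst (asm) ennreal_mult) (auto simp: decay_kernel_wt mult.assoc)
  qed
  also have "\<dots> \<le> ennreal 24 * (ennreal (D * C powr (1/r)) * ?Q)"
    unfolding tsum_multc by (intro mult_right_mono tsum_decay_kernel_shift) auto
  also have "\<dots> = ennreal (24 * D * C powr (1/r)) * ?Q" using D by (simp add: ennreal_mult mult.assoc)
  finally show ?thesis .
qed

section \<open>Tempered distributions on the integers\<close>

lemma lap_pow_add: "(lap ^^ l) (\<lambda>n. f n + g n) = (\<lambda>n. (lap ^^ l) f n + (lap ^^ l) g n)"
proof (induction l)
  case (Suc l)
  then show ?case by (auto simp: lap_def)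
qed simp

text \<open>The Laplacian preserves polynomial decay, so that the seminorms of \<open>schwartz\<close> only measure decay.\<close>
lemma lap_pow_bound:
  assumes "\<And>n. cmod (f n) \<le> c / wt 0 n ^ m" "0 \<le> c"
  shows "cmod ((lap ^^ l) f n) \<le> (4 * 2 ^ m) ^ l * c / wt 0 n ^ m"
proof (induction l arbitrary: n)
  case (Suc l)
  define C where "C = (4 * 2 ^ m) ^ l * c"
  have C: "C \<ge> 0" using assms by (simp add: C_def)
  let ?g = "(lap ^^ l) f"
  have near: "cmod (?g n') \<le> 2 ^ m * C / wt 0 n ^ m" if "n' \<in> {n - 1, n, n + 1}" for n'
  proof -
    have "wt 0 n \<le> 2 * wt 0 n'" using that unfolding wt_def by (auto simp: abs_if)
    then have "wt 0 n ^ m \<le> (2 * wt 0 n') ^ m" by (intro power_mono) auto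
    then have "1 / wt 0 n' ^ m \<le> 2 ^ m / wt 0 n ^ m" by (simp add: field_simps power_mult_distrib)
    then have "C * (1 / wt 0 n' ^ m) \<le> C * (2 ^ m / wt 0 n ^ m)" using C by (rule mult_left_mono)
    then show ?thesis using Suc[of n'] by (simp add: C_def mult_ac)
  qed
  have "cmod (lap ?g n) \<le> cmod (?g (n + 1)) + 2 * cmod (?g n) + cmod (?g (n - 1))"
    unfolding lap_def by (rule order_trans[OF norm_triangle_ineq4] add_mono order_trans[OF norm_triangle_ineq])+ (auto simp: norm_mult)
  also have "\<dots> \<le> 2 ^ m * C / wt 0 n ^ m + 2 * (2 ^ m * C / wt 0 n ^ m) + 2 ^ m * C / wt 0 n ^ m"
    by (intro add_mono mult_left_mono near) auto
  also have "\<dots> = (4 * 2 ^ m) ^ Suc l * c / wt 0 n ^ m" by (simp add: C_def field_simps)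
  finally show ?case by simp
qed (use assms in simp)

lemma schwartz_seminorm_le:
  assumes "\<And>n. cmod (f n) \<le> c / wt 0 n ^ m" "0 \<le> c"
  shows "schwartz_seminorm m f \<le> ennreal ((4 * 2 ^ m) ^ m * c)"
  unfolding schwartz_seminorm_def
proof (rule SUP_least)
  fix n :: int
  have "(SUP l\<in>{0..m}. ennreal (cmod ((lap ^^ l) f n))) \<le> ennreal ((4 * 2 ^ m) ^ m * c / wt 0 n ^ m)"
  proof (intro SUP_least ennreal_leI)
    fix l assume l: "l \<in> {0..m}"
    have "(4 * 2 ^ m) ^ l * c \<le> (4 * 2 ^ m) ^ m * (c::real)"
    proof (intro mult_right_mono power_increasing)
      show "1 \<le> 4 * (2::real) ^ m" using one_le_power[of "2::real" m] by linarith
    qed (use l assms(2) in auto)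
    then have "(4 * 2 ^ m) ^ l * c / wt 0 n ^ m \<le> (4 * 2 ^ m) ^ m * c / wt 0 n ^ m"
      by (intro divide_right_mono) auto
    then show "cmod ((lap ^^ l) f n) \<le> (4 * 2 ^ m) ^ m * c / wt 0 n ^ m"
      using lap_pow_bound[OF assms, of l n] by linarith
  qed
  then have "ennreal ((1 + \<bar>real_of_int n\<bar>) ^ m) * (SUP l\<in>{0..m}. ennreal (cmod ((lap ^^ l) f n)))
    \<le> ennreal (wt 0 n ^ m) * ennreal ((4 * 2 ^ m) ^ m * c / wt 0 n ^ m)"
    by (intro mult_mono) (auto simp: wt_def)
  also have "\<dots> = ennreal ((4 * 2 ^ m) ^ m * c)" using assms(2) by (simp flip: ennreal_mult)
  finally show "ennreal ((1 + \<bar>real_of_int n\<bar>) ^ m) * (SUP l\<in>{0..m}. ennreal (cmod ((lap ^^ l) f n))) \<le> ennreal ((4 * 2 ^ m) ^ m * c)" .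
qed

lemma schwartz_seminorm_bound:
  assumes "schwartz_seminorm m f \<le> ennreal c" "0 \<le> c"
  shows "cmod (f n) \<le> c / wt 0 n ^ m"
proof -
  have "ennreal (wt 0 n ^ m) * ennreal (cmod ((lap ^^ 0) f n)) \<le> ennreal (wt 0 n ^ m) * (SUP l\<in>{0..m}. ennreal (cmod ((lap ^^ l) f n)))"
    by (intro mult_left_mono SUP_upper) auto
  also have "\<dots> \<le> schwartz_seminorm m f" unfolding schwartz_seminorm_def wt_def power_0 div_by_1
    by (rule SUP_upper) simp
  also note assms(1)
  finally have "wt 0 n ^ m * cmod (f n) \<le> c" using assms(2) by (simp add: ennreal_le_iff flip: ennreal_mult)
  then show ?thesis by (simp add: field_simps)
qed

lemma schwartz_iff_rapid: "f \<in> schwartz \<longleftrightarrow> rapid f"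
proof
  assume f: "f \<in> schwartz"
  show "rapid f" unfolding rapid_def
  proof
    fix M
    have "schwartz_seminorm M f < top" using f by (simp add: schwartz_def)
    then obtain c where "schwartz_seminorm M f = ennreal c" "0 \<le> c" by (cases "schwartz_seminorm M f") auto
    then have "\<And>n. cmod (f n) \<le> c / wt 0 n ^ M" by (intro schwartz_seminorm_bound) auto
    then show "\<exists>C. scaled 0 M C f" by (auto simp: scaled_def)
  qed
next
  assume f: "rapid f"
  show "f \<in> schwartz" unfolding schwartz_def
  proof (intro CollectI allI)
    fix m
    obtain C where C: "C \<ge> 0" "\<And>n. cmod (f n) \<le> C / wt 0 n ^ m" using rapid_bound[OF f] by meson
    have "schwartz_seminorm m f \<le> ennreal ((4 * 2 ^ m) ^ m * C)" by (intro schwartz_seminorm_le C)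
    then show "schwartz_seminorm m f < \<infinity>" by (simp add: le_less_trans)
  qed
qed

lemma rapid_add: "rapid f \<Longrightarrow> rapid g \<Longrightarrow> rapid (\<lambda>n. f n + g n)"
  unfolding rapid_def
proof
  fix M assume *: "\<forall>M. \<exists>C. scaled 0 M C f" "\<forall>M. \<exists>C. scaled 0 M C g"
  then obtain C D where "scaled 0 M C f" "scaled 0 M D g" by meson
  then have "scaled 0 M (C + D) (\<lambda>n. f n + g n)"
    unfolding scaled_def by (auto simp: add_divide_distrib intro!: order_trans[OF norm_triangle_ineq] add_mono)
  then show "\<exists>C. scaled 0 M C (\<lambda>n. f n + g n)" by blast
qed

lemma rapid_cmult: "rapid f \<Longrightarrow> rapid (\<lambda>n. c * f n)"
  unfolding rapid_def
proof
  fix M assume *: "\<forall>M. \<exists>C. scaled 0 M C f"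
  then obtain C where "scaled 0 M C f" by meson
  then have "scaled 0 M (cmod c * C) (\<lambda>n. c * f n)"
    unfolding scaled_def by (auto simp: norm_mult mult_left_mono simp flip: times_divide_eq_right)
  then show "\<exists>C. scaled 0 M C (\<lambda>n. c * f n)" by blast
qed

lemma rapid_zero: "rapid (\<lambda>n. 0)"
  unfolding rapid_def scaled_def by (intro allI exI[of _ 0]) auto

lemma rapid_sum: "finite D \<Longrightarrow> (\<And>d. d \<in> D \<Longrightarrow> rapid (f d)) \<Longrightarrow> rapid (\<lambda>n. \<Sum>d\<in>D. f d n)"
  by (induction D rule: finite_induct) (auto intro: rapid_zero rapid_add)

lemma unit_bound: "cmod (of_bool (n = m)) \<le> wt 0 m ^ M / wt 0 n ^ M"
  by auto

lemma rapid_unit: "rapid (\<lambda>n. of_bool (n = m))"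
  unfolding rapid_def
proof
  fix M
  have "scaled 0 M (wt 0 m ^ M) (\<lambda>n. of_bool (n = m))"
    unfolding scaled_def using unit_bound[of _ m M] by simp
  then show "\<exists>C. scaled 0 M C (\<lambda>n. of_bool (n = m))" by blast
qed

lemma schwartz_seminorm_mono: "m \<le> m' \<Longrightarrow> schwartz_seminorm m f \<le> schwartz_seminorm m' f"
  unfolding schwartz_seminorm_def
  by (rule SUP_mono'; intro mult_mono ennreal_leI power_increasing SUP_subset_mono) auto

lemma schwartz_seminorm_triangle:
  "schwartz_seminorm m (\<lambda>n. f n + g n) \<le> schwartz_seminorm m f + schwartz_seminorm m g"
  unfolding schwartz_seminorm_def
proof (rule SUP_least)
  fix n :: int
  let ?w = "ennreal ((1 + \<bar>real_of_int n\<bar>) ^ m)"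
  let ?S = "\<lambda>f. SUP l\<in>{0..m}. ennreal (cmod ((lap ^^ l) f n))"
  have "?S (\<lambda>n. f n + g n) \<le> ?S f + ?S g"
  proof (rule SUP_least)
    fix l assume l: "l \<in> {0..m}"
    have "ennreal (cmod ((lap ^^ l) (\<lambda>n. f n + g n) n)) \<le> ennreal (cmod ((lap ^^ l) f n) + cmod ((lap ^^ l) g n))"
      unfolding lap_pow_add by (intro ennreal_leI norm_triangle_ineq)
    also have "\<dots> = ennreal (cmod ((lap ^^ l) f n)) + ennreal (cmod ((lap ^^ l) g n))" by simp
    also have "\<dots> \<le> ?S f + ?S g" using l by (intro add_mono SUP_upper)
    finally show "ennreal (cmod ((lap ^^ l) (\<lambda>n. f n + g n) n)) \<le> ?S f + ?S g" .
  qed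
  then have "?w * ?S (\<lambda>n. f n + g n) \<le> ?w * ?S f + ?w * ?S g"
    unfolding distrib_left[symmetric] by (rule mult_left_mono) simp
  also have "\<dots> \<le> (SUP n. ennreal ((1 + \<bar>real_of_int n\<bar>) ^ m) * (SUP l\<in>{0..m}. ennreal (cmod ((lap ^^ l) f n)))) +
     (SUP n. ennreal ((1 + \<bar>real_of_int n\<bar>) ^ m) * (SUP l\<in>{0..m}. ennreal (cmod ((lap ^^ l) g n))))"
    by (intro add_mono SUP_upper) auto
  finally show "?w * ?S (\<lambda>n. f n + g n) \<le> \<dots>" .
qed

text \<open>A basic neighbourhood of 0 inside an open set, although the topology is given by a subbasis.\<close>
lemma schwartz_open_zero_nhd:
  assumes "openin schwartz_topology W" "(\<lambda>n. 0) \<in> W"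
  shows "\<exists>m \<epsilon>. \<epsilon> > 0 \<and> (\<forall>g\<in>schwartz. schwartz_seminorm m g < ennreal \<epsilon> \<longrightarrow> g \<in> W)"
proof -
  let ?S = "{{g \<in> schwartz. schwartz_seminorm m (\<lambda>n. g n - f n) < ennreal \<epsilon>} | f m \<epsilon>. f \<in> schwartz \<and> \<epsilon> > 0}"
  have "generate_topology_on ?S W"
    using assms(1) unfolding schwartz_topology_def by (rule openin_topology_generated_by)
  then show ?thesis using assms(2)
  proof (induction rule: generate_topology_on.induct)
    case (Int a b)
    then obtain m1 e1 m2 e2 where *: "e1 > 0" "\<forall>g\<in>schwartz. schwartz_seminorm m1 g < ennreal e1 \<longrightarrow> g \<in> a"
      "e2 > 0" "\<forall>g\<in>schwartz. schwartz_seminorm m2 g < ennreal e2 \<longrightarrow> g \<in> b" by blast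
    show ?case
    proof (intro exI[of _ "max m1 m2"] exI[of _ "min e1 e2"] conjI ballI impI)
      fix g assume g: "g \<in> schwartz" "schwartz_seminorm (max m1 m2) g < ennreal (min e1 e2)"
      have "schwartz_seminorm m1 g < ennreal e1" "schwartz_seminorm m2 g < ennreal e2"
        using g(2) schwartz_seminorm_mono[of m1 "max m1 m2" g] schwartz_seminorm_mono[of m2 "max m1 m2" g]
          ennreal_leI[of "min e1 e2" e1] ennreal_leI[of "min e1 e2" e2] by (auto intro: le_less_trans less_le_trans)
      then show "g \<in> a \<inter> b" using * g by blast
    qed (use * in auto)
  next
    case (UN K)
    then obtain k where "k \<in> K" "(\<lambda>n. 0) \<in> k" by blast
    then obtain m e where "e > 0" "\<forall>g\<in>schwartz. schwartz_seminorm m g < ennreal e \<longrightarrow> g \<in> k" using UN.IH by blast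
    then show ?case using \<open>k \<in> K\<close> by blast
  next
    case (Basis s)
    then obtain f m e where s: "s = {g \<in> schwartz. schwartz_seminorm m (\<lambda>n. g n - f n) < ennreal e}" "e > 0" by blast
    then have lt: "schwartz_seminorm m (\<lambda>n. - f n) < ennreal e" using Basis by auto
    then obtain d where d: "schwartz_seminorm m (\<lambda>n. - f n) = ennreal d" "0 \<le> d"
      by (cases "schwartz_seminorm m (\<lambda>n. - f n)") auto
    then have "d < e" using lt by (simp add: ennreal_less_iff)
    show ?case
    proof (intro exI[of _ m] exI[of _ "e - d"] conjI ballI impI)
      fix g assume g: "g \<in> schwartz" "schwartz_seminorm m g < ennreal (e - d)"
      have "schwartz_seminorm m (\<lambda>n. g n - f n) \<le> schwartz_seminorm m g + schwartz_seminorm m (\<lambda>n. - f n)"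
        using schwartz_seminorm_triangle[of m g "\<lambda>n. - f n"] by simp
      also have "\<dots> < ennreal (e - d) + ennreal d"
        using g d ennreal_add_left_cancel_less[of "ennreal d"] by (simp add: add.commute)
      also have "\<dots> = ennreal e" using d \<open>d < e\<close> by (simp flip: ennreal_plus)
      finally show "g \<in> s" using g s by simp
    qed (use \<open>d < e\<close> in auto)
  qed auto
qed

lemma schwartz_dual_zero: "u \<in> schwartz_dual \<Longrightarrow> u (\<lambda>n. 0) = 0"
proof -
  assume "u \<in> schwartz_dual"
  then have "\<And>f. f \<in> schwartz \<Longrightarrow> u (\<lambda>n. 0 * f n) = 0 * u f"
    unfolding schwartz_dual_def by blast
  from this[of "\<lambda>n. 0"] show ?thesis by (simp add: schwartz_iff_rapid rapid_zero)
qed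

lemma schwartz_dual_bound:
  assumes u: "u \<in> schwartz_dual"
  shows "\<exists>m C. C \<ge> 0 \<and> (\<forall>f c. rapid f \<longrightarrow> c \<ge> 0 \<longrightarrow> (\<forall>n. cmod (f n) \<le> c / wt 0 n ^ m) \<longrightarrow> cmod (u f) \<le> C * c)"
proof -
  have cont: "continuous_map schwartz_topology euclidean u" and lin: "\<And>c f. rapid f \<Longrightarrow> u (\<lambda>n. c * f n) = c * u f"
    using u unfolding schwartz_dual_def schwartz_iff_rapid[symmetric] by auto
  \<comment> \<open>Continuity at 0 is all that is needed, by homogeneity.\<close>
  define W where "W = {x \<in> topspace schwartz_topology. u x \<in> ball 0 1}"
  have "openin schwartz_topology W" unfolding W_def
    by (rule openin_continuous_map_preimage[OF cont]) simp
  moreover have "(\<lambda>n. 0) \<in> topspace schwartz_topology"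
  proof -
    have "(\<lambda>n. 0) \<in> schwartz" by (simp add: schwartz_iff_rapid rapid_zero)
    moreover have "schwartz_seminorm 0 (\<lambda>n. 0 - 0) < ennreal 1"
      using schwartz_seminorm_le[of "\<lambda>n. 0" 0 0] by (simp add: le_less_trans)
    ultimately have "(\<lambda>n. 0) \<in> {g \<in> schwartz. schwartz_seminorm 0 (\<lambda>n. g n - (\<lambda>n. 0) n) < ennreal 1}" by simp
    then show ?thesis using \<open>(\<lambda>n. 0) \<in> schwartz\<close> unfolding schwartz_topology_def topology_generated_by_topspace
      by (intro UnionI[of "{g \<in> schwartz. schwartz_seminorm 0 (\<lambda>n. g n - (\<lambda>n. 0) n) < ennreal 1}"])
         (auto intro!: exI[of _ "\<lambda>n. 0"] exI[of _ "0::nat"] exI[of _ "1::real"])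
  qed
  ultimately obtain m e where e: "e > 0" and W: "\<And>g. rapid g \<Longrightarrow> schwartz_seminorm m g < ennreal e \<Longrightarrow> g \<in> W"
  proof -
    assume "openin schwartz_topology W" "(\<lambda>n. 0) \<in> topspace schwartz_topology"
    then have "\<exists>m \<epsilon>. \<epsilon> > 0 \<and> (\<forall>g\<in>schwartz. schwartz_seminorm m g < ennreal \<epsilon> \<longrightarrow> g \<in> W)"
      using schwartz_dual_zero[OF u] by (intro schwartz_open_zero_nhd) (auto simp: W_def)
    then show ?thesis using that schwartz_iff_rapid by blast
  qed
  define D where "D = ((4::real) * 2 ^ m) ^ m"
  have D: "D > 0" by (simp add: D_def)
  have "cmod (u f) \<le> 2 * D / e * c" if f: "rapid f" and c: "c \<ge> 0" and b: "\<forall>n. cmod (f n) \<le> c / wt 0 n ^ m" for f c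
  proof (cases "c = 0")
    case True
    then have "f = (\<lambda>n. 0)" using b by auto
    then show ?thesis using True schwartz_dual_zero[OF u] by simp
  next
    case False
    then have c: "c > 0" using c by simp
    define t where "t = e / (2 * D * c)"
    have t: "t > 0" using e D c by (simp add: t_def)
    have "schwartz_seminorm m (\<lambda>n. of_real t * f n) \<le> ennreal (D * (t * c))" unfolding D_def
    proof (rule schwartz_seminorm_le)
      fix n show "cmod (of_real t * f n) \<le> t * c / wt 0 n ^ m"
        using b[rule_format, of n] t by (simp add: norm_mult mult_left_mono flip: times_divide_eq_right)
    qed (use t c in auto)
    also have "D * (t * c) < e" using e D c by (simp add: t_def)
    then have "ennreal (D * (t * c)) < ennreal e" using e by (intro ennreal_lessI) auto
    finally have "(\<lambda>n. of_real t * f n) \<in> W" by (intro W rapid_cmult f)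
    then have "cmod (of_real t * u f) < 1" by (simp add: W_def lin[OF f])
    then have "t * cmod (u f) < 1" using t by (simp add: norm_mult)
    then show ?thesis using t e D c by (simp add: t_def field_simps)
  qed
  then show ?thesis using D e by (intro exI[of _ m] exI[of _ "2 * D / e"]) auto
qed

lemma tempered_dist_fun:
  assumes u: "u \<in> schwartz_dual"
  shows "tempered (dist_fun u)"
proof -
  obtain m C where C: "C \<ge> 0" "\<And>f c. rapid f \<Longrightarrow> c \<ge> 0 \<Longrightarrow> (\<forall>n. cmod (f n) \<le> c / wt 0 n ^ m) \<Longrightarrow> cmod (u f) \<le> C * c"
    using schwartz_dual_bound[OF u] by blast
  have "cmod (dist_fun u k) \<le> C * wt 0 k ^ m" for k
    unfolding dist_fun_def by (intro C rapid_unit allI unit_bound) auto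
  then show ?thesis unfolding tempered_def by blast
qed

text \<open>A tempered distribution acts by summation against its values at the unit sequences.\<close>
lemma schwartz_dual_has_sum:
  assumes u: "u \<in> schwartz_dual" and f: "rapid f"
  shows "((\<lambda>m. f m * dist_fun u m) has_sum u f) UNIV"
proof -
  have lin: "\<And>c f. rapid f \<Longrightarrow> u (\<lambda>n. c * f n) = c * u f" "\<And>f g. rapid f \<Longrightarrow> rapid g \<Longrightarrow> u (\<lambda>n. f n + g n) = u f + u g"
    using u unfolding schwartz_dual_def schwartz_iff_rapid[symmetric] by auto
  obtain m C where C: "C \<ge> 0" "\<And>f c. rapid f \<Longrightarrow> c \<ge> 0 \<Longrightarrow> (\<forall>n. cmod (f n) \<le> c / wt 0 n ^ m) \<Longrightarrow> cmod (u f) \<le> C * c"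
    using schwartz_dual_bound[OF u] by blast
  obtain A where A: "A \<ge> 0" "\<And>n. cmod (f n) \<le> A / wt 0 n ^ (m + 1)" using rapid_bound[OF f] by meson
  have trunc: "rapid (\<lambda>n. if n \<in> F then f n else 0) \<and> u (\<lambda>n. if n \<in> F then f n else 0) = (\<Sum>m\<in>F. f m * dist_fun u m)" if "finite F" for F
    using that
  proof (induction F)
    case empty
    then show ?case using schwartz_dual_zero[OF u] rapid_zero by simp
  next
    case (insert k F)
    have "(\<lambda>n. if n \<in> insert k F then f n else 0) = (\<lambda>n. f k * of_bool (n = k) + (if n \<in> F then f n else 0))"
      using insert by auto
    moreover have "rapid (\<lambda>n. f k * of_bool (n = k))" by (intro rapid_cmult rapid_unit)
    ultimately show ?case using insert lin rapid_add
      by (simp add: rapid_unit dist_fun_def)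
  qed
  show ?thesis unfolding has_sum_def tendsto_iff
  proof (intro allI impI)
    fix e :: real assume e: "e > 0"
    \<comment> \<open>One order of decay more than the bound on u requires makes the remainder of f small.\<close>
    obtain N :: nat where N: "C * A / e < real N" using reals_Archimedean2 by blast
    show "\<forall>\<^sub>F F in finite_subsets_at_top UNIV. dist (\<Sum>m\<in>F. f m * dist_fun u m) (u f) < e"
      unfolding eventually_finite_subsets_at_top
    proof (intro exI[of _ "{- int N..int N}"] conjI allI impI)
      fix F assume F: "finite F \<and> {- int N..int N} \<subseteq> F \<and> F \<subseteq> UNIV"
      define g where "g n = f n + (-1) * (if n \<in> F then f n else 0)" for n
      have "u f - (\<Sum>m\<in>F. f m * dist_fun u m) = u g"
      proof -
        define T where "T n = (if n \<in> F then f n else 0)" for n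
        have T: "rapid T" "u T = (\<Sum>m\<in>F. f m * dist_fun u m)"
          using trunc[of F] F by (auto simp: T_def[abs_def])
        have "u g = u f + u (\<lambda>n. (-1) * T n)"
          unfolding g_def T_def[symmetric] by (intro lin f rapid_cmult T)
        also have "u (\<lambda>n. (-1) * T n) = (-1) * u T" by (intro lin T)
        finally show ?thesis by (simp add: T)
      qed
      moreover have "cmod (u g) \<le> C * (A / (1 + real N))"
      proof (rule C)
        show "rapid g" unfolding g_def using trunc[of F] F f by (intro rapid_add rapid_cmult) auto
        show "\<forall>n. cmod (g n) \<le> A / (1 + real N) / wt 0 n ^ m"
        proof
          fix n show "cmod (g n) \<le> A / (1 + real N) / wt 0 n ^ m"
          proof (cases "n \<in> F")
            case True
            then show ?thesis using A by (simp add: g_def)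
          next
            case False
            then have "n \<notin> {- int N..int N}" using F by blast
            then have "int N < \<bar>n\<bar>" by auto
            then have "real_of_int (int N) < real_of_int \<bar>n\<bar>" by (simp only: of_int_less_iff)
            then have "1 + real N \<le> wt 0 n" by (simp add: wt_def)
            then have "A / (wt 0 n * wt 0 n ^ m) \<le> A / ((1 + real N) * wt 0 n ^ m)"
              using A by (intro divide_left_mono mult_right_mono) auto
            then show ?thesis using A(2)[of n] False by (simp add: g_def)
          qed
        qed
      qed (use A in auto)
      moreover have "C * (A / (1 + real N)) < e"
      proof -
        have "C * A < e * (1 + real N)" using N e by (simp add: field_simps)
        then show ?thesis by (simp add: field_simps)
      qed
      ultimately show "dist (\<Sum>m\<in>F. f m * dist_fun u m) (u f) < e"
        by (simp add: dist_norm norm_minus_commute)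
    qed auto
  qed
qed

lemma dist_rep_dual:
  assumes "U \<in> dist_mod_poly"
  shows "dist_rep U \<in> schwartz_dual"
proof -
  obtain u where u: "u \<in> schwartz_dual" "U = poly_rel `` {u}"
    using assms unfolding dist_mod_poly_def quotient_def by blast
  have "(\<lambda>n. 0) \<in> int_polynomials" unfolding int_polynomials_def by (auto intro!: exI[of _ 0])
  then have "(u, u) \<in> poly_rel" using u unfolding poly_rel_def by (auto intro!: bexI[of _ "\<lambda>n. 0"])
  then have "u \<in> U" using u by blast
  then have "dist_rep U \<in> U" unfolding dist_rep_def by (rule someI[of "\<lambda>u. u \<in> U"])
  then show ?thesis using u by (auto simp: poly_rel_def)
qed

section \<open>Fourier series\<close>

text \<open>The Fourier coefficients of a function on \<open>[-\<pi>, \<pi>]\<close>, normalised as the inverse of \<open>fourierZ\<close>.\<close>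
definition coef :: "(real \<Rightarrow> complex) \<Rightarrow> int \<Rightarrow> complex" where
  "coef G n = 1 / (2 * of_real pi) * (LBINT \<theta>:{-pi..pi}. G \<theta> * exp (- \<i> * of_int n * of_real \<theta>))"

lemma rapid_abs_summable: "rapid f \<Longrightarrow> (\<lambda>m. norm (f m)) summable_on UNIV"
proof -
  assume "rapid f"
  then have "(\<lambda>m. norm (f (- m) * 1)) summable_on UNIV"
  proof -
    have "tempered (\<lambda>_. 1)" unfolding tempered_def by (intro exI[of _ 0] exI[of _ 1]) simp
    from conv_abs_summable[OF \<open>rapid f\<close> this, of 0] show ?thesis by simp
  qed
  then have "(\<lambda>m. norm (f (- m))) summable_on UNIV" by simp
  then show ?thesis
    by (subst summable_on_reindex_bij_witness[of UNIV uminus uminus UNIV "\<lambda>m. norm (f (- m))"]) auto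
qed

lemma has_sum_imp_sums_int:
  assumes "(f has_sum S) (UNIV :: int set)"
  shows "(\<lambda>k. f (int_decode k)) sums S"
proof (rule has_sum_imp_sums)
  show "((\<lambda>k. f (int_decode k)) has_sum S) UNIV"
    using assms has_sum_reindex_bij_betw[OF bij_int_decode, of f S] by simp
qed

lemma summable_int_decode:
  assumes "(f :: int \<Rightarrow> real) summable_on UNIV"
  shows "summable (\<lambda>k. f (int_decode k))"
  using has_sum_imp_sums_int[OF has_sum_infsum[OF assms]] by (rule sums_summable)

lemma norm_exp_real: "norm (exp (\<i> * of_int n * of_real \<theta>)) = 1" "norm (exp (- \<i> * of_int n * of_real \<theta>)) = 1"
proof -
  show "norm (exp (\<i> * of_int n * of_real \<theta>)) = 1"
    unfolding norm_exp_eq_Re by simp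
  show "norm (exp (- \<i> * of_int n * of_real \<theta>)) = 1"
    unfolding norm_exp_eq_Re by simp
qed

lemma fourierZ_has_sum:
  assumes "rapid f"
  shows "((\<lambda>n. f n * exp (\<i> * of_int n * of_real \<theta>)) has_sum fourierZ f \<theta>) UNIV"
  unfolding fourierZ_def
proof (rule has_sum_infsum, rule Infinite_Sum.abs_summable_summable)
  show "(\<lambda>n. norm (f n * exp (\<i> * of_int n * of_real \<theta>))) summable_on UNIV"
    unfolding norm_mult norm_exp_real mult_1_right by (rule rapid_abs_summable[OF assms])
qed

lemma fourierZ_sums:
  assumes "rapid f"
  shows "(\<lambda>k. f (int_decode k) * exp (\<i> * of_int (int_decode k) * of_real \<theta>)) sums fourierZ f \<theta>"
  by (rule has_sum_imp_sums_int[OF fourierZ_has_sum[OF assms]])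

text \<open>Convolution with Fourier coefficients is multiplication on the Fourier side. As \<open>f\<close> is absolutely
  summable, \<open>G\<close> need not be the sum of its Fourier series.\<close>
lemma conv_coef:
  assumes G: "continuous_on {-pi..pi} G" and f: "rapid f"
  shows "conv (coef G) f n = coef (\<lambda>\<theta>. G \<theta> * fourierZ f \<theta>) n"
proof -
  define h where "h \<theta> = G \<theta> * exp (- \<i> * of_int n * of_real \<theta>)" for \<theta>
  define F where "F k \<theta> = indicator {-pi..pi} \<theta> *\<^sub>R (h \<theta> * (f (int_decode k) * exp (\<i> * of_int (int_decode k) * of_real \<theta>)))" for k \<theta>
  have h: "continuous_on {-pi..pi} h" unfolding h_def by (intro continuous_intros G)
  have intF: "integrable lborel (F k)" for k
    unfolding F_def
    by (rule borel_integrable_compact) (auto intro!: continuous_intros h)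
  have normF: "norm (F k \<theta>) = norm (f (int_decode k)) * (indicator {-pi..pi} \<theta> * norm (h \<theta>))" for k \<theta>
    by (simp add: F_def norm_mult norm_exp_real)
  have sf: "summable (\<lambda>k. norm (f (int_decode k)))"
    by (rule summable_int_decode[OF rapid_abs_summable[OF f]])
  have sums: "(\<lambda>k. integral\<^sup>L lborel (F k)) sums (\<integral>\<theta>. (\<Sum>k. F k \<theta>) \<partial>lborel)"
  proof (rule sums_integral[OF intF])
    show "AE x in lborel. summable (\<lambda>i. norm (F i x))"
      unfolding normF by (intro AE_I2 summable_mult2 sf)
    show "summable (\<lambda>i. \<integral>x. norm (F i x) \<partial>lborel)"
      unfolding normF by (simp add: summable_mult2[OF sf])
  qed
  have termF: "1 / (2 * of_real pi) * integral\<^sup>L lborel (F k) = coef G (n - int_decode k) * f (int_decode k)" for k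
  proof -
    have eq: "F k = (\<lambda>\<theta>. f (int_decode k) * (indicator {-pi..pi} \<theta> *\<^sub>R (G \<theta> * exp (- \<i> * of_int (n - int_decode k) * of_real \<theta>))))"
    proof
      fix \<theta>
      have "exp (- \<i> * of_int (n - int_decode k) * of_real \<theta>) = exp (- \<i> * of_int n * of_real \<theta>) * exp (\<i> * of_int (int_decode k) * of_real \<theta>)"
        by (simp add: exp_add[symmetric] algebra_simps)
      then show "F k \<theta> = f (int_decode k) * (indicator {-pi..pi} \<theta> *\<^sub>R (G \<theta> * exp (- \<i> * of_int (n - int_decode k) * of_real \<theta>)))"
        by (simp add: F_def h_def)
    qed
    show ?thesis
      unfolding coef_def set_lebesgue_integral_def eq integral_mult_right_zero by (simp only: mult_ac)
  qed
  have "(\<Sum>k. F k \<theta>) = indicator {-pi..pi} \<theta> *\<^sub>R (h \<theta> * fourierZ f \<theta>)" for \<theta>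
    unfolding F_def by (intro sums_unique[symmetric] sums_scaleR_right sums_mult fourierZ_sums f)
  then have "(\<integral>\<theta>. (\<Sum>k. F k \<theta>) \<partial>lborel) = (LBINT \<theta>:{-pi..pi}. (G \<theta> * fourierZ f \<theta>) * exp (- \<i> * of_int n * of_real \<theta>))"
    by (simp add: set_lebesgue_integral_def h_def mult_ac)
  then have 1: "(\<lambda>k. coef G (n - int_decode k) * f (int_decode k)) sums coef (\<lambda>\<theta>. G \<theta> * fourierZ f \<theta>) n"
    using sums_mult[OF sums, of "1 / (2 * of_real pi)"] unfolding termF by (simp add: coef_def)
  have "(\<lambda>m. coef G (n - m) * f m) summable_on UNIV"
  proof -
    define c where "c = norm (1 / (2 * of_real pi) :: complex) * (\<integral>\<theta>. indicator {-pi..pi} \<theta> * norm (G \<theta>) \<partial>lborel)"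
    have bound: "norm (coef G l) \<le> c" for l
    proof -
      have "norm (LBINT \<theta>:{-pi..pi}. G \<theta> * exp (- \<i> * of_int l * of_real \<theta>)) \<le> (\<integral>\<theta>. indicator {-pi..pi} \<theta> * norm (G \<theta>) \<partial>lborel)"
        unfolding set_lebesgue_integral_def
        by (rule order_trans[OF integral_norm_bound]) (simp add: norm_mult norm_exp_real)
      then show ?thesis unfolding coef_def c_def norm_mult by (intro mult_left_mono) auto
    qed
    show ?thesis
    proof (rule Infinite_Sum.abs_summable_summable, rule Infinite_Sum.abs_summable_on_comparison_test')
      show "(\<lambda>m. c * norm (f m)) summable_on UNIV" by (intro summable_on_cmult_right rapid_abs_summable f)
      show "norm (coef G (n - m) * f m) \<le> c * norm (f m)" for m
        unfolding norm_mult by (intro mult_right_mono bound) auto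
    qed
  qed
  then have "((\<lambda>m. coef G (n - m) * f m) has_sum conv (coef G) f n) UNIV"
    unfolding conv_def by (rule has_sum_infsum)
  from has_sum_imp_sums_int[OF this] 1 show ?thesis by (rule sums_unique2)
qed

lemma coef_one: "coef (\<lambda>_. 1) n = of_bool (n = 0)"
proof -
  have "((\<lambda>\<theta>. exp (- \<i> * of_int n * of_real \<theta>)) has_integral (if n = 0 then 2 * of_real pi else 0)) {-pi..pi}"
  proof (cases "n = 0")
    case True
    then show ?thesis using has_integral_const_real[of "1::complex" "-pi" pi] by (simp add: scaleR_conv_of_real)
  next
    case False
    define H where "H \<theta> = exp (- \<i> * of_int n * of_real \<theta>) / (- \<i> * of_int n)" for \<theta> :: real
    have "((\<lambda>\<theta>. exp (- \<i> * of_int n * of_real \<theta>)) has_integral H pi - H (- pi)) {-pi..pi}"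
    proof (rule fundamental_theorem_of_calculus)
      fix x assume "x \<in> {-pi..pi}"
      have "((\<lambda>z. exp (- \<i> * of_int n * z) / (- \<i> * of_int n)) has_field_derivative exp (- \<i> * of_int n * of_real x)) (at (of_real x))"
        using False by (auto intro!: derivative_eq_intros simp: field_simps)
      then show "(H has_vector_derivative exp (- \<i> * of_int n * of_real x)) (at x within {-pi..pi})"
        unfolding H_def[abs_def] by (rule has_vector_derivative_real_field)
    qed simp
    moreover have "H pi = H (- pi)"
    proof -
      have "exp (- \<i> * of_int n * of_real pi) = exp (- \<i> * of_int n * of_real (- pi))"
        unfolding exp_eq by (rule exI[of _ "- n"]) (simp add: mult_ac)
      then show ?thesis by (simp add: H_def)
    qed
    ultimately show ?thesis using False by simp
  qed
  then have "integral {-pi..pi} (\<lambda>\<theta>. exp (- \<i> * of_int n * of_real \<theta>)) = (if n = 0 then 2 * of_real pi else 0)"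
    by (rule integral_unique)
  moreover have "(LBINT \<theta>:{-pi..pi}. exp (- \<i> * of_int n * of_real \<theta>)) = integral {-pi..pi} (\<lambda>\<theta>. exp (- \<i> * of_int n * of_real \<theta>))"
    by (rule set_borel_integral_eq_integral) (auto simp: set_integrable_def intro!: borel_integrable_compact continuous_intros)
  ultimately show ?thesis by (simp add: coef_def)
qed

lemma coef_fourierZ:
  assumes "rapid f"
  shows "coef (fourierZ f) n = f n"
proof -
  have "coef (fourierZ f) n = conv (coef (\<lambda>_. 1)) f n" using conv_coef[of "\<lambda>_. 1" f n] assms by simp
  also have "\<dots> = (\<Sum>\<^sub>\<infinity>m\<in>{n}. of_bool (n - m = 0) * f m)"
    unfolding conv_def coef_one by (intro infsum_cong_neutral) auto
  finally show ?thesis by simp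
qed

lemma rapid_times_n:
  assumes "rapid f"
  shows "rapid (\<lambda>n. \<i> * of_int n * f n)"
  unfolding rapid_def
proof
  fix M
  obtain C where C: "C \<ge> 0" "\<And>n. cmod (f n) \<le> C / wt 0 n ^ (M + 1)" using rapid_bound[OF assms] by meson
  have "scaled 0 M C (\<lambda>n. \<i> * of_int n * f n)" unfolding scaled_def
  proof
    fix n
    have "cmod (\<i> * of_int n * f n) \<le> wt 0 n * (C / wt 0 n ^ (M + 1))"
      unfolding norm_mult using C by (intro mult_mono) (auto simp: wt_def)
    then show "cmod (\<i> * of_int n * f n) \<le> C / 2 ^ 0 / wt 0 n ^ M" by simp
  qed
  then show "\<exists>C. scaled 0 M C (\<lambda>n. \<i> * of_int n * f n)" by blast
qed

lemma fourierZ_deriv: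
  assumes f: "rapid f"
  shows "(fourierZ f has_vector_derivative fourierZ (\<lambda>n. \<i> * of_int n * f n) x) (at x)"
proof -
  let ?g = "\<lambda>n. \<i> * of_int n * f n"
  let ?e = "\<lambda>k \<theta>. exp (\<i> * of_int (int_decode k) * of_real \<theta>)"
  have g: "rapid ?g" by (rule rapid_times_n[OF f])
  have lim: "uniform_limit UNIV (\<lambda>n \<theta>. \<Sum>i<n. ?g (int_decode i) * ?e i \<theta>) (\<lambda>\<theta>. \<Sum>i. ?g (int_decode i) * ?e i \<theta>) sequentially"
    by (rule Weierstrass_m_test[OF _ summable_int_decode[OF rapid_abs_summable[OF g]]])
       (simp add: norm_mult norm_exp_real)
  have sg: "(\<Sum>i. ?g (int_decode i) * ?e i \<theta>) = fourierZ ?g \<theta>" for \<theta>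
    using fourierZ_sums[OF g, of \<theta>] by (simp add: sums_iff)
  have "\<exists>F. \<forall>x\<in>UNIV. (\<lambda>k. f (int_decode k) * ?e k x) sums F x \<and> (F has_derivative (\<lambda>h. h *\<^sub>R fourierZ ?g x)) (at x within UNIV)"
  proof (rule has_derivative_series)
    fix k and x :: real
    have "((\<lambda>z. f (int_decode k) * exp (\<i> * of_int (int_decode k) * z)) has_field_derivative ?g (int_decode k) * ?e k x) (at (of_real x))"
      by (auto intro!: derivative_eq_intros simp: field_simps)
    then have "((\<lambda>x. f (int_decode k) * ?e k x) has_vector_derivative ?g (int_decode k) * ?e k x) (at x)"
      by (rule has_vector_derivative_real_field)
    then show "((\<lambda>x. f (int_decode k) * ?e k x) has_derivative (\<lambda>h. h *\<^sub>R (?g (int_decode k) * ?e k x))) (at x within UNIV)"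
      by (simp add: has_vector_derivative_def)
  next
    fix e :: real assume e: "e > 0"
    have "\<forall>\<^sub>F n in sequentially. \<forall>\<theta>\<in>UNIV. dist (\<Sum>i<n. ?g (int_decode i) * ?e i \<theta>) (fourierZ ?g \<theta>) < e"
      using lim e unfolding uniform_limit_iff sg by blast
    then show "\<forall>\<^sub>F n in sequentially. \<forall>x\<in>UNIV. \<forall>h. norm ((\<Sum>i<n. h *\<^sub>R (?g (int_decode i) * ?e i x)) - h *\<^sub>R fourierZ ?g x) \<le> e * norm h"
    proof (rule eventually_mono, intro ballI allI)
      fix n :: nat and x h :: real assume "\<forall>\<theta>\<in>UNIV. dist (\<Sum>i<n. ?g (int_decode i) * ?e i \<theta>) (fourierZ ?g \<theta>) < e"
      then have "norm ((\<Sum>i<n. ?g (int_decode i) * ?e i x) - fourierZ ?g x) \<le> e" by (simp add: dist_norm less_imp_le)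
      then have "norm h * norm ((\<Sum>i<n. ?g (int_decode i) * ?e i x) - fourierZ ?g x) \<le> norm h * e" by (intro mult_left_mono) auto
      then show "norm ((\<Sum>i<n. h *\<^sub>R (?g (int_decode i) * ?e i x)) - h *\<^sub>R fourierZ ?g x) \<le> e * norm h"
        by (simp add: scaleR_sum_right[symmetric] scaleR_diff_right[symmetric] mult.commute)
    qed
  qed (rule convex_UNIV UNIV_I fourierZ_sums[OF f])+
  then obtain F where F: "\<And>x. (\<lambda>k. f (int_decode k) * ?e k x) sums F x" "\<And>x. (F has_derivative (\<lambda>h. h *\<^sub>R fourierZ ?g x)) (at x)" by auto
  have "F = fourierZ f" using sums_unique2[OF F(1) fourierZ_sums[OF f]] by auto
  then show ?thesis using F(2) by (simp add: has_vector_derivative_def)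
qed

lemma continuous_fourierZ: "rapid f \<Longrightarrow> continuous_on A (fourierZ f)"
  using fourierZ_deriv by (intro continuous_at_imp_continuous_on ballI) (auto intro: has_vector_derivative_continuous)

lemma iter_deriv_fourierZ:
  assumes "rapid f"
  shows "iter_deriv k (fourierZ f) = fourierZ (\<lambda>n. (\<i> * of_int n) ^ k * f n) \<and> rapid (\<lambda>n. (\<i> * of_int n) ^ k * f n)"
proof (induction k)
  case (Suc k)
  let ?h = "\<lambda>n. (\<i> * of_int n) ^ k * f n"
  have eq: "(\<lambda>n. \<i> * of_int n * ?h n) = (\<lambda>n. (\<i> * of_int n) ^ Suc k * f n)" by (simp add: mult_ac)
  have "iter_deriv (Suc k) (fourierZ f) = (\<lambda>x. vector_derivative (fourierZ ?h) (at x))" using Suc by simp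
  also have "\<dots> = fourierZ (\<lambda>n. \<i> * of_int n * ?h n)"
    using fourierZ_deriv[of ?h] Suc by (auto intro!: vector_derivative_at)
  finally show ?case using rapid_times_n[of ?h] Suc unfolding eq by simp
qed (use assms in simp)

section \<open>Decay of sequences with Fourier support at a dyadic scale\<close>

lemma wt_power_le: "wt k n ^ M \<le> 2 ^ M * (1 + (\<bar>real_of_int n\<bar> / 2 ^ k) ^ M)"
proof -
  define x where "x = \<bar>real_of_int n\<bar> / 2 ^ k"
  have x: "x \<ge> 0" by (simp add: x_def)
  have "(1 + x) ^ M \<le> (2 * max 1 x) ^ M" using x by (intro power_mono) auto
  also have "\<dots> = 2 ^ M * (max 1 x) ^ M" by (simp add: power_mult_distrib)
  also have "(max 1 x) ^ M \<le> 1 + x ^ M" using x by (cases "x \<le> 1") (auto simp: max_def)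
  finally show ?thesis by (simp add: wt_def x_def)
qed

lemma iter_deriv_zero_open:
  assumes "open S" "\<And>x. x \<in> S \<Longrightarrow> f x = 0" "x \<in> S"
  shows "iter_deriv j f x = 0"
  using assms(3)
proof (induction j arbitrary: x)
  case (Suc j)
  have "((\<lambda>x. 0) has_vector_derivative 0) (at x)" by (rule has_vector_derivative_const)
  then have "(iter_deriv j f has_vector_derivative 0) (at x)"
    by (rule has_vector_derivative_transform_within_open[OF _ assms(1) Suc.prems]) (use Suc.IH in auto)
  then show ?case by (simp add: vector_derivative_at)
qed (use assms in simp)

text \<open>The hypothesis says nothing at \<open>\<pm>\<pi>\<close>, where derivatives of a function vanishing inside the interval
  need not be known; these two points have measure 0.\<close>
lemma coef_bound_supp:
  assumes B: "\<And>x. x \<in> {-pi..pi} \<Longrightarrow> cmod (F x) \<le> B" and supp: "\<And>x. a < \<bar>x\<bar> \<Longrightarrow> \<bar>x\<bar> < pi \<Longrightarrow> F x = 0" and a: "0 \<le> a"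
  shows "cmod (coef F n) \<le> a * B / pi"
proof -
  have B0: "B \<ge> 0" using B[of 0] by (meson atLeastAtMost_iff norm_ge_zero order_trans pi_ge_zero neg_le_0_iff_le)
  define b where "b x = B * (indicator {-a..a} x + indicator {pi} x + indicator {-pi} x)" for x :: real
  have ib: "integrable lborel b" unfolding b_def using a by (intro integrable_mult_right Bochner_Integration.integrable_add) (auto simp: integrable_indicator_iff emeasure_lborel_Icc)
  have "cmod (LBINT \<theta>:{-pi..pi}. F \<theta> * exp (- \<i> * of_int n * of_real \<theta>)) \<le>
     (\<integral>\<theta>. norm (indicator {-pi..pi} \<theta> *\<^sub>R (F \<theta> * exp (- \<i> * of_int n * of_real \<theta>))) \<partial>lborel)"
    unfolding set_lebesgue_integral_def by (rule integral_norm_bound)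
  also have "\<dots> \<le> integral\<^sup>L lborel b"
  proof (rule integral_mono'[OF ib])
    fix x :: real
    show "0 \<le> b x" using B0 by (simp add: b_def)
    show "norm (indicator {-pi..pi} x *\<^sub>R (F x * exp (- \<i> * of_int n * of_real x))) \<le> b x"
    proof (cases "x \<in> {-pi..pi}")
      case True
      consider "\<bar>x\<bar> \<le> a" | "a < \<bar>x\<bar>" "\<bar>x\<bar> < pi" | "\<bar>x\<bar> = pi" using True by fastforce
      then show ?thesis
      proof cases
        case 1
        have "B * 1 \<le> b x" unfolding b_def using 1 B0 by (intro mult_left_mono) (auto simp: abs_le_iff indicator_def)
        then show ?thesis using B[OF True] True by (simp add: norm_mult norm_exp_real)
      next
        case 2
        then show ?thesis using supp[of x] B0 by (simp add: b_def)
      next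
        case 3
        then have "x = pi \<or> x = - pi" by linarith
        then have "B * 1 \<le> b x" unfolding b_def using B0 by (intro mult_left_mono) auto
        then show ?thesis using B[OF True] True by (simp add: norm_mult norm_exp_real)
      qed
    qed (use B0 in \<open>simp add: b_def\<close>)
  qed
  also have "integral\<^sup>L lborel b = B * (2 * a)"
    unfolding b_def using a by (simp add: integrable_indicator_iff)
  finally have "cmod (coef F n) \<le> 1 / (2 * pi) * (B * (2 * a))"
    unfolding coef_def norm_mult by (intro mult_mono) (auto simp: norm_divide norm_mult)
  then show ?thesis by (simp add: field_simps)
qed

text \<open>Multiplication by \<open>i n\<close> corresponds to differentiation on the Fourier side, and the length of the Fourier
  support contributes the factor \<open>2\<^sup>-\<^sup>k\<close>.\<close>
lemma scaled_of_fourier: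
  assumes f: "rapid f" and supp: "\<And>x. x \<in> {-pi..pi} \<Longrightarrow> fourierZ f x \<noteq> 0 \<Longrightarrow> \<bar>x\<bar> \<le> pi / 2 ^ k"
    and A: "\<And>x j. x \<in> {-pi..pi} \<Longrightarrow> cmod (iter_deriv j (fourierZ f) x) \<le> A j * (2 ^ k) ^ j"
  shows "scaled k M (2 ^ M * (A 0 + A M)) f"
  unfolding scaled_def
proof
  fix n
  have est: "\<bar>real_of_int n\<bar> ^ j * cmod (f n) \<le> A j * (2 ^ k) ^ j / 2 ^ k" for j
  proof -
    let ?F = "iter_deriv j (fourierZ f)"
    have "coef ?F n = (\<i> * of_int n) ^ j * f n"
      using iter_deriv_fourierZ[OF f, of j] coef_fourierZ[of "\<lambda>n. (\<i> * of_int n) ^ j * f n" n] by simp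
    moreover have "cmod (coef ?F n) \<le> (pi / 2 ^ k) * (A j * (2 ^ k) ^ j) / pi"
    proof (rule coef_bound_supp)
      fix x assume x: "pi / 2 ^ k < \<bar>x\<bar>" "\<bar>x\<bar> < pi"
      show "?F x = 0"
      proof (rule iter_deriv_zero_open)
        show "open {x. pi / 2 ^ k < \<bar>x\<bar> \<and> \<bar>x\<bar> < pi}"
          by (intro open_Collect_conj open_Collect_less continuous_intros)
        show "fourierZ f y = 0" if "y \<in> {x. pi / 2 ^ k < \<bar>x\<bar> \<and> \<bar>x\<bar> < pi}" for y
          using supp[of y] that by fastforce
      qed (use x in auto)
    qed (use A in auto)
    ultimately show ?thesis by (simp add: norm_mult norm_power)
  qed
  have "wt k n ^ M * cmod (f n) \<le> (2 ^ M * (1 + (\<bar>real_of_int n\<bar> / 2 ^ k) ^ M)) * cmod (f n)"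
    by (intro mult_right_mono wt_power_le) auto
  also have "\<dots> = 2 ^ M * (cmod (f n) + (\<bar>real_of_int n\<bar> ^ M * cmod (f n)) / (2 ^ k) ^ M)"
    by (simp add: algebra_simps power_divide)
  also have "\<dots> \<le> 2 ^ M * (A 0 / 2 ^ k + (A M * (2 ^ k) ^ M / 2 ^ k) / (2 ^ k) ^ M)"
    using est[of 0] est[of M] by (intro mult_left_mono add_mono divide_right_mono) auto
  also have "\<dots> = 2 ^ M * (A 0 + A M) / 2 ^ k" by (simp add: field_simps)
  finally show "cmod (f n) \<le> 2 ^ M * (A 0 + A M) / 2 ^ k / wt k n ^ M" by (simp add: field_simps)
qed

section \<open>Smooth functions supported in [2,8] composed with a sine\<close>

text \<open>Functions with \<open>m\<close> continuous derivatives that vanish outside \<open>[2, 8]\<close>. The derivative is quantified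
  existentially, which makes inductions on \<open>m\<close> immediate.\<close>
fun smooth_supp :: "nat \<Rightarrow> (real \<Rightarrow> complex) \<Rightarrow> bool" where
  "smooth_supp 0 f \<longleftrightarrow> continuous_on UNIV f \<and> (\<forall>x. x \<notin> {2..8} \<longrightarrow> f x = 0)"
| "smooth_supp (Suc m) f \<longleftrightarrow> (\<forall>x. x \<notin> {2..8} \<longrightarrow> f x = 0) \<and>
    (\<exists>f'. (\<forall>x. (f has_vector_derivative f' x) (at x)) \<and> smooth_supp m f')"

lemma smooth_supp_zero: "smooth_supp m f \<Longrightarrow> x \<notin> {2..8} \<Longrightarrow> f x = 0"
  by (cases m) auto

lemma smooth_supp_continuous: "smooth_supp m f \<Longrightarrow> continuous_on UNIV f"
  by (cases m) (auto intro!: continuous_at_imp_continuous_on intro: has_vector_derivative_continuous)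

lemma smooth_supp_Suc: "smooth_supp (Suc m) f \<Longrightarrow> smooth_supp m f"
proof (induction m arbitrary: f)
  case 0
  then show ?case using smooth_supp_continuous[of "Suc 0" f] by auto
next
  case (Suc m)
  then obtain f' where "\<forall>x. x \<notin> {2..8} \<longrightarrow> f x = 0" "\<forall>x. (f has_vector_derivative f' x) (at x)" "smooth_supp (Suc m) f'"
    by (auto simp del: smooth_supp.simps simp: smooth_supp.simps(2)[of "Suc m"])
  then show ?case using Suc.IH[of f'] by auto
qed

lemma smooth_supp_diff:
  "smooth_supp m f \<Longrightarrow> smooth_supp m g \<Longrightarrow> smooth_supp m (\<lambda>x. f x - c * g x)"
proof (induction m arbitrary: f g)
  case 0
  then show ?case by (auto intro!: continuous_intros)
next
  case (Suc m)
  then obtain f' g' where "\<forall>x. (f has_vector_derivative f' x) (at x)" "smooth_supp m f'"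
    "\<forall>x. (g has_vector_derivative g' x) (at x)" "smooth_supp m g'"
    by auto
  moreover have "((\<lambda>x. f x - c * g x) has_vector_derivative (f' x - c * g' x)) (at x)" for x
    using calculation by (intro has_vector_derivative_diff has_vector_derivative_mult_right) auto
  ultimately show ?case using Suc by (auto intro!: exI[of _ "\<lambda>x. f' x - c * g' x"])
qed

lemma smooth_supp_divide_power:
  "smooth_supp m f \<Longrightarrow> smooth_supp m (\<lambda>x. f x / of_real x ^ a)"
proof (induction m arbitrary: f a)
  case 0
  have "continuous_on UNIV (\<lambda>x. f x / of_real x ^ a)"
  proof -
    have "continuous_on ({1<..} \<union> {..<2}) (\<lambda>x. f x / of_real x ^ a)"
    proof (rule continuous_on_open_Un)
      show "continuous_on {1<..} (\<lambda>x. f x / of_real x ^ a)"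
        using 0 by (intro continuous_intros) (auto intro: continuous_on_subset)
      have "continuous_on {..<2::real} (\<lambda>x. 0 :: complex)" by simp
      then show "continuous_on {..<2} (\<lambda>x. f x / of_real x ^ a)"
        by (rule continuous_on_eq) (use 0 in auto)
    qed auto
    moreover have "{1<..} \<union> {..<2} = (UNIV :: real set)" by auto
    ultimately show ?thesis by simp
  qed
  then show ?case using 0 by auto
next
  case (Suc m)
  then obtain f' where f': "\<And>x. (f has_vector_derivative f' x) (at x)" "smooth_supp m f'" by auto
  have z: "\<And>x. x \<notin> {2..8} \<Longrightarrow> f x = 0" using Suc by auto
  define g where "g x = f' x / of_real x ^ a - of_nat a * (f x / of_real x ^ Suc a)" for x
  have "smooth_supp m g" unfolding g_def
    by (intro smooth_supp_diff Suc.IH f' smooth_supp_Suc[OF Suc.prems])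
  moreover have "((\<lambda>x. f x / of_real x ^ a) has_vector_derivative g x) (at x)" for x
  proof (cases "x < 2")
    case True
    have "((\<lambda>x. 0) has_vector_derivative 0) (at x)" by (rule has_vector_derivative_const)
    then have "((\<lambda>x. f x / of_real x ^ a) has_vector_derivative 0) (at x)"
      by (rule has_vector_derivative_transform_within_open[of _ _ _ "{..<2}"]) (use True z in auto)
    moreover have "g x = 0" using True z[of x] smooth_supp_zero[OF f'(2), of x] by (simp add: g_def)
    ultimately show ?thesis by simp
  next
    case False
    have "((\<lambda>x. f x * of_real (1 / x ^ a)) has_vector_derivative f x * of_real (- real a / x ^ Suc a) + f' x * of_real (1 / x ^ a)) (at x)"
    proof (intro has_vector_derivative_mult f' has_vector_derivative_of_real)
      have "((\<lambda>x. inverse (x ^ a)) has_real_derivative - (inverse (x ^ a) * (real a * x ^ (a - Suc 0)) * inverse (x ^ a))) (at x)"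
        using False by (intro DERIV_inverse' DERIV_pow) simp
      moreover have "- (inverse (x ^ a) * (real a * x ^ (a - Suc 0)) * inverse (x ^ a)) = - real a / x ^ Suc a"
        using False by (cases a) (simp_all add: field_simps)
      ultimately show "((\<lambda>x. 1 / x ^ a) has_real_derivative (- real a / x ^ Suc a)) (at x)"
        by (simp only: inverse_eq_divide)
    qed
    moreover have "f x * of_real (- real a / x ^ Suc a) + f' x * of_real (1 / x ^ a) = g x"
      by (simp add: g_def)
    ultimately show ?thesis by (simp add: divide_inverse)
  qed
  ultimately show ?case using z by auto
qed

lemma smooth_supp_schwartz:
  assumes "\<psi> \<in> real_schwartz" "\<And>x. x \<notin> {2..8} \<Longrightarrow> \<psi> x = 0"
  shows "smooth_supp m (iter_deriv j \<psi>)"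
proof (induction m arbitrary: j)
  case 0
  have d: "iter_deriv j \<psi> differentiable (at x)" for x using assms by (auto simp: real_schwartz_def)
  have "iter_deriv j \<psi> x = 0" if "x \<notin> {2..8}" for x
    by (rule iter_deriv_zero_open[of "- {2..8}"]) (use that assms in auto)
  then show ?case using d by (auto intro!: continuous_at_imp_continuous_on differentiable_imp_continuous_within)
next
  case (Suc m)
  have d: "iter_deriv j \<psi> differentiable (at x)" for x using assms by (auto simp: real_schwartz_def)
  then have "(iter_deriv j \<psi> has_vector_derivative iter_deriv (Suc j) \<psi> x) (at x)" for x
    by (simp add: vector_derivative_works[symmetric])
  then have "\<exists>f'. (\<forall>x. (iter_deriv j \<psi> has_vector_derivative f' x) (at x)) \<and> smooth_supp m f'"
    using Suc[of "Suc j"] by blast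
  then show ?case using smooth_supp_zero[OF Suc[of j]] by auto
qed

lemma half_le_sin:
  assumes "0 \<le> y" "y \<le> pi / 2"
  shows "y / 2 \<le> sin y"
proof (cases "y \<le> pi / 3")
  case True
  show ?thesis
  proof (cases "y = 0")
    case False
    then have "\<exists>z. 0 < z \<and> z < y \<and> sin y - sin 0 = (y - 0) * cos z"
      using assms by (intro MVT2) (auto intro!: derivative_eq_intros)
    then obtain z where z: "0 < z" "z < y" "sin y = y * cos z" by auto
    have "cos (pi / 3) \<le> cos z" using z True by (intro cos_monotone_0_pi_le) auto
    then have "y * (1/2) \<le> y * cos z" using assms by (intro mult_left_mono) (auto simp: cos_60)
    then show ?thesis using z by simp
  qed simp
next
  case False
  have "sin (pi / 3) \<le> sin y" using False assms by (intro sin_monotone_2pi_le) auto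
  moreover have "1.6 \<le> sqrt 3" by (rule real_le_rsqrt) (simp add: power2_eq_square)
  ultimately show ?thesis using assms pi_less_4 pi_approx by (simp add: sin_60)
qed

text \<open>On \<open>[0, 2\<pi>]\<close> the function \<open>2 sin (\<theta> / 2)\<close> is nonnegative and smooth. The frequency \<open>x\<close> is real, since
  integration by parts shifts it by \<open>\<pm>1/2\<close>.\<close>
definition sine_int :: "nat \<Rightarrow> (real \<Rightarrow> complex) \<Rightarrow> real \<Rightarrow> complex" where
  "sine_int k \<Psi> x = integral {0..2*pi} (\<lambda>\<theta>. \<Psi> (2 ^ k * (2 * sin (\<theta> / 2))) * exp (- \<i> * of_real x * of_real \<theta>))"

lemma sine_integrand_continuous:
  assumes "continuous_on UNIV \<Psi>"
  shows "continuous_on A (\<lambda>\<theta>. \<Psi> (2 ^ k * (2 * sin (\<theta> / 2))) * exp (- \<i> * of_real x * of_real \<theta>))"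
  by (intro continuous_intros continuous_on_compose2[OF assms]) auto

text \<open>The integrand vanishes except near the end points, on a set of measure \<open>O(2\<^sup>-\<^sup>k)\<close>.\<close>
lemma sine_int_base:
  assumes "smooth_supp 0 \<Psi>"
  shows "\<exists>C\<ge>0. \<forall>k x. cmod (sine_int k \<Psi> x) \<le> C / 2 ^ k"
proof -
  have "compact (\<Psi> ` {2..8})" using assms by (intro compact_continuous_image) (auto intro: continuous_on_subset)
  then have "bounded (\<Psi> ` {2..8})" by (rule compact_imp_bounded)
  then obtain B where "\<And>z. z \<in> \<Psi> ` {2..8} \<Longrightarrow> cmod z \<le> B" unfolding bounded_iff by blast
  then have B: "\<And>y. y \<in> {2..8} \<Longrightarrow> cmod (\<Psi> y) \<le> B" by simp
  have B0: "0 \<le> B" using B[of 2] by (simp, meson norm_ge_zero order_trans)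
  have B': "cmod (\<Psi> y) \<le> B" for y using B[of y] assms B0 by (cases "y \<in> {2..8}") auto
  have "cmod (sine_int k \<Psi> x) \<le> B * 32 / 2 ^ k" for k x
  proof -
    define d :: real where "d = 16 / 2 ^ k"
    define b where "b \<theta> = B * (indicator {0..d} \<theta> + indicator {2*pi-d..2*pi} \<theta>)" for \<theta> :: real
    have d: "d \<ge> 0" by (simp add: d_def)
    have ind: "(indicator {u..v} has_integral (v - u)) {0..2*pi}" if "u \<le> v" "0 \<le> u" "v \<le> 2*pi" for u v :: real
    proof -
      have "((\<lambda>x. 1::real) has_integral (v - u)) {u..v}" using has_integral_const_real[of "1::real" u v] that by simp
      moreover have "{u..v} \<subseteq> {0..2*pi}" using that by auto
      ultimately have "((\<lambda>x. if x \<in> {u..v} then 1 else 0 :: real) has_integral (v - u)) {0..2*pi}"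
        using has_integral_restrict[of "{u..v}" "{0..2*pi}" "\<lambda>x. 1::real"] by blast
      then show ?thesis by (simp add: indicator_def[abs_def] of_bool_def)
    qed
    show ?thesis
    proof (cases "d \<le> 2 * pi")
      case True
      have hb: "(b has_integral B * (d + d)) {0..2*pi}"
        unfolding b_def using ind[of 0 d] ind[of "2*pi-d" "2*pi"] d True
        by (intro has_integral_mult_right has_integral_add) auto
      have "cmod (sine_int k \<Psi> x) \<le> integral {0..2*pi} b"
        unfolding sine_int_def
      proof (rule integral_norm_bound_integral)
        show "(\<lambda>\<theta>. \<Psi> (2 ^ k * (2 * sin (\<theta> / 2))) * exp (- \<i> * of_real x * of_real \<theta>)) integrable_on {0..2*pi}"
          using assms by (intro integrable_continuous_interval sine_integrand_continuous) auto
        show "b integrable_on {0..2*pi}" using hb by blast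
        fix \<theta> :: real assume \<theta>: "\<theta> \<in> {0..2*pi}"
        have e: "cmod (exp (- \<i> * of_real x * of_real \<theta>)) = 1" unfolding norm_exp_eq_Re by simp
        show "cmod (\<Psi> (2 ^ k * (2 * sin (\<theta> / 2))) * exp (- \<i> * of_real x * of_real \<theta>)) \<le> b \<theta>"
        proof (cases "2 ^ k * (2 * sin (\<theta> / 2)) \<in> {2..8}")
          case True
          then have "sin (\<theta> / 2) \<le> 4 / 2 ^ k" by (simp add: field_simps)
          then have s: "4 * sin (\<theta> / 2) \<le> d" by (simp add: d_def)
          have "\<theta> \<in> {0..d} \<or> \<theta> \<in> {2*pi-d..2*pi}"
          proof (cases "\<theta> \<le> pi")
            case True
            then have "\<theta> / 4 \<le> sin (\<theta> / 2)" using half_le_sin[of "\<theta>/2"] \<theta> by simp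
            then show ?thesis using s \<theta> by auto
          next
            case False
            have "sin (\<theta> / 2) = sin ((2 * pi - \<theta>) / 2)" using sin_pi_minus[of "\<theta>/2"] by (simp add: diff_divide_distrib)
            then have "(2 * pi - \<theta>) / 4 \<le> sin (\<theta> / 2)" using half_le_sin[of "(2 * pi - \<theta>)/2"] \<theta> False by simp
            then show ?thesis using s \<theta> by auto
          qed
          then have "B * 1 \<le> b \<theta>" unfolding b_def using B0 by (intro mult_left_mono) auto
          then show ?thesis unfolding norm_mult e using B'[of "2 ^ k * (2 * sin (\<theta> / 2))"] by simp
        next
          case False
          then have "\<Psi> (2 ^ k * (2 * sin (\<theta> / 2))) = 0" using assms by auto
          then show ?thesis using B0 by (simp add: b_def)
        qed
      qed
      also have "\<dots> = B * (d + d)" using hb by (rule integral_unique)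
      finally show ?thesis by (simp add: d_def)
    next
      case False
      have "cmod (sine_int k \<Psi> x) \<le> integral {0..2*pi} (\<lambda>_. B)"
        unfolding sine_int_def
      proof (rule integral_norm_bound_integral)
        show "(\<lambda>\<theta>. \<Psi> (2 ^ k * (2 * sin (\<theta> / 2))) * exp (- \<i> * of_real x * of_real \<theta>)) integrable_on {0..2*pi}"
          using assms by (intro integrable_continuous_interval sine_integrand_continuous) auto
        fix \<theta> :: real
        have e: "cmod (exp (- \<i> * of_real x * of_real \<theta>)) = 1" unfolding norm_exp_eq_Re by simp
        show "cmod (\<Psi> (2 ^ k * (2 * sin (\<theta> / 2))) * exp (- \<i> * of_real x * of_real \<theta>)) \<le> B"
          unfolding norm_mult e using B' by simp
      qed auto
      also have "\<dots> = B * (2 * pi)" by simp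
      also have "\<dots> \<le> B * (d + d)" using False d B0 by (intro mult_left_mono) auto
      finally show ?thesis by (simp add: d_def)
    qed
  qed
  then show ?thesis using B0 by (intro exI[of _ "B * 32"]) auto
qed

text \<open>Integration by parts; the factor \<open>cos (\<theta> / 2)\<close> of the inner derivative is split into exponentials.\<close>
lemma sine_int_parts:
  assumes d: "\<And>y. (\<Psi> has_vector_derivative \<Psi>' y) (at y)" and c: "continuous_on UNIV \<Psi>" "continuous_on UNIV \<Psi>'" and z: "\<Psi> 0 = 0"
  shows "\<i> * of_real x * sine_int k \<Psi> x = 2 ^ k / 2 * (sine_int k \<Psi>' (x - 1/2) + sine_int k \<Psi>' (x + 1/2))"
proof -
  define E where "E x \<theta> = exp (- \<i> * of_real x * of_real \<theta>)" for x \<theta> :: real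
  define s where "s \<theta> = 2 ^ k * (2 * sin (\<theta> / 2))" for \<theta> :: real
  have ds: "(s has_vector_derivative 2 ^ k * cos (\<theta> / 2)) (at \<theta>)" for \<theta>
    unfolding s_def has_real_derivative_iff_has_vector_derivative[symmetric]
    by (auto intro!: derivative_eq_intros)
  have dE: "(E x has_vector_derivative - \<i> * of_real x * E x \<theta>) (at \<theta>)" for \<theta>
    unfolding E_def[abs_def]
    by (rule has_vector_derivative_real_field[where f = "\<lambda>z. exp (- \<i> * of_real x * z)"]) (auto intro!: derivative_eq_intros)
  have dh: "((\<lambda>\<theta>. \<Psi> (s \<theta>) * E x \<theta>) has_vector_derivative
     \<Psi> (s \<theta>) * (- \<i> * of_real x * E x \<theta>) + ((2 ^ k * cos (\<theta> / 2)) *\<^sub>R \<Psi>' (s \<theta>)) * E x \<theta>) (at \<theta>)" for \<theta>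
    using vector_diff_chain_at[OF ds d] dE by (intro has_vector_derivative_mult) (auto simp: o_def)
  have I: "((\<lambda>\<theta>. \<Psi> (s \<theta>) * (- \<i> * of_real x * E x \<theta>) + ((2 ^ k * cos (\<theta> / 2)) *\<^sub>R \<Psi>' (s \<theta>)) * E x \<theta>) has_integral
      \<Psi> (s (2*pi)) * E x (2*pi) - \<Psi> (s 0) * E x 0) {0..2*pi}"
    by (rule fundamental_theorem_of_calculus) (simp, rule has_vector_derivative_at_within[OF dh])
  have bd: "\<Psi> (s (2*pi)) * E x (2*pi) - \<Psi> (s 0) * E x 0 = 0" by (simp add: s_def z)
  have i1: "((\<lambda>\<theta>. \<Psi> (s \<theta>) * E x \<theta>) has_integral sine_int k \<Psi> x) {0..2*pi}" if "continuous_on UNIV \<Psi>" for x and \<Psi>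
    unfolding sine_int_def s_def E_def using that
    by (intro integrable_integral integrable_continuous_interval sine_integrand_continuous)
  have "((\<lambda>\<theta>. (- \<i> * of_real x) * (\<Psi> (s \<theta>) * E x \<theta>) + 2 ^ k / 2 * (\<Psi>' (s \<theta>) * E (x - 1/2) \<theta> + \<Psi>' (s \<theta>) * E (x + 1/2) \<theta>)) has_integral
      (- \<i> * of_real x) * sine_int k \<Psi> x + 2 ^ k / 2 * (sine_int k \<Psi>' (x - 1/2) + sine_int k \<Psi>' (x + 1/2))) {0..2*pi}"
    by (intro has_integral_add has_integral_mult_right i1 c)
  moreover have "(\<lambda>\<theta>. (- \<i> * of_real x) * (\<Psi> (s \<theta>) * E x \<theta>) + 2 ^ k / 2 * (\<Psi>' (s \<theta>) * E (x - 1/2) \<theta> + \<Psi>' (s \<theta>) * E (x + 1/2) \<theta>)) =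
     (\<lambda>\<theta>. \<Psi> (s \<theta>) * (- \<i> * of_real x * E x \<theta>) + ((2 ^ k * cos (\<theta> / 2)) *\<^sub>R \<Psi>' (s \<theta>)) * E x \<theta>)"
  proof
    fix \<theta>
    define a where "a = exp (\<i> * of_real (\<theta> / 2))"
    define b where "b = exp (- (\<i> * of_real (\<theta> / 2)))"
    have E: "E (x - 1/2) \<theta> = a * E x \<theta>" "E (x + 1/2) \<theta> = b * E x \<theta>"
      unfolding E_def a_def b_def exp_add[symmetric]
      by (rule arg_cong[where f = exp], simp add: algebra_simps)+
    have "of_real (cos (\<theta> / 2)) = (a + b) / 2"
      unfolding cos_of_real[symmetric] cos_exp_eq a_def b_def ..
    then have c: "(2 ^ k * cos (\<theta> / 2)) *\<^sub>R \<Psi>' (s \<theta>) = 2 ^ k * ((a + b) / 2) * \<Psi>' (s \<theta>)"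
      by (simp only: scaleR_conv_of_real of_real_mult of_real_power of_real_numeral)
    show "(- \<i> * of_real x) * (\<Psi> (s \<theta>) * E x \<theta>) + 2 ^ k / 2 * (\<Psi>' (s \<theta>) * E (x - 1/2) \<theta> + \<Psi>' (s \<theta>) * E (x + 1/2) \<theta>) =
      \<Psi> (s \<theta>) * (- \<i> * of_real x * E x \<theta>) + ((2 ^ k * cos (\<theta> / 2)) *\<^sub>R \<Psi>' (s \<theta>)) * E x \<theta>"
      unfolding E c by (simp add: field_simps)
  qed
  ultimately have "((\<lambda>\<theta>. \<Psi> (s \<theta>) * (- \<i> * of_real x * E x \<theta>) + ((2 ^ k * cos (\<theta> / 2)) *\<^sub>R \<Psi>' (s \<theta>)) * E x \<theta>) has_integral
      (- \<i> * of_real x) * sine_int k \<Psi> x + 2 ^ k / 2 * (sine_int k \<Psi>' (x - 1/2) + sine_int k \<Psi>' (x + 1/2))) {0..2*pi}"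
    by (simp only:)
  from has_integral_unique[OF this I] have "(- \<i> * of_real x) * sine_int k \<Psi> x + 2 ^ k / 2 * (sine_int k \<Psi>' (x - 1/2) + sine_int k \<Psi>' (x + 1/2)) = 0"
    unfolding bd .
  then show ?thesis by (simp add: add_eq_0_iff2)
qed

lemma sine_int_bound:
  assumes "smooth_supp m \<Psi>"
  shows "\<exists>C\<ge>0. \<forall>k x. cmod (sine_int k \<Psi> x) \<le> C / 2 ^ k / (1 + \<bar>x\<bar> / 2 ^ k) ^ m"
  using assms
proof (induction m arbitrary: \<Psi>)
  case 0
  then show ?case using sine_int_base[of \<Psi>] by simp
next
  case (Suc m)
  obtain \<Psi>' where \<Psi>': "\<And>y. (\<Psi> has_vector_derivative \<Psi>' y) (at y)" "smooth_supp m \<Psi>'" using Suc.prems by auto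
  obtain C where C: "C \<ge> 0" "\<And>k x. cmod (sine_int k \<Psi> x) \<le> C / 2 ^ k / (1 + \<bar>x\<bar> / 2 ^ k) ^ m"
    using Suc.IH[OF smooth_supp_Suc[OF Suc.prems]] by blast
  obtain D where D: "D \<ge> 0" "\<And>k x. cmod (sine_int k \<Psi>' x) \<le> D / 2 ^ k / (1 + \<bar>x\<bar> / 2 ^ k) ^ m"
    using Suc.IH[OF \<Psi>'(2)] by blast
  have "cmod (sine_int k \<Psi> x) \<le> (C + 2 ^ m * D) / 2 ^ k / (1 + \<bar>x\<bar> / 2 ^ k) ^ Suc m" for k x
  proof -
    define W where "W x = 1 + \<bar>x\<bar> / 2 ^ k" for x :: real
    have W: "W x > 0" for x by (simp add: W_def add_pos_nonneg)
    have sh: "cmod (sine_int k \<Psi>' y) \<le> 2 ^ m * D / 2 ^ k / W x ^ m" if "\<bar>x - y\<bar> \<le> 1 / 2" for y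
    proof -
      have "\<bar>x\<bar> \<le> \<bar>y\<bar> + 1/2" using that by linarith
      then have "\<bar>x\<bar> / 2 ^ k \<le> (\<bar>y\<bar> + 1/2) / 2 ^ k" by (rule divide_right_mono) simp
      also have "\<dots> = \<bar>y\<bar> / 2 ^ k + 1 / 2 / 2 ^ k" by (rule add_divide_distrib)
      also have "1 / 2 / (2::real) ^ k \<le> 1"
      proof -
        have "1 \<le> (2::real) ^ k" by simp
        then have "1 \<le> 2 * (2::real) ^ k" by linarith
        then show ?thesis by (simp add: divide_le_eq)
      qed
      finally have le: "\<bar>x\<bar> / 2 ^ k \<le> \<bar>y\<bar> / 2 ^ k + 1" by simp
      have aux: "1 + u \<le> 2 * (1 + v)" if "u \<le> v + 1" "0 \<le> v" for u v :: real
        using that by (simp add: distrib_left)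
      have "W x \<le> 2 * W y" unfolding W_def by (rule aux[OF le]) simp
      then have "W x ^ m \<le> (2 * W y) ^ m" using W[of x] by (intro power_mono) auto
      then have "1 / W y ^ m \<le> 2 ^ m / W x ^ m" using W[of x] W[of y] by (simp add: field_simps power_mult_distrib)
      then have "(D / 2 ^ k) * (1 / W y ^ m) \<le> (D / 2 ^ k) * (2 ^ m / W x ^ m)" using D by (intro mult_left_mono) auto
      then show ?thesis using D(2)[of k y] by (simp add: W_def mult_ac)
    qed
    have z: "\<Psi> 0 = 0" using smooth_supp_zero[OF Suc.prems, of 0] by simp
    have "\<bar>x\<bar> * cmod (sine_int k \<Psi> x) = cmod (\<i> * of_real x * sine_int k \<Psi> x)" by (simp add: norm_mult)
    also have "\<dots> = 2 ^ k / 2 * cmod (sine_int k \<Psi>' (x - 1/2) + sine_int k \<Psi>' (x + 1/2))"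
      unfolding sine_int_parts[OF \<Psi>'(1) smooth_supp_continuous[OF Suc.prems] smooth_supp_continuous[OF \<Psi>'(2)] z]
      by (simp add: norm_mult norm_divide norm_power)
    also have "\<dots> \<le> 2 ^ k / 2 * (2 ^ m * D / 2 ^ k / W x ^ m + 2 ^ m * D / 2 ^ k / W x ^ m)"
      by (intro mult_left_mono order_trans[OF norm_triangle_ineq] add_mono sh) auto
    also have "\<dots> = 2 ^ m * D / W x ^ m" by simp
    finally have x: "\<bar>x\<bar> * cmod (sine_int k \<Psi> x) \<le> 2 ^ m * D / W x ^ m" .
    have "W x * cmod (sine_int k \<Psi> x) = cmod (sine_int k \<Psi> x) + (\<bar>x\<bar> * cmod (sine_int k \<Psi> x)) / 2 ^ k"
      by (simp add: W_def algebra_simps)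
    also have "\<dots> \<le> C / 2 ^ k / W x ^ m + (2 ^ m * D / W x ^ m) / 2 ^ k"
      using C(2)[of k x] by (intro add_mono divide_right_mono x) (auto simp: W_def)
    also have "\<dots> = (C + 2 ^ m * D) / 2 ^ k / W x ^ m" by (simp add: add_divide_distrib mult_ac)
    finally have "cmod (sine_int k \<Psi> x) \<le> (C + 2 ^ m * D) / 2 ^ k / W x ^ m / W x"
      using W[of x] by (subst pos_le_divide_eq) (auto simp: mult.commute)
    then show ?thesis by (simp add: W_def mult_ac)
  qed
  then show ?case using C D by (intro exI[of _ "C + 2 ^ m * D"]) auto
qed

section \<open>Functions of the square root of the discrete Laplacian\<close>

text \<open>The symbol of the square root of the discrete Laplacian.\<close>
definition symb :: "real \<Rightarrow> real" where
  "symb \<theta> = sqrt (2 * (1 - cos \<theta>))"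

lemma symb_sq: "symb \<theta> ^ 2 = 2 - 2 * cos \<theta>"
  by (simp add: symb_def algebra_simps)

lemma symb_eq_sin: "symb \<theta> = 2 * \<bar>sin (\<theta> / 2)\<bar>"
proof -
  have "cos \<theta> = 1 - 2 * sin (\<theta> / 2) ^ 2" using cos_double_sin[of "\<theta> / 2"] by simp
  then have "symb \<theta> = sqrt ((2 * sin (\<theta> / 2)) ^ 2)" by (simp add: symb_def power_mult_distrib)
  then show ?thesis by (simp only: real_sqrt_abs abs_mult abs_numeral)
qed

lemma symb_bounds:
  assumes "\<bar>\<theta>\<bar> \<le> pi"
  shows "\<bar>\<theta>\<bar> / 2 \<le> symb \<theta>" "symb \<theta> \<le> \<bar>\<theta>\<bar>"
proof -
  define t where "t = \<bar>\<theta>\<bar> / 2"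
  have t: "0 \<le> t" "t \<le> pi / 2" using assms by (auto simp: t_def)
  have "0 \<le> sin t" using t by (intro sin_ge_zero) auto
  moreover have "\<theta> / 2 = t \<or> \<theta> / 2 = - t" by (auto simp: t_def)
  ultimately have "\<bar>sin (\<theta> / 2)\<bar> = sin t" by auto
  then have "symb \<theta> = 2 * sin t" by (simp only: symb_eq_sin)
  then show "\<bar>\<theta>\<bar> / 2 \<le> symb \<theta>" "symb \<theta> \<le> \<bar>\<theta>\<bar>"
    using half_le_sin[OF t] sin_x_le_x[OF t(1)] by (simp_all add: t_def)
qed

lemma continuous_symb: "continuous_on A symb"
  unfolding symb_def[abs_def] by (intro continuous_intros)

text \<open>The symbol of \<open>\<Psi> (2\<^sup>k \<surd>\<Delta>)\<close>.\<close>
definition dsymb :: "(real \<Rightarrow> complex) \<Rightarrow> nat \<Rightarrow> real \<Rightarrow> complex" where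
  "dsymb \<Psi> k \<theta> = \<Psi> (2 ^ k * symb \<theta>)"

lemma continuous_dsymb: "continuous_on UNIV \<Psi> \<Longrightarrow> continuous_on A (dsymb \<Psi> k)"
  unfolding dsymb_def[abs_def]
  by (rule continuous_on_compose2[of UNIV \<Psi>]) (auto intro: continuous_intros continuous_symb)

lemma coef_dsymb:
  assumes "continuous_on UNIV \<Psi>"
  shows "coef (dsymb \<Psi> k) n = 1 / (2 * of_real pi) * sine_int k \<Psi> (of_int n)"
proof -
  define g where "g \<theta> = dsymb \<Psi> k \<theta> * exp (- \<i> * of_int n * of_real \<theta>)" for \<theta>
  have cont: "continuous_on A g" for A unfolding g_def by (intro continuous_intros continuous_dsymb assms)
  \<comment> \<open>By periodicity the interval [-pi, 0] can be replaced by [pi, 2 pi], which removes the absolute value.\<close>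
  have per: "g (2 * pi + \<theta>) = g \<theta>" for \<theta>
  proof -
    have "exp (- \<i> * of_int n * of_real (2 * pi + \<theta>)) = exp (- \<i> * of_int n * of_real \<theta>)"
      unfolding exp_eq by (rule exI[of _ "- n"]) (simp add: algebra_simps)
    moreover have "symb (2 * pi + \<theta>) = symb \<theta>" by (simp add: symb_def add.commute)
    ultimately show ?thesis unfolding g_def dsymb_def by (simp only:)
  qed
  have "(LBINT \<theta>:{-pi..pi}. g \<theta>) = integral {-pi..pi} g"
    by (rule set_borel_integral_eq_integral) (auto simp: set_integrable_def intro!: borel_integrable_compact cont)
  also have "\<dots> = integral {-pi..0} g + integral {0..pi} g"
    by (rule Henstock_Kurzweil_Integration.integral_combine[symmetric]) (auto intro!: integrable_continuous_interval cont)
  also have "integral {-pi..0} g = integral {-pi..0} (g \<circ> (+) (2 * pi))"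
    by (simp add: per o_def)
  also have "\<dots> = integral {pi..2*pi} g" unfolding integral_shift_Icc_real by simp
  also have "integral {pi..2*pi} g + integral {0..pi} g = integral {0..2*pi} g"
    by (subst add.commute, rule Henstock_Kurzweil_Integration.integral_combine) (auto intro!: integrable_continuous_interval cont)
  also have "\<dots> = sine_int k \<Psi> (of_int n)" unfolding sine_int_def
  proof (rule integral_cong)
    fix \<theta> :: real assume "\<theta> \<in> {0..2*pi}"
    then have "0 \<le> sin (\<theta> / 2)" by (intro sin_ge_zero) auto
    then show "g \<theta> = \<Psi> (2 ^ k * (2 * sin (\<theta> / 2))) * exp (- \<i> * of_real (of_int n) * of_real \<theta>)"
      by (simp add: g_def dsymb_def symb_eq_sin)
  qed
  finally show ?thesis by (simp add: coef_def g_def)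
qed

lemma scaled_dsymb:
  assumes "\<And>m. smooth_supp m \<Psi>"
  shows "\<exists>C. \<forall>k. scaled k M C (coef (dsymb \<Psi> k))"
proof -
  obtain C where C: "C \<ge> 0" "\<And>k x. cmod (sine_int k \<Psi> x) \<le> C / 2 ^ k / (1 + \<bar>x\<bar> / 2 ^ k) ^ M"
    using sine_int_bound[OF assms, of M] by blast
  have "scaled k M C (coef (dsymb \<Psi> k))" for k
    unfolding scaled_def
  proof
    fix n
    have "cmod (coef (dsymb \<Psi> k) n) = 1 / (2 * pi) * cmod (sine_int k \<Psi> (of_int n))"
      unfolding coef_dsymb[OF smooth_supp_continuous[OF assms[of 0]]] by (simp add: norm_mult norm_divide)
    also have "\<dots> \<le> 1 * cmod (sine_int k \<Psi> (of_int n))" using pi_gt3 by (intro mult_right_mono) auto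
    also have "\<dots> \<le> C / 2 ^ k / wt k n ^ M" using C(2)[of k "of_int n"] by (simp add: wt_def)
    finally show "cmod (coef (dsymb \<Psi> k) n) \<le> C / 2 ^ k / wt k n ^ M" .
  qed
  then show ?thesis by blast
qed

lemma coef_integrable:
  fixes G :: "real \<Rightarrow> complex"
  assumes "continuous_on {-pi..pi} G"
  shows "set_integrable lborel {-pi..pi} (\<lambda>\<theta>. G \<theta> * exp (- \<i> * of_int n * of_real \<theta>))"
  unfolding set_integrable_def by (rule borel_integrable_compact) (auto intro!: continuous_intros assms)

lemma coef_sum:
  assumes "finite D" "\<And>d. d \<in> D \<Longrightarrow> continuous_on {-pi..pi} (G d)"
  shows "coef (\<lambda>\<theta>. \<Sum>d\<in>D. G d \<theta>) n = (\<Sum>d\<in>D. coef (G d) n)"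
proof -
  have "(LBINT \<theta>:{-pi..pi}. (\<Sum>d\<in>D. G d \<theta>) * exp (- \<i> * of_int n * of_real \<theta>)) =
      (\<Sum>d\<in>D. LBINT \<theta>:{-pi..pi}. G d \<theta> * exp (- \<i> * of_int n * of_real \<theta>))"
    using assms coef_integrable[of "G _" n]
    unfolding set_lebesgue_integral_def set_integrable_def sum_distrib_right scaleR_sum_right
    by (intro Bochner_Integration.integral_sum) auto
  then show ?thesis by (simp add: coef_def sum_distrib_left)
qed

lemma coef_cong:
  assumes "\<And>\<theta>. \<theta> \<in> {-pi..pi} \<Longrightarrow> F \<theta> = G \<theta>"
  shows "coef F = coef G"
proof
  fix n
  have "(LBINT \<theta>:{-pi..pi}. F \<theta> * exp (- \<i> * of_int n * of_real \<theta>)) = (LBINT \<theta>:{-pi..pi}. G \<theta> * exp (- \<i> * of_int n * of_real \<theta>))"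
    by (rule set_lebesgue_integral_cong) (use assms in auto)
  then show "coef F n = coef G n" by (simp add: coef_def)
qed

lemma lap_coef:
  assumes "continuous_on {-pi..pi} G"
  shows "lap (coef G) n = coef (\<lambda>\<theta>. of_real (symb \<theta> ^ 2) * G \<theta>) n"
proof -
  let ?e = "\<lambda>n \<theta>. exp (- \<i> * of_int n * of_real \<theta>)"
  note int = coef_integrable[OF assms]
  have "(LBINT \<theta>:{-pi..pi}. of_real (symb \<theta> ^ 2) * G \<theta> * ?e n \<theta>) =
     (LBINT \<theta>:{-pi..pi}. 2 * (G \<theta> * ?e n \<theta>) - (G \<theta> * ?e (n + 1) \<theta>) - (G \<theta> * ?e (n - 1) \<theta>))"
  proof (rule set_lebesgue_integral_cong)
    have "of_real (symb \<theta> ^ 2) * ?e n \<theta> = 2 * ?e n \<theta> - ?e (n + 1) \<theta> - ?e (n - 1) \<theta>" for \<theta>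
    proof -
      have "?e (n + 1) \<theta> = ?e n \<theta> * exp (- (\<i> * of_real \<theta>))" "?e (n - 1) \<theta> = ?e n \<theta> * exp (\<i> * of_real \<theta>)"
        unfolding exp_add[symmetric] by (rule arg_cong[where f = exp], simp add: algebra_simps)+
      moreover have "of_real (cos \<theta>) = (exp (\<i> * of_real \<theta>) + exp (- (\<i> * of_real \<theta>))) / 2"
        unfolding cos_of_real[symmetric] cos_exp_eq ..
      ultimately show ?thesis by (simp add: symb_sq algebra_simps)
    qed
    then have "of_real (symb \<theta> ^ 2) * G \<theta> * ?e n \<theta> = G \<theta> * (2 * ?e n \<theta> - ?e (n + 1) \<theta> - ?e (n - 1) \<theta>)" for \<theta>
      by (metis mult.assoc mult.left_commute)
    then show "\<forall>\<theta>. \<theta> \<in> {-pi..pi} \<longrightarrow> of_real (symb \<theta> ^ 2) * G \<theta> * ?e n \<theta> = 2 * (G \<theta> * ?e n \<theta>) - (G \<theta> * ?e (n + 1) \<theta>) - (G \<theta> * ?e (n - 1) \<theta>)"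
      by (simp add: algebra_simps)
  qed simp
  also have "\<dots> = 2 * (LBINT \<theta>:{-pi..pi}. G \<theta> * ?e n \<theta>) - (LBINT \<theta>:{-pi..pi}. G \<theta> * ?e (n + 1) \<theta>) - (LBINT \<theta>:{-pi..pi}. G \<theta> * ?e (n - 1) \<theta>)"
    using int[of n] int[of "n + 1"] int[of "n - 1"] by (simp add: set_integral_diff set_integrable_mult_right del: of_int_add of_int_diff)
  finally have *: "coef (\<lambda>\<theta>. of_real (symb \<theta> ^ 2) * G \<theta>) n = 1 / (2 * of_real pi) *
     (2 * (LBINT \<theta>:{-pi..pi}. G \<theta> * ?e n \<theta>) - (LBINT \<theta>:{-pi..pi}. G \<theta> * ?e (n + 1) \<theta>) - (LBINT \<theta>:{-pi..pi}. G \<theta> * ?e (n - 1) \<theta>))"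
    unfolding coef_def by (rule arg_cong)
  have "- (c * x) + 2 * (c * y) - c * z = c * (2 * y - x - z)" for c x y z :: complex
    by (simp add: algebra_simps)
  then show ?thesis unfolding * unfolding coef_def lap_def .
qed

lemma lap_reflect: "lap (\<lambda>m. f (n - m)) = (\<lambda>m. lap f (n - m))"
proof
  fix m :: int
  have "n - (m + 1) = n - m - 1" "n - (m - 1) = n - m + 1" by auto
  then show "lap (\<lambda>m. f (n - m)) m = lap f (n - m)" by (simp only: lap_def)  simp
qed

lemma lap_pow_reflect: "(lap ^^ l) (\<lambda>m. f (n - m)) = (\<lambda>m. (lap ^^ l) f (n - m))"
  by (induction l) (simp_all add: lap_reflect)

lemma rapid_reflect:
  assumes "rapid f"
  shows "rapid (\<lambda>m. f (n - m))"
  unfolding rapid_def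
proof
  fix M
  obtain C where C: "C \<ge> 0" "\<And>n. cmod (f n) \<le> C / wt 0 n ^ M" using rapid_bound[OF assms] by meson
  have "scaled 0 M (C * wt 0 n ^ M) (\<lambda>m. f (n - m))" unfolding scaled_def
  proof
    fix m
    have "wt 0 m ^ M \<le> (wt 0 n * wt 0 (n - m)) ^ M"
      using wt_mult[of 0 n "m - n"] by (intro power_mono) (auto simp: wt_commute)
    then have "1 / wt 0 (n - m) ^ M \<le> wt 0 n ^ M / wt 0 m ^ M" by (simp add: field_simps power_mult_distrib)
    then have "C * (1 / wt 0 (n - m) ^ M) \<le> C * (wt 0 n ^ M / wt 0 m ^ M)" using C by (intro mult_left_mono) auto
    then show "cmod (f (n - m)) \<le> C * wt 0 n ^ M / 2 ^ 0 / wt 0 m ^ M" using C(2)[of "n - m"] by simp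
  qed
  then show "\<exists>C. scaled 0 M C (\<lambda>m. f (n - m))" by blast
qed

lemma rapid_coef_dsymb: "(\<And>m. smooth_supp m \<Psi>) \<Longrightarrow> rapid (coef (dsymb \<Psi> k))"
  by (rule rapidI_scaled[of k]) (meson scaled_dsymb)

text \<open>Division by powers of the Laplacian divides \<open>\<psi>\<close> by even powers of its argument, which preserves the
  smoothness and the support because the latter stays away from 0.\<close>
lemma coef_dsymb_schwartz_inf:
  assumes s: "\<And>m. smooth_supp m \<psi>"
  shows "(\<lambda>m. coef (dsymb \<psi> k) (n - m)) \<in> schwartz_inf"
proof -
  \<comment> \<open>The factor compensates the dilation by 2 ^ k, so that each step of the Laplacian is exact.\<close>
  define \<Psi> where "\<Psi> l y = of_real ((2 ^ k) ^ (2 * l)) * (\<psi> y / of_real y ^ (2 * l))" for l :: nat and y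
  have \<Psi>: "smooth_supp m (\<Psi> l)" for m l
  proof -
    have "smooth_supp m (\<lambda>y. 0 - (- of_real ((2 ^ k) ^ (2 * l))) * (\<psi> y / of_real y ^ (2 * l)))"
    proof (rule smooth_supp_diff)
      show "smooth_supp m (\<lambda>y. 0)"
        by (induction m) (auto intro!: exI[of _ "\<lambda>y. 0"])
    qed (intro smooth_supp_divide_power s)
    then show ?thesis by (simp add: \<Psi>_def[abs_def])
  qed
  have step: "lap (coef (dsymb (\<Psi> (Suc l)) k)) = coef (dsymb (\<Psi> l) k)" for l
  proof
    fix n
    have "lap (coef (dsymb (\<Psi> (Suc l)) k)) n = coef (\<lambda>\<theta>. of_real (symb \<theta> ^ 2) * dsymb (\<Psi> (Suc l)) k \<theta>) n"
      by (rule lap_coef) (intro continuous_dsymb smooth_supp_continuous[OF \<Psi>[of 0]])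
    also have "(\<lambda>\<theta>. of_real (symb \<theta> ^ 2) * dsymb (\<Psi> (Suc l)) k \<theta>) = dsymb (\<Psi> l) k"
    proof
      fix \<theta>
      have "\<psi> 0 = 0" using smooth_supp_zero[OF s[of 0], of 0] by simp
      then show "of_real (symb \<theta> ^ 2) * dsymb (\<Psi> (Suc l)) k \<theta> = dsymb (\<Psi> l) k \<theta>"
        by (cases "symb \<theta> = 0") (simp_all add: dsymb_def \<Psi>_def power_mult_distrib power2_eq_square)
    qed
    finally show "lap (coef (dsymb (\<Psi> (Suc l)) k)) n = coef (dsymb (\<Psi> l) k) n" .
  qed
  have pow: "(lap ^^ l) (coef (dsymb (\<Psi> l) k)) = coef (dsymb \<psi> k)" for l
  proof (induction l)
    case (Suc l)
    then show ?case by (simp only: funpow_Suc_right o_apply step)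
  qed (simp add: \<Psi>_def)
  have "(\<lambda>m. coef (dsymb \<psi> k) (n - m)) = (lap ^^ l) (\<lambda>m. coef (dsymb (\<Psi> l) k) (n - m))" for l
    unfolding lap_pow_reflect pow ..
  moreover have "(\<lambda>m. coef (dsymb (\<Psi> l) k) (n - m)) \<in> schwartz" for l
    unfolding schwartz_iff_rapid by (intro rapid_reflect rapid_coef_dsymb \<Psi>)
  moreover have "(\<lambda>m. coef (dsymb \<psi> k) (n - m)) \<in> schwartz"
    unfolding schwartz_iff_rapid by (intro rapid_reflect rapid_coef_dsymb s)
  ultimately show ?thesis unfolding schwartz_inf_def by blast
qed

lemma dyadic_op_eq_conv:
  assumes s: "\<And>m. smooth_supp m \<psi>" and U: "U \<in> dist_mod_poly" and j: "j \<le> 0"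
  shows "dyadic_op \<psi> j U n = conv (coef (dsymb \<psi> (nat (- j)))) (dist_fun (dist_rep U)) n"
proof -
  have p: "(2::real) powi (- j) = 2 ^ nat (- j)" using j by (simp add: power_int_def)
  have K: "sqrt_lap_kernel (\<lambda>x. \<psi> (2 powi (- j) * x)) n = (\<lambda>m. coef (dsymb \<psi> (nat (- j))) (n - m))"
    unfolding sqrt_lap_kernel_def coef_def dsymb_def symb_def p by simp
  have u: "dist_rep U \<in> schwartz_dual" by (rule dist_rep_dual[OF U])
  have "dyadic_op \<psi> j U n = dist_rep U (\<lambda>m. coef (dsymb \<psi> (nat (- j))) (n - m))"
    unfolding sqrt_lap_op_def K dual_inf_of_def using coef_dsymb_schwartz_inf[OF s] by simp
  also have "\<dots> = conv (coef (dsymb \<psi> (nat (- j)))) (dist_fun (dist_rep U)) n"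
    unfolding conv_def
    by (rule infsumI[symmetric], rule schwartz_dual_has_sum[OF u], intro rapid_reflect rapid_coef_dsymb s)
  finally show ?thesis .
qed

section \<open>Reproducing formulas\<close>

lemma conv_commute: "conv f g n = conv g f n"
  unfolding conv_def
  by (rule infsum_reindex_bij_witness[of _ "\<lambda>m. n - m" "\<lambda>m. n - m"]) (auto simp: mult.commute)

lemma conv_commute_fun: "conv f g = conv g f"
  by (rule ext) (rule conv_commute)

lemma conv_sum_right:
  assumes "finite D" "\<And>d. d \<in> D \<Longrightarrow> tempered (f d)" "rapid g"
  shows "conv g (\<lambda>m. \<Sum>d\<in>D. f d m) n = (\<Sum>d\<in>D. conv g (f d) n)"
proof -
  have "((\<lambda>m. \<Sum>d\<in>D. g (n - m) * f d m) has_sum (\<Sum>d\<in>D. conv g (f d) n)) UNIV"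
    using assms(1,2)
  proof (induction D)
    case (insert d D)
    have "((\<lambda>m. g (n - m) * f d m) has_sum conv g (f d) n) UNIV"
      unfolding conv_def using insert assms(3) by (intro has_sum_infsum conv_summable) auto
    from has_sum_add[OF this insert.IH] show ?case using insert by simp
  qed simp
  then show ?thesis by (simp add: conv_def sum_distrib_left infsumI)
qed

lemma scaled_sum:
  assumes "finite D" "\<And>d. d \<in> D \<Longrightarrow> scaled k M C (f d)"
  shows "scaled k M (real (card D) * C) (\<lambda>n. \<Sum>d\<in>D. f d n)"
  unfolding scaled_def
proof
  fix n
  have "cmod (\<Sum>d\<in>D. f d n) \<le> (\<Sum>d\<in>D. C / 2 ^ k / wt k n ^ M)"
    using assms by (intro sum_norm_le) (auto simp: scaled_def)
  then show "cmod (\<Sum>d\<in>D. f d n) \<le> real (card D) * C / 2 ^ k / wt k n ^ M" by simp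
qed

text \<open>The sequence whose Fourier series is the complex conjugate.\<close>
definition refl_cnj :: "(int \<Rightarrow> complex) \<Rightarrow> int \<Rightarrow> complex" where
  "refl_cnj f n = cnj (f (- n))"

lemma scaled_refl_cnj: "scaled k M C f \<Longrightarrow> scaled k M C (refl_cnj f)"
  unfolding scaled_def refl_cnj_def by (metis complex_mod_cnj wt_minus)

lemma rapid_refl_cnj: "rapid f \<Longrightarrow> rapid (refl_cnj f)"
  unfolding rapid_def using scaled_refl_cnj by blast

lemma fourierZ_refl_cnj: "fourierZ (refl_cnj f) \<theta> = cnj (fourierZ f \<theta>)"
proof -
  have "cnj (fourierZ f \<theta>) = (\<Sum>\<^sub>\<infinity>n. cnj (f n * exp (\<i> * of_int n * of_real \<theta>)))"
    unfolding fourierZ_def by (rule infsum_cnj[symmetric])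
  also have "\<dots> = (\<Sum>\<^sub>\<infinity>n. refl_cnj f n * exp (\<i> * of_int n * of_real \<theta>))"
    by (rule infsum_reindex_bij_witness[of _ uminus uminus]) (auto simp: refl_cnj_def exp_cnj)
  finally show ?thesis by (simp add: fourierZ_def)
qed

lemma powi_neg_nonpos: "j \<le> 0 \<Longrightarrow> (2::real) powi (- j) = 2 ^ nat (- j)"
  by (simp add: power_int_def)

lemma powi_nonpos:
  assumes "\<nu> \<le> 0"
  shows "(2::real) powi \<nu> = 1 / 2 ^ nat (- \<nu>)"
proof -
  have "(2::real) powi \<nu> = inverse (2 powi (- \<nu>))" by (simp only: power_int_minus inverse_inverse_eq)
  then show ?thesis unfolding powi_neg_nonpos[OF assms] by (simp only: inverse_eq_divide)
qed

lemma admissible_rapid: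
  assumes "admissible_pair \<phi> \<eta>" "\<nu> \<le> 0"
  shows "rapid (\<phi> \<nu>)" "rapid (\<eta> \<nu>)"
  using assms by (auto simp: admissible_pair_def schwartz_iff_rapid)

lemma admissible_supp:
  assumes "admissible_pair \<phi> \<eta>" "\<nu> \<le> 0" "f \<in> {\<phi> \<nu>, \<eta> \<nu>}" "x \<in> {-pi..pi}" "fourierZ f x \<noteq> 0"
  shows "2 powi (\<nu> - 2) * pi < \<bar>x\<bar>" "\<bar>x\<bar> \<le> 2 powi \<nu> * pi"
proof -
  have "fourier_supp f \<subseteq> {- (2 powi \<nu> * pi)..2 powi \<nu> * pi} - {- (2 powi (\<nu> - 2) * pi)..2 powi (\<nu> - 2) * pi}"
    using assms unfolding admissible_pair_def by blast
  moreover have "x \<in> fourier_supp f" unfolding fourier_supp_def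
    using assms by (intro subsetD[OF closure_subset]) auto
  ultimately have "x \<in> {- (2 powi \<nu> * pi)..2 powi \<nu> * pi}" "x \<notin> {- (2 powi (\<nu> - 2) * pi)..2 powi (\<nu> - 2) * pi}" by auto
  then show "2 powi (\<nu> - 2) * pi < \<bar>x\<bar>" "\<bar>x\<bar> \<le> 2 powi \<nu> * pi" unfolding atLeastAtMost_iff by linarith+
qed

lemma admissible_scaled:
  assumes a: "admissible_pair \<phi> \<eta>"
  shows "\<exists>C. \<forall>\<nu>\<le>0. scaled (nat (- \<nu>)) M C (\<phi> \<nu>) \<and> scaled (nat (- \<nu>)) M C (\<eta> \<nu>)"
proof -
  obtain Ak where Ak: "\<And>\<nu> f x k. \<nu> \<le> 0 \<Longrightarrow> f \<in> {\<phi> \<nu>, \<eta> \<nu>} \<Longrightarrow> x \<in> {-pi..pi} \<Longrightarrow>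
      cmod (iter_deriv k (fourierZ f) x) \<le> Ak k * 2 powi (- (int k * \<nu>))"
    using a unfolding admissible_pair_def by blast
  have "scaled (nat (- \<nu>)) M (2 ^ M * (Ak 0 + Ak M)) f" if \<nu>: "\<nu> \<le> 0" and f: "f \<in> {\<phi> \<nu>, \<eta> \<nu>}" for \<nu> f
  proof (rule scaled_of_fourier)
    show "rapid f" using admissible_rapid[OF a \<nu>] f by auto
    show "\<bar>x\<bar> \<le> pi / 2 ^ nat (- \<nu>)" if "x \<in> {-pi..pi}" "fourierZ f x \<noteq> 0" for x
      using admissible_supp(2)[OF a \<nu> f that] \<nu> by (simp add: powi_nonpos)
    show "cmod (iter_deriv j (fourierZ f) x) \<le> Ak j * (2 ^ nat (- \<nu>)) ^ j" if "x \<in> {-pi..pi}" for x j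
    proof -
      have "(2::real) powi (- (int j * \<nu>)) = 2 powi ((- \<nu>) * int j)" by (simp add: mult.commute)
      also have "\<dots> = (2 powi (- \<nu>)) powi int j" by (rule power_int_mult)
      also have "\<dots> = (2 ^ nat (- \<nu>)) ^ j" unfolding powi_neg_nonpos[OF \<nu>] by (rule power_int_of_nat)
      finally show ?thesis using Ak[OF \<nu> f that, of j] by simp
    qed
  qed
  then show ?thesis by blast
qed

text \<open>The symbol is comparable with \<open>|x|\<close>; hence only boundedly many of the functions of one family
  meet the support of a given function of the other.\<close>
lemma dyadic_window:
  assumes x: "\<bar>x\<bar> \<le> pi" and a: "2 powi (\<nu> - 2) * pi < \<bar>x\<bar>" "\<bar>x\<bar> \<le> 2 powi \<nu> * pi"
    and s: "2 \<le> 2 powi (- j) * symb x" "2 powi (- j) * symb x \<le> 8"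
  shows "j \<in> {\<nu> - 4..\<nu> + 4}"
proof -
  define A where "A = (2::real) powi j"
  define B where "B = (2::real) powi \<nu>"
  have AB: "A > 0" "B > 0" by (simp_all add: A_def B_def)
  have j: "2 * A \<le> symb x" "symb x \<le> 8 * A" using s AB by (simp_all add: A_def power_int_minus field_simps)
  have e: "2 powi (\<nu> - 2) = B / 4" by (simp add: B_def power_int_diff)
  have n: "B / 4 * pi < \<bar>x\<bar>" "\<bar>x\<bar> \<le> B * pi" using a unfolding e B_def[symmetric] by auto
  have "2 * A < B * 4"
  proof -
    have "B * pi < B * 4" using pi_less_4 AB by simp
    then show ?thesis using j n symb_bounds[OF x] by linarith
  qed
  then have "A < 2 powi (\<nu> + 1)" by (simp add: B_def power_int_add)
  then have 1: "j < \<nu> + 1" unfolding A_def by (metis linorder_not_le power_int_increasing one_le_numeral)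
  have "B / 4 < 8 * A"
  proof -
    have "B / 4 * 2 < B / 4 * pi" using pi_gt3 AB by simp
    then show ?thesis using j n symb_bounds[OF x] by linarith
  qed
  then have "B < 2 powi (j + 5)" by (simp add: A_def power_int_add)
  then have "\<nu> < j + 5" unfolding B_def by (metis linorder_not_le power_int_increasing one_le_numeral)
  then show ?thesis using 1 by simp
qed

lemma pou_smooth:
  assumes "partition_of_unity \<psi>"
  shows "smooth_supp m \<psi>"
proof -
  have "\<psi> x = 0" if "x \<notin> {2..8}" for x
    using assms that closure_subset[of "{\<xi>. \<psi> \<xi> \<noteq> 0}"] unfolding partition_of_unity_def by blast
  then show ?thesis using smooth_supp_schwartz[of \<psi> m 0] assms by (simp add: partition_of_unity_def)
qed

lemma pou_at_2:
  assumes "partition_of_unity \<psi>"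
  shows "\<psi> 2 = 0"
proof -
  have "closed {x. \<psi> x = 0}"
    using smooth_supp_continuous[OF pou_smooth[OF assms, of 0]] by (intro closed_Collect_eq) auto
  moreover have "{..<2} \<subseteq> {x. \<psi> x = 0}" using smooth_supp_zero[OF pou_smooth[OF assms, of 0]] by auto
  ultimately have "closure {..<2} \<subseteq> {x. \<psi> x = 0}" by (rule closure_minimal[rotated])
  then show ?thesis by (auto simp: closure_lessThan)
qed

lemma pou_nonzero:
  assumes "partition_of_unity \<psi>" "\<psi> y \<noteq> 0"
  shows "2 < y" "y \<le> 8"
  using smooth_supp_zero[OF pou_smooth[OF assms(1), of 0], of y] pou_at_2[OF assms(1)] assms(2)
  by (cases "y = 2"; force)+

lemma pou_sum:
  assumes p: "partition_of_unity \<psi>" and s: "0 < s" "s \<le> 2" and M: "finite M" "M \<subseteq> {..-1}"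
    and out: "\<And>j. j < 0 \<Longrightarrow> j \<notin> M \<Longrightarrow> \<psi> (2 powi (- j) * s) = 0"
  shows "(\<Sum>j\<in>M. \<psi> (2 powi (- j) * s)) = 1"
proof -
  \<comment> \<open>For nonnegative j the argument is at most 2, where the function vanishes, too.\<close>
  have z: "\<psi> (2 powi (- j) * s) = 0" if "j \<notin> M" for j
  proof (cases "j < 0")
    case False
    have "(2::real) powi (- j) \<le> 1" using False power_int_increasing[of "- j" 0 "2::real"] by simp
    then have "2 powi (- j) * s \<le> 1 * 2" using s by (intro mult_mono) auto
    then show ?thesis using pou_nonzero(1)[OF p, of "2 powi (- j) * s"] by force
  qed (use out that in auto)
  have "((\<lambda>j::int. \<psi> (2 powi (- j) * s)) has_sum 1) UNIV" using p s by (simp add: partition_of_unity_def)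
  moreover have "((\<lambda>j::int. \<psi> (2 powi (- j) * s)) has_sum (\<Sum>j\<in>M. \<psi> (2 powi (- j) * s))) UNIV"
    by (rule has_sum_finite_neutralI[OF M(1)]) (use z in auto)
  ultimately show ?thesis by (rule has_sum_unique[symmetric])
qed

text \<open>The convolution kernel of \<open>\<psi>\<^sub>j(\<surd>\<Delta>)\<close>, for \<open>j \<le> 0\<close>.\<close>
definition dker :: "(real \<Rightarrow> complex) \<Rightarrow> int \<Rightarrow> int \<Rightarrow> complex" where
  "dker \<psi> j = coef (dsymb \<psi> (nat (- j)))"

text \<open>Indices of the operators of a scale near \<open>2\<^sup>j\<close>. The radius 8 is twice the overlap radius 4 of the two
  families, as a reproducing kernel for \<open>dker \<psi> j\<close> is found by passing through the other family.\<close>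
definition nearby :: "int \<Rightarrow> int set" where
  "nearby j = {j-8..j+8} \<inter> {..-1}"

lemma finite_nearby [simp]: "finite (nearby j)"
  by (simp add: nearby_def)

text \<open>A reproducing kernel at scale \<open>2\<^sup>j\<close>, the sum of the kernels of nearby index.\<close>
definition dker_sum :: "(real \<Rightarrow> complex) \<Rightarrow> int \<Rightarrow> int \<Rightarrow> complex" where
  "dker_sum \<psi> j n = (\<Sum>i\<in>nearby j. dker \<psi> i n)"

lemma symb_le_2: "symb \<theta> \<le> 2"
  by (simp add: symb_eq_sin abs_sin_le_one)

lemma rapid_dker: "partition_of_unity \<psi> \<Longrightarrow> rapid (dker \<psi> j)"
  unfolding dker_def by (intro rapid_coef_dsymb pou_smooth)

lemma rapid_dker_sum: "partition_of_unity \<psi> \<Longrightarrow> rapid (dker_sum \<psi> j)"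
  unfolding dker_sum_def[abs_def] by (intro rapid_sum rapid_dker) auto

lemma pou_continuous_dsymb: "partition_of_unity \<psi> \<Longrightarrow> continuous_on A (dsymb \<psi> k)"
  by (intro continuous_dsymb smooth_supp_continuous[OF pou_smooth[of \<psi> 0]])

lemma dker_sum_reproduces_admissible:
  assumes a: "admissible_pair \<phi> \<eta>" and p: "partition_of_unity \<psi>" and \<nu>: "\<nu> \<le> 0" and j: "\<bar>\<nu> - j\<bar> \<le> 4"
  shows "conv (dker_sum \<psi> j) (\<phi> \<nu>) = \<phi> \<nu>"
proof
  fix n
  have f: "rapid (\<phi> \<nu>)" using admissible_rapid[OF a \<nu>] by simp
  have "conv (dker_sum \<psi> j) (\<phi> \<nu>) n = (\<Sum>i\<in>nearby j. conv (dker \<psi> i) (\<phi> \<nu>) n)"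
    unfolding dker_sum_def[abs_def] by (intro conv_sum_left rapid_dker p rapid_tempered f) auto
  also have "\<dots> = (\<Sum>i\<in>nearby j. coef (\<lambda>\<theta>. dsymb \<psi> (nat (- i)) \<theta> * fourierZ (\<phi> \<nu>) \<theta>) n)"
    unfolding dker_def by (intro sum.cong refl conv_coef pou_continuous_dsymb p f)
  also have "\<dots> = coef (\<lambda>\<theta>. \<Sum>i\<in>nearby j. dsymb \<psi> (nat (- i)) \<theta> * fourierZ (\<phi> \<nu>) \<theta>) n"
    by (intro coef_sum[symmetric] continuous_intros pou_continuous_dsymb p continuous_fourierZ f) auto
  also have "coef (\<lambda>\<theta>. \<Sum>i\<in>nearby j. dsymb \<psi> (nat (- i)) \<theta> * fourierZ (\<phi> \<nu>) \<theta>) = coef (fourierZ (\<phi> \<nu>))"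
  proof (rule coef_cong)
    fix \<theta> assume \<theta>: "\<theta> \<in> {-pi..pi}"
    show "(\<Sum>i\<in>nearby j. dsymb \<psi> (nat (- i)) \<theta> * fourierZ (\<phi> \<nu>) \<theta>) = fourierZ (\<phi> \<nu>) \<theta>"
    proof (cases "fourierZ (\<phi> \<nu>) \<theta> = 0")
      case False
      have b: "2 powi (\<nu> - 2) * pi < \<bar>\<theta>\<bar>" "\<bar>\<theta>\<bar> \<le> 2 powi \<nu> * pi" "\<bar>\<theta>\<bar> \<le> pi"
        using admissible_supp[OF a \<nu> _ \<theta> False] \<theta> by auto
      have "0 < \<bar>\<theta>\<bar>" using b(1) by (rule le_less_trans[rotated]) simp
      then have s0: "0 < symb \<theta>" using symb_bounds(1)[OF b(3)] by simp
      have "(\<Sum>i\<in>nearby j. dsymb \<psi> (nat (- i)) \<theta>) = (\<Sum>i\<in>nearby j. \<psi> (2 powi (- i) * symb \<theta>))"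
        by (intro sum.cong refl) (simp add: dsymb_def nearby_def powi_neg_nonpos)
      also have "\<dots> = 1"
      proof (rule pou_sum[OF p s0 symb_le_2])
        fix i :: int assume i: "i < 0" "i \<notin> nearby j"
        show "\<psi> (2 powi (- i) * symb \<theta>) = 0"
        proof (rule ccontr)
          assume "\<psi> (2 powi (- i) * symb \<theta>) \<noteq> 0"
          then have "i \<in> {\<nu> - 4..\<nu> + 4}"
            using pou_nonzero[OF p] by (intro dyadic_window[OF b(3,1,2)]) (auto intro: less_imp_le)
          then show False using i j by (auto simp: nearby_def)
        qed
      qed (auto simp: nearby_def)
      finally show ?thesis by (simp add: sum_distrib_right[symmetric])
    qed simp
  qed
  also have "coef (fourierZ (\<phi> \<nu>)) n = \<phi> \<nu> n" by (rule coef_fourierZ[OF f])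
  finally show "conv (dker_sum \<psi> j) (\<phi> \<nu>) n = \<phi> \<nu> n" .
qed

text \<open>The complex conjugate of the Calderon condition on the pair \<open>(\<phi>, \<eta>)\<close> puts the conjugate on \<open>\<eta>\<close>, so that
  \<open>\<phi> \<nu>\<close> itself splits off.\<close>
lemma dker_decomposition:
  assumes a: "admissible_pair \<phi> \<eta>" and p: "partition_of_unity \<psi>" and j: "j < 0"
  shows "dker \<psi> j n = (\<Sum>\<nu>\<in>{..0} \<inter> {j-4..j+4}. conv (conv (dker \<psi> j) (refl_cnj (\<eta> \<nu>))) (\<phi> \<nu>) n)"
proof -
  let ?N = "{..0} \<inter> {j-4..j+4}"
  let ?G = "\<lambda>\<nu> \<theta>. dsymb \<psi> (nat (- j)) \<theta> * cnj (fourierZ (\<eta> \<nu>) \<theta>)"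
  have cG: "continuous_on {-pi..pi} (?G \<nu>)" if "\<nu> \<in> ?N" for \<nu>
    using admissible_rapid[OF a, of \<nu>] that by (intro continuous_intros pou_continuous_dsymb p continuous_fourierZ) auto
  have "(\<Sum>\<nu>\<in>?N. conv (conv (dker \<psi> j) (refl_cnj (\<eta> \<nu>))) (\<phi> \<nu>) n) = (\<Sum>\<nu>\<in>?N. coef (\<lambda>\<theta>. ?G \<nu> \<theta> * fourierZ (\<phi> \<nu>) \<theta>) n)"
  proof (rule sum.cong[OF refl])
    fix \<nu> assume \<nu>: "\<nu> \<in> ?N"
    have r: "rapid (\<phi> \<nu>)" "rapid (refl_cnj (\<eta> \<nu>))" using admissible_rapid[OF a, of \<nu>] \<nu> by (auto intro: rapid_refl_cnj)
    have "conv (dker \<psi> j) (refl_cnj (\<eta> \<nu>)) = coef (?G \<nu>)"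
    proof
      fix m show "conv (dker \<psi> j) (refl_cnj (\<eta> \<nu>)) m = coef (?G \<nu>) m"
        unfolding dker_def conv_coef[OF pou_continuous_dsymb[OF p] r(2)] fourierZ_refl_cnj ..
    qed
    then show "conv (conv (dker \<psi> j) (refl_cnj (\<eta> \<nu>))) (\<phi> \<nu>) n = coef (\<lambda>\<theta>. ?G \<nu> \<theta> * fourierZ (\<phi> \<nu>) \<theta>) n"
      by (simp only: conv_coef[OF cG[OF \<nu>] r(1)])
  qed
  also have "\<dots> = coef (\<lambda>\<theta>. \<Sum>\<nu>\<in>?N. ?G \<nu> \<theta> * fourierZ (\<phi> \<nu>) \<theta>) n"
  proof (rule coef_sum[symmetric])
    fix \<nu> assume \<nu>: "\<nu> \<in> ?N"
    then show "continuous_on {-pi..pi} (\<lambda>\<theta>. ?G \<nu> \<theta> * fourierZ (\<phi> \<nu>) \<theta>)"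
      using admissible_rapid[OF a, of \<nu>] by (intro continuous_on_mult cG continuous_fourierZ) auto
  qed simp
  also have "coef (\<lambda>\<theta>. \<Sum>\<nu>\<in>?N. ?G \<nu> \<theta> * fourierZ (\<phi> \<nu>) \<theta>) = coef (dsymb \<psi> (nat (- j)))"
  proof (rule coef_cong)
    fix \<theta> assume \<theta>: "\<theta> \<in> {-pi..pi}"
    show "(\<Sum>\<nu>\<in>?N. ?G \<nu> \<theta> * fourierZ (\<phi> \<nu>) \<theta>) = dsymb \<psi> (nat (- j)) \<theta>"
    proof (cases "dsymb \<psi> (nat (- j)) \<theta> = 0")
      case False
      then have nz: "\<psi> (2 powi (- j) * symb \<theta>) \<noteq> 0" using j by (simp add: dsymb_def powi_neg_nonpos)
      have "\<theta> \<noteq> 0"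
      proof
        assume "\<theta> = 0"
        then have "symb \<theta> = 0" by (simp add: symb_def)
        then show False using pou_nonzero(1)[OF p nz] by simp
      qed
      then have "((\<lambda>\<nu>. cnj (fourierZ (\<phi> \<nu>) \<theta>) * fourierZ (\<eta> \<nu>) \<theta>) has_sum 1) {..0}"
        using a \<theta> unfolding admissible_pair_def by blast
      moreover have "((\<lambda>\<nu>. cnj (fourierZ (\<phi> \<nu>) \<theta>) * fourierZ (\<eta> \<nu>) \<theta>) has_sum
         (\<Sum>\<nu>\<in>?N. cnj (fourierZ (\<phi> \<nu>) \<theta>) * fourierZ (\<eta> \<nu>) \<theta>)) {..0}"
      proof (rule has_sum_finite_neutralI)
        fix \<nu> assume \<nu>: "\<nu> \<in> {..0} - ?N"
        have "fourierZ (\<phi> \<nu>) \<theta> = 0"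
        proof (rule ccontr)
          assume f: "fourierZ (\<phi> \<nu>) \<theta> \<noteq> 0"
          have b: "2 powi (\<nu> - 2) * pi < \<bar>\<theta>\<bar>" "\<bar>\<theta>\<bar> \<le> 2 powi \<nu> * pi" "\<bar>\<theta>\<bar> \<le> pi"
            using admissible_supp[OF a _ _ \<theta> f] \<theta> \<nu> by auto
          have "j \<in> {\<nu> - 4..\<nu> + 4}"
            using pou_nonzero[OF p nz] by (intro dyadic_window[OF b(3,1,2)]) (auto intro: less_imp_le)
          then show False using \<nu> by auto
        qed
        then show "cnj (fourierZ (\<phi> \<nu>) \<theta>) * fourierZ (\<eta> \<nu>) \<theta> = 0" by simp
      qed auto
      ultimately have "(\<Sum>\<nu>\<in>?N. cnj (fourierZ (\<phi> \<nu>) \<theta>) * fourierZ (\<eta> \<nu>) \<theta>) = 1" by (rule has_sum_unique[symmetric])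
      then have "cnj (\<Sum>\<nu>\<in>?N. cnj (fourierZ (\<phi> \<nu>) \<theta>) * fourierZ (\<eta> \<nu>) \<theta>) = 1" by (simp only: complex_cnj_one)
      then have "(\<Sum>\<nu>\<in>?N. cnj (fourierZ (\<eta> \<nu>) \<theta>) * fourierZ (\<phi> \<nu>) \<theta>) = 1" by (simp add: mult.commute)
      then show ?thesis by (simp add: mult.assoc sum_distrib_left[symmetric])
    qed simp
  qed
  finally show ?thesis by (simp add: dker_def)
qed

lemma dker_sum_reproduces_dker:
  assumes a: "admissible_pair \<phi> \<eta>" and p: "partition_of_unity \<psi>" and j: "j < 0"
  shows "conv (dker_sum \<psi> j) (dker \<psi> j) = dker \<psi> j"
proof
  fix n
  let ?N = "{..0} \<inter> {j-4..j+4}"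
  define A where "A \<nu> = conv (dker \<psi> j) (refl_cnj (\<eta> \<nu>))" for \<nu>
  have r: "rapid (\<phi> \<nu>)" "rapid (A \<nu>)" if "\<nu> \<in> ?N" for \<nu>
    using admissible_rapid[OF a, of \<nu>] that unfolding A_def by (auto intro!: rapid_conv rapid_dker p rapid_refl_cnj)
  \<comment> \<open>Each summand contains a factor that is reproduced already.\<close>
  have dec: "dker \<psi> j = (\<lambda>n. \<Sum>\<nu>\<in>?N. conv (A \<nu>) (\<phi> \<nu>) n)"
    unfolding A_def using dker_decomposition[OF a p j] by blast
  have "conv (dker_sum \<psi> j) (dker \<psi> j) n = conv (dker_sum \<psi> j) (\<lambda>n. \<Sum>\<nu>\<in>?N. conv (A \<nu>) (\<phi> \<nu>) n) n"
    by (subst dec) simp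
  also have "\<dots> = (\<Sum>\<nu>\<in>?N. conv (dker_sum \<psi> j) (conv (A \<nu>) (\<phi> \<nu>)) n)"
    by (intro conv_sum_right rapid_tempered rapid_conv r rapid_dker_sum p) auto
  also have "\<dots> = (\<Sum>\<nu>\<in>?N. conv (A \<nu>) (\<phi> \<nu>) n)"
  proof (rule sum.cong[OF refl])
    fix \<nu> assume \<nu>: "\<nu> \<in> ?N"
    have "conv (dker_sum \<psi> j) (conv (A \<nu>) (\<phi> \<nu>)) n = conv (dker_sum \<psi> j) (conv (\<phi> \<nu>) (A \<nu>)) n"
      by (simp only: conv_commute_fun[of "A \<nu>"])
    also have "\<dots> = conv (conv (dker_sum \<psi> j) (\<phi> \<nu>)) (A \<nu>) n"
      by (intro conv_assoc[symmetric] rapid_dker_sum p r[OF \<nu>] rapid_tempered)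
    also have "conv (dker_sum \<psi> j) (\<phi> \<nu>) = \<phi> \<nu>" using \<nu> by (intro dker_sum_reproduces_admissible[OF a p]) auto
    finally show "conv (dker_sum \<psi> j) (conv (A \<nu>) (\<phi> \<nu>)) n = conv (A \<nu>) (\<phi> \<nu>) n"
      by (simp only: conv_commute)
  qed
  also have "\<dots> = dker \<psi> j n" by (subst dec) simp
  finally show "conv (dker_sum \<psi> j) (dker \<psi> j) n = dker \<psi> j n" .
qed

lemma dker_scaled:
  assumes p: "partition_of_unity \<psi>"
  shows "\<exists>C>0. (\<forall>j. scaled (nat (- j)) M C (dker \<psi> j)) \<and> (\<forall>j\<le>0. scaled (nat (- j)) M C (dker_sum \<psi> j))"
proof -
  obtain C where C: "\<And>k. scaled k M C (coef (dsymb \<psi> k))" using scaled_dsymb[of \<psi> M] pou_smooth[OF p] by blast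
  define D where "D = 2 ^ 8 * (2 ^ 8) ^ M * C"
  have C0: "C \<ge> 0" by (rule scaled_nonneg[OF C])
  have D0: "D \<ge> 0" using C0 by (simp add: D_def)
  have "scaled (nat (- j)) M (17 * D) (dker_sum \<psi> j)" if "j \<le> 0" for j
  proof -
    have "scaled (nat (- j)) M (real (card (nearby j)) * D) (dker_sum \<psi> j)"
      unfolding dker_sum_def[abs_def]
    proof (rule scaled_sum)
      fix i assume "i \<in> nearby j"
      then show "scaled (nat (- j)) M D (dker \<psi> i)"
        unfolding dker_def D_def using that by (intro scaled_change[OF C]) (auto simp: nearby_def)
    qed simp
    moreover have "card (nearby j) \<le> card {j-8..j+8}" by (intro card_mono) (auto simp: nearby_def)
    ultimately show ?thesis using D0 by (elim scaled_mono) (auto intro!: mult_right_mono)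
  qed
  then have "scaled (nat (- j)) M (C + 17 * D + 1) (dker_sum \<psi> j)" if "j \<le> 0" for j
    by (rule scaled_mono[where C = "17 * D" and M = M]) (use that C0 in auto)
  moreover have "scaled (nat (- j)) M (C + 17 * D + 1) (dker \<psi> j)" for j
    unfolding dker_def by (rule scaled_mono[OF C]) (use D0 in auto)
  ultimately show ?thesis using C0 D0 by (intro exI[of _ "C + 17 * D + 1"]) auto
qed

section \<open>Pointwise estimates between the two families\<close>

lemma dker_conv_le_avg:
  assumes a: "admissible_pair \<phi> \<eta>" and p: "partition_of_unity \<psi>" and r: "0 < r" "r \<le> 1"
  shows "\<exists>C\<ge>0. \<forall>u. tempered u \<longrightarrow> (\<forall>j<0. \<forall>n. ennreal (cmod (conv (dker \<psi> j) u n)) \<le>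
     ennreal C * (\<Sum>\<nu>\<in>{..0} \<inter> {j-8..j+8}. avg r (nat (- \<nu>)) (\<lambda>l. ennreal (cmod (conv (\<phi> \<nu>) u l))) n))"
proof -
  obtain m :: nat where "2 / r \<le> real m" using real_arch_simple by blast
  then have m: "2 \<le> real m * r" using r by (simp add: field_simps)
  obtain CK where CK: "CK > 0" "\<And>j. scaled (nat (- j)) (m + 4) CK (dker \<psi> j)" "\<And>j. j \<le> 0 \<Longrightarrow> scaled (nat (- j)) (m + 4) CK (dker_sum \<psi> j)"
    using dker_scaled[OF p] by blast
  obtain CA where CA: "\<And>\<nu>. \<nu> \<le> 0 \<Longrightarrow> scaled (nat (- \<nu>)) (m + 4) CA (\<eta> \<nu>)"
    using admissible_scaled[OF a] by blast
  define D where "D = 2 ^ 4 * (2 ^ 4) ^ (m + 4) * CK"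
  define E where "E = 24 * D * CA"
  define C where "C = 24 * E * CK powr (1/r)"
  have "CA \<ge> 0" using scaled_nonneg[OF CA[of 0]] by simp
  then have C0: "C \<ge> 0" using CK by (simp add: C_def D_def E_def)
  have "ennreal (cmod (conv (dker \<psi> j) u n)) \<le>
     ennreal C * (\<Sum>\<nu>\<in>{..0} \<inter> {j-8..j+8}. avg r (nat (- \<nu>)) (\<lambda>l. ennreal (cmod (conv (\<phi> \<nu>) u l))) n)"
    if u: "tempered u" and j: "j < 0" for u j n
  proof -
    let ?N = "{..0} \<inter> {j-4..j+4}"
    define A where "A \<nu> = conv (dker \<psi> j) (refl_cnj (\<eta> \<nu>))" for \<nu>
    have rap: "rapid (\<phi> \<nu>)" "rapid (A \<nu>)" if "\<nu> \<in> ?N" for \<nu>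
      using admissible_rapid[OF a, of \<nu>] that unfolding A_def by (auto intro!: rapid_conv rapid_dker p rapid_refl_cnj)
    have dec: "dker \<psi> j = (\<lambda>n. \<Sum>\<nu>\<in>?N. conv (A \<nu>) (\<phi> \<nu>) n)"
      unfolding A_def using dker_decomposition[OF a p j] by blast
    have "conv (dker \<psi> j) u n = conv (\<lambda>n. \<Sum>\<nu>\<in>?N. conv (A \<nu>) (\<phi> \<nu>) n) u n" by (subst dec) simp
    also have "\<dots> = (\<Sum>\<nu>\<in>?N. conv (conv (A \<nu>) (\<phi> \<nu>)) u n)"
      by (intro conv_sum_left rapid_conv rap u) auto
    also have "\<dots> = (\<Sum>\<nu>\<in>?N. conv (A \<nu>) (conv (\<phi> \<nu>) u) n)"
      by (intro sum.cong refl conv_assoc rap u)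
    finally have "cmod (conv (dker \<psi> j) u n) \<le> (\<Sum>\<nu>\<in>?N. cmod (conv (A \<nu>) (conv (\<phi> \<nu>) u) n))" by (simp add: norm_sum)
    then have "ennreal (cmod (conv (dker \<psi> j) u n)) \<le> (\<Sum>\<nu>\<in>?N. ennreal (cmod (conv (A \<nu>) (conv (\<phi> \<nu>) u) n)))"
      by (simp add: ennreal_leI)
    also have "\<dots> \<le> (\<Sum>\<nu>\<in>?N. ennreal C * avg r (nat (- \<nu>)) (\<lambda>l. ennreal (cmod (conv (\<phi> \<nu>) u l))) n)"
    proof (rule sum_mono)
      fix \<nu> assume \<nu>: "\<nu> \<in> ?N"
      show "ennreal (cmod (conv (A \<nu>) (conv (\<phi> \<nu>) u) n)) \<le> ennreal C * avg r (nat (- \<nu>)) (\<lambda>l. ennreal (cmod (conv (\<phi> \<nu>) u l))) n"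
        unfolding C_def
      proof (rule conv_le_avg[OF r m _ CK(1)])
        show "scaled (nat (- \<nu>)) m CK (dker_sum \<psi> \<nu>)" using CK(3)[of \<nu>] \<nu> by (auto elim!: scaled_mono)
        show "conv (\<phi> \<nu>) u l = conv (dker_sum \<psi> \<nu>) (conv (\<phi> \<nu>) u) l" for l
        proof -
          have "conv (dker_sum \<psi> \<nu>) (conv (\<phi> \<nu>) u) l = conv (conv (dker_sum \<psi> \<nu>) (\<phi> \<nu>)) u l"
            by (intro conv_assoc[symmetric] rapid_dker_sum p rap[OF \<nu>] u)
          also have "conv (dker_sum \<psi> \<nu>) (\<phi> \<nu>) = \<phi> \<nu>" using \<nu> by (intro dker_sum_reproduces_admissible[OF a p]) auto
          finally show ?thesis by simp
        qed
        have "scaled (nat (- \<nu>)) (m + 2 + 2) D (dker \<psi> j)"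
          using \<nu> unfolding D_def by (intro scaled_mono[OF scaled_change[OF CK(2), of _ _ 4]]) auto
        moreover have "scaled (nat (- \<nu>)) (m + 2 + 2) CA (refl_cnj (\<eta> \<nu>))"
          using scaled_refl_cnj[OF CA[of \<nu>]] \<nu> by (auto elim!: scaled_mono)
        ultimately show "scaled (nat (- \<nu>)) (m + 2) E (A \<nu>)" unfolding A_def E_def by (rule scaled_conv)
      qed
    qed
    also have "\<dots> \<le> (\<Sum>\<nu>\<in>{..0} \<inter> {j-8..j+8}. ennreal C * avg r (nat (- \<nu>)) (\<lambda>l. ennreal (cmod (conv (\<phi> \<nu>) u l))) n)"
      by (intro sum_mono2) auto
    finally show ?thesis by (simp add: sum_distrib_left)
  qed
  then show ?thesis using C0 by blast
qed

lemma admissible_conv_le_avg: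
  assumes a: "admissible_pair \<phi> \<eta>" and p: "partition_of_unity \<psi>" and r: "0 < r" "r \<le> 1"
  shows "\<exists>C\<ge>0. \<forall>u. tempered u \<longrightarrow> (\<forall>\<nu>\<le>0. \<forall>n. ennreal (cmod (conv (\<phi> \<nu>) u n)) \<le>
     ennreal C * (\<Sum>j\<in>{j. j < 0} \<inter> {\<nu>-8..\<nu>+8}. avg r (nat (- j)) (\<lambda>l. ennreal (cmod (conv (dker \<psi> j) u l))) n))"
proof -
  obtain m :: nat where "2 / r \<le> real m" using real_arch_simple by blast
  then have m: "2 \<le> real m * r" using r by (simp add: field_simps)
  obtain CK where CK: "CK > 0" "\<And>j. scaled (nat (- j)) (m + 4) CK (dker \<psi> j)" "\<And>j. j \<le> 0 \<Longrightarrow> scaled (nat (- j)) (m + 4) CK (dker_sum \<psi> j)"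
    using dker_scaled[OF p] by blast
  obtain CA where CA: "\<And>\<nu>. \<nu> \<le> 0 \<Longrightarrow> scaled (nat (- \<nu>)) (m + 4) CA (\<phi> \<nu>)"
    using admissible_scaled[OF a] by blast
  define D where "D = 2 ^ 8 * (2 ^ 8) ^ (m + 4) * CA"
  define C where "C = 24 * D * CK powr (1/r)"
  have "CA \<ge> 0" using scaled_nonneg[OF CA[of 0]] by simp
  then have C0: "C \<ge> 0" using CK by (simp add: C_def D_def)
  have "ennreal (cmod (conv (\<phi> \<nu>) u n)) \<le>
     ennreal C * (\<Sum>j\<in>{j. j < 0} \<inter> {\<nu>-8..\<nu>+8}. avg r (nat (- j)) (\<lambda>l. ennreal (cmod (conv (dker \<psi> j) u l))) n)"
    if u: "tempered u" and \<nu>: "\<nu> \<le> 0" for u \<nu> n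
  proof -
    let ?N = "{j. j < 0} \<inter> {\<nu>-8..\<nu>+8}"
    have N: "?N = nearby \<nu>" by (auto simp: nearby_def)
    have f: "rapid (\<phi> \<nu>)" using admissible_rapid[OF a \<nu>] by simp
    have "conv (\<phi> \<nu>) u n = conv (conv (\<phi> \<nu>) (dker_sum \<psi> \<nu>)) u n"
      using dker_sum_reproduces_admissible[OF a p \<nu>, of \<nu>] by (simp add: conv_commute_fun[of "\<phi> \<nu>"])
    also have "\<dots> = conv (\<phi> \<nu>) (conv (dker_sum \<psi> \<nu>) u) n"
      by (intro conv_assoc f rapid_dker_sum p u)
    also have "conv (dker_sum \<psi> \<nu>) u = (\<lambda>l. \<Sum>j\<in>?N. conv (dker \<psi> j) u l)"
      unfolding N dker_sum_def[abs_def] by (intro ext conv_sum_left rapid_dker p u) auto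
    also have "conv (\<phi> \<nu>) (\<lambda>l. \<Sum>j\<in>?N. conv (dker \<psi> j) u l) n = (\<Sum>j\<in>?N. conv (\<phi> \<nu>) (conv (dker \<psi> j) u) n)"
      using N by (intro conv_sum_right tempered_conv rapid_dker p u f) auto
    finally have "cmod (conv (\<phi> \<nu>) u n) \<le> (\<Sum>j\<in>?N. cmod (conv (\<phi> \<nu>) (conv (dker \<psi> j) u) n))" by (simp add: norm_sum)
    then have "ennreal (cmod (conv (\<phi> \<nu>) u n)) \<le> (\<Sum>j\<in>?N. ennreal (cmod (conv (\<phi> \<nu>) (conv (dker \<psi> j) u) n)))"
      by (simp add: ennreal_leI)
    also have "\<dots> \<le> (\<Sum>j\<in>?N. ennreal C * avg r (nat (- j)) (\<lambda>l. ennreal (cmod (conv (dker \<psi> j) u l))) n)"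
    proof (rule sum_mono)
      fix j assume j: "j \<in> ?N"
      show "ennreal (cmod (conv (\<phi> \<nu>) (conv (dker \<psi> j) u) n)) \<le> ennreal C * avg r (nat (- j)) (\<lambda>l. ennreal (cmod (conv (dker \<psi> j) u l))) n"
        unfolding C_def
      proof (rule conv_le_avg[OF r m _ CK(1)])
        show "scaled (nat (- j)) m CK (dker_sum \<psi> j)" using CK(3)[of j] j by (auto elim!: scaled_mono)
        show "conv (dker \<psi> j) u l = conv (dker_sum \<psi> j) (conv (dker \<psi> j) u) l" for l
        proof -
          have "conv (dker_sum \<psi> j) (conv (dker \<psi> j) u) l = conv (conv (dker_sum \<psi> j) (dker \<psi> j)) u l"
            by (intro conv_assoc[symmetric] rapid_dker_sum rapid_dker p u)
          also have "conv (dker_sum \<psi> j) (dker \<psi> j) = dker \<psi> j" using j by (intro dker_sum_reproduces_dker[OF a p]) auto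
          finally show ?thesis by simp
        qed
        show "scaled (nat (- j)) (m + 2) D (\<phi> \<nu>)"
          using j \<nu> unfolding D_def by (intro scaled_mono[OF scaled_change[OF CA[OF \<nu>], of _ 8]]) auto
      qed
    qed
    finally show ?thesis by (simp add: sum_distrib_left)
  qed
  then show ?thesis using C0 by blast
qed

section \<open>Equivalence of the quasi-norms\<close>

lemma lpnorm_cong: "(\<And>i. i \<in> I \<Longrightarrow> f i = g i) \<Longrightarrow> lpnorm q I f = lpnorm q I g"
  unfolding lpnorm_def by (auto intro!: arg_cong2[where f = ennpow] nn_integral_cong SUP_cong)

text \<open>An exponent for the averages in the Peetre inequality.\<close>
lemma small_exponent:
  fixes p q :: ennreal
  assumes "0 < p" "0 < q"
  shows "\<exists>r>0. r \<le> 1 \<and> ennreal r < p \<and> ennreal r < q"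
proof -
  define m where "m = min 1 (min p q)"
  have "m \<le> 1" by (simp add: m_def)
  then have "m < top" using ennreal_one_less_top by (rule le_less_trans)
  then obtain c where c: "m = ennreal c" "0 \<le> c" by (cases m) auto
  have "0 < m" using assms by (simp add: m_def)
  then have "0 < c" using c by simp
  have "c \<le> 1" using \<open>m \<le> 1\<close> c by simp
  have "ennreal (c / 2) < m" using c \<open>0 < c\<close> by (auto intro: ennreal_lessI)
  then show ?thesis using \<open>0 < c\<close> \<open>c \<le> 1\<close> by (intro exI[of _ "c / 2"]) (auto simp: m_def)
qed

lemma equivalent_onI:
  assumes "0 \<le> C" "0 \<le> D" "\<And>U. U \<in> X \<Longrightarrow> N U \<le> ennreal C * M U" "\<And>U. U \<in> X \<Longrightarrow> M U \<le> ennreal D * N U"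
  shows "equivalent_on X N M"
  unfolding equivalent_on_def
proof (intro exI[of _ "C + D + 1"] conjI ballI)
  fix U assume U: "U \<in> X"
  have "ennreal C * M U \<le> ennreal (C + D + 1) * M U" "ennreal D * N U \<le> ennreal (C + D + 1) * N U"
    using assms by (auto intro!: mult_right_mono ennreal_leI)
  then show "N U \<le> ennreal (C + D + 1) * M U" "M U \<le> ennreal (C + D + 1) * N U"
    using assms(3,4)[OF U] by (auto intro: order_trans)
qed (use assms in simp)

lemma finite_norm_sets_eq:
  assumes "\<And>U. U \<in> X \<Longrightarrow> N U \<le> ennreal C * M U" "\<And>U. U \<in> X \<Longrightarrow> M U \<le> ennreal D * N U"
  shows "{U \<in> X. N U < \<infinity>} = {U \<in> X. M U < \<infinity>}"
proof -
  have "N U < \<infinity> \<longleftrightarrow> M U < \<infinity>" if "U \<in> X" for U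
  proof
    assume "N U < \<infinity>"
    then have "ennreal D * N U < \<infinity>" by (simp add: ennreal_mult_less_top)
    then show "M U < \<infinity>" using assms(2)[OF that] by (rule le_less_trans[rotated])
  next
    assume "M U < \<infinity>"
    then have "ennreal C * M U < \<infinity>" by (simp add: ennreal_mult_less_top)
    then show "N U < \<infinity>" using assms(1)[OF that] by (rule le_less_trans[rotated])
  qed
  then show ?thesis by blast
qed

theorem theorem4p18:
  fixes \<phi> \<eta> :: "int \<Rightarrow> int \<Rightarrow> complex" and \<psi> :: "real \<Rightarrow> complex"
    and \<alpha> :: real and p q :: ennreal
  assumes "admissible_pair \<phi> \<eta>" and "partition_of_unity \<psi>"
    and "0 < p" and "0 < q"
  shows "besov \<phi> \<alpha> p q = besov_lap \<psi> \<alpha> p q \<and>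
         equivalent_on (besov \<phi> \<alpha> p q) (besov_norm \<phi> \<alpha> p q) (besov_lap_norm \<psi> \<alpha> p q) \<and>
         (p < \<infinity> \<longrightarrow>
            triebel \<phi> \<alpha> p q = triebel_lap \<psi> \<alpha> p q \<and>
            equivalent_on (triebel \<phi> \<alpha> p q) (triebel_norm \<phi> \<alpha> p q) (triebel_lap_norm \<psi> \<alpha> p q))"
proof -
  note adm = assms(1) and pou = assms(2) and pq = assms(3,4)
  obtain r where r: "0 < r" "r \<le> 1" "ennreal r < p" "ennreal r < q" using small_exponent[OF pq] by blast
  define v where "v U \<nu> n = ennreal (cmod (conv (\<phi> \<nu>) (dist_fun (dist_rep U)) n))" for U \<nu> n
  define w where "w U j n = ennreal (cmod (conv (dker \<psi> j) (dist_fun (dist_rep U)) n))" for U j n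
  let ?J = "{j::int. j < 0}"
  obtain A where A: "0 \<le> A" "\<And>u j n. tempered u \<Longrightarrow> j < 0 \<Longrightarrow> ennreal (cmod (conv (dker \<psi> j) u n)) \<le>
     ennreal A * (\<Sum>\<nu>\<in>{..0} \<inter> {j-8..j+8}. avg r (nat (- \<nu>)) (\<lambda>l. ennreal (cmod (conv (\<phi> \<nu>) u l))) n)"
    using dker_conv_le_avg[OF adm pou r(1,2)] by blast
  obtain B where B: "0 \<le> B" "\<And>u \<nu> n. tempered u \<Longrightarrow> \<nu> \<le> 0 \<Longrightarrow> ennreal (cmod (conv (\<phi> \<nu>) u n)) \<le>
     ennreal B * (\<Sum>j\<in>?J \<inter> {\<nu>-8..\<nu>+8}. avg r (nat (- j)) (\<lambda>l. ennreal (cmod (conv (dker \<psi> j) u l))) n)"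
    using admissible_conv_le_avg[OF adm pou r(1,2)] by blast
  have temp: "tempered (dist_fun (dist_rep U))" if "U \<in> dist_mod_poly" for U
    by (rule tempered_dist_fun[OF dist_rep_dual[OF that]])
  have wv: "\<forall>j\<in>?J. \<forall>n. w U j n \<le> ennreal A * (\<Sum>\<nu>\<in>{..0} \<inter> {j-8..j+8}. avg r (nat (- \<nu>)) (v U \<nu>) n)"
    if "U \<in> dist_mod_poly" for U
    using A(2)[OF temp[OF that]] by (simp add: w_def v_def[abs_def])
  have vw: "\<forall>\<nu>\<in>{..0}. \<forall>n. v U \<nu> n \<le> ennreal B * (\<Sum>j\<in>?J \<inter> {\<nu>-8..\<nu>+8}. avg r (nat (- j)) (w U j) n)"
    if "U \<in> dist_mod_poly" for U
    using B(2)[OF temp[OF that]] by (simp add: v_def w_def[abs_def])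
  have cl: "{\<nu>::int. \<nu> \<le> 0} = {..0}" by auto
  have v: "ennreal (cmod (conv_dist (\<phi> \<nu>) U n)) = v U \<nu> n" for U \<nu> n
    by (simp add: v_def conv_dist_def conv_def)
  have w: "ennreal (cmod (dyadic_op \<psi> j U n)) = w U j n" if "U \<in> dist_mod_poly" "j \<in> ?J" for U j n
  proof -
    have "dyadic_op \<psi> j U n = conv (dker \<psi> j) (dist_fun (dist_rep U)) n"
      unfolding dker_def by (rule dyadic_op_eq_conv[OF pou_smooth[OF pou] that(1)]) (use that(2) in simp)
    then show ?thesis by (simp only: w_def)
  qed
  have bn: "besov_norm \<phi> \<alpha> p q U = lpnorm q {..0} (\<lambda>\<nu>. ennreal (2 powr (of_int \<nu> * \<alpha>)) * lpnorm p UNIV (v U \<nu>))" for U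
    unfolding besov_norm_def v cl ..
  have bln: "besov_lap_norm \<psi> \<alpha> p q U = lpnorm q ?J (\<lambda>j. ennreal (2 powr (of_int j * \<alpha>)) * lpnorm p UNIV (w U j))"
    if "U \<in> dist_mod_poly" for U
    unfolding besov_lap_norm_def using w[OF that] by (intro lpnorm_cong) simp
  have tn: "triebel_norm \<phi> \<alpha> p q U = lpnorm p UNIV (\<lambda>n. lpnorm q {..0} (\<lambda>\<nu>. ennreal (2 powr (of_int \<nu> * \<alpha>)) * v U \<nu> n))" for U
    unfolding triebel_norm_def v cl ..
  have tln: "triebel_lap_norm \<psi> \<alpha> p q U = lpnorm p UNIV (\<lambda>n. lpnorm q ?J (\<lambda>j. ennreal (2 powr (of_int j * \<alpha>)) * w U j n))"
    if "U \<in> dist_mod_poly" for U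
    unfolding triebel_lap_norm_def using w[OF that] by (intro lpnorm_cong) simp
  have rp: "ennreal r \<le> p" using r by simp
  have besov: "besov \<phi> \<alpha> p q = besov_lap \<psi> \<alpha> p q \<and>
         equivalent_on (besov \<phi> \<alpha> p q) (besov_norm \<phi> \<alpha> p q) (besov_lap_norm \<psi> \<alpha> p q)"
  proof -
    obtain C where C: "0 \<le> C" and Cle: "\<And>J J' w v. (\<forall>j\<in>J. \<forall>n. w j n \<le> ennreal A * (\<Sum>\<nu>\<in>J' \<inter> {j-8..j+8}. avg r (nat (- \<nu>)) (v \<nu>) n)) \<Longrightarrow>
       lpnorm q J (\<lambda>j::int. ennreal (2 powr (of_int j * \<alpha>)) * lpnorm p UNIV (w j)) \<le>
       ennreal C * lpnorm q J' (\<lambda>\<nu>. ennreal (2 powr (of_int \<nu> * \<alpha>)) * lpnorm p UNIV (v \<nu>))"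
      using besov_compare[OF pq A(1) r(1) rp, of \<alpha>] by blast
    obtain D where D: "0 \<le> D" and Dle: "\<And>J J' w v. (\<forall>j\<in>J. \<forall>n. w j n \<le> ennreal B * (\<Sum>\<nu>\<in>J' \<inter> {j-8..j+8}. avg r (nat (- \<nu>)) (v \<nu>) n)) \<Longrightarrow>
       lpnorm q J (\<lambda>j::int. ennreal (2 powr (of_int j * \<alpha>)) * lpnorm p UNIV (w j)) \<le>
       ennreal D * lpnorm q J' (\<lambda>\<nu>. ennreal (2 powr (of_int \<nu> * \<alpha>)) * lpnorm p UNIV (v \<nu>))"
      using besov_compare[OF pq B(1) r(1) rp, of \<alpha>] by blast
    have le1: "besov_lap_norm \<psi> \<alpha> p q U \<le> ennreal C * besov_norm \<phi> \<alpha> p q U" if "U \<in> dist_mod_poly" for U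
      unfolding bln[OF that] bn by (rule Cle[OF wv[OF that]])
    have le2: "besov_norm \<phi> \<alpha> p q U \<le> ennreal D * besov_lap_norm \<psi> \<alpha> p q U" if "U \<in> dist_mod_poly" for U
      unfolding bln[OF that] bn by (rule Dle[OF vw[OF that]])
    have "besov \<phi> \<alpha> p q = besov_lap \<psi> \<alpha> p q"
      unfolding besov_def besov_lap_def by (rule finite_norm_sets_eq[OF le2 le1])
    moreover have "equivalent_on (besov \<phi> \<alpha> p q) (besov_norm \<phi> \<alpha> p q) (besov_lap_norm \<psi> \<alpha> p q)"
      by (rule equivalent_onI[OF D C]) (auto simp: besov_def intro: le1 le2)
    ultimately show ?thesis by blast
  qed
  have triebel: "triebel \<phi> \<alpha> p q = triebel_lap \<psi> \<alpha> p q \<and>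
         equivalent_on (triebel \<phi> \<alpha> p q) (triebel_norm \<phi> \<alpha> p q) (triebel_lap_norm \<psi> \<alpha> p q)" if p: "p < \<infinity>"
  proof -
    have sub: "?J \<subseteq> {..0}" by auto
    obtain C where C: "0 \<le> C" and Cle: "\<And>J J' w v. J' \<subseteq> {..0} \<Longrightarrow> (\<forall>j\<in>J. \<forall>n. w j n \<le> ennreal A * (\<Sum>\<nu>\<in>J' \<inter> {j-8..j+8}. avg r (nat (- \<nu>)) (v \<nu>) n)) \<Longrightarrow>
       lpnorm p UNIV (\<lambda>n. lpnorm q J (\<lambda>j::int. ennreal (2 powr (of_int j * \<alpha>)) * w j n)) \<le>
       ennreal C * lpnorm p UNIV (\<lambda>n. lpnorm q J' (\<lambda>\<nu>. ennreal (2 powr (of_int \<nu> * \<alpha>)) * v \<nu> n))"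
      using triebel_compare[OF pq p A(1) r(1,3,4), of \<alpha>] by blast
    obtain D where D: "0 \<le> D" and Dle: "\<And>J J' w v. J' \<subseteq> {..0} \<Longrightarrow> (\<forall>j\<in>J. \<forall>n. w j n \<le> ennreal B * (\<Sum>\<nu>\<in>J' \<inter> {j-8..j+8}. avg r (nat (- \<nu>)) (v \<nu>) n)) \<Longrightarrow>
       lpnorm p UNIV (\<lambda>n. lpnorm q J (\<lambda>j::int. ennreal (2 powr (of_int j * \<alpha>)) * w j n)) \<le>
       ennreal D * lpnorm p UNIV (\<lambda>n. lpnorm q J' (\<lambda>\<nu>. ennreal (2 powr (of_int \<nu> * \<alpha>)) * v \<nu> n))"
      using triebel_compare[OF pq p B(1) r(1,3,4), of \<alpha>] by blast
    have le1: "triebel_lap_norm \<psi> \<alpha> p q U \<le> ennreal C * triebel_norm \<phi> \<alpha> p q U" if "U \<in> dist_mod_poly" for U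
      unfolding tln[OF that] tn by (rule Cle[OF order_refl wv[OF that]])
    have le2: "triebel_norm \<phi> \<alpha> p q U \<le> ennreal D * triebel_lap_norm \<psi> \<alpha> p q U" if "U \<in> dist_mod_poly" for U
      unfolding tln[OF that] tn by (rule Dle[OF sub vw[OF that]])
    have "triebel \<phi> \<alpha> p q = triebel_lap \<psi> \<alpha> p q"
      unfolding triebel_def triebel_lap_def by (rule finite_norm_sets_eq[OF le2 le1])
    moreover have "equivalent_on (triebel \<phi> \<alpha> p q) (triebel_norm \<phi> \<alpha> p q) (triebel_lap_norm \<psi> \<alpha> p q)"
      by (rule equivalent_onI[OF D C]) (auto simp: triebel_def intro: le1 le2)
    ultimately show ?thesis by blast
  qed
  from besov triebel show ?thesis by blast
qed

end
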